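(* Let $n\ge2$, $\lambda=(\lambda_1,\lambda_2)\in\mathbb R^2$, $\mu\in\mathbb R$ and $\delta=\mu-\lambda_1-\lambda_2$. If $\delta=\frac{n+2}{n+1}$, there exists a projectively equivariant symbol map for the second order bidifferential operators of $\mathcal M^2_{\mathit{diff}}(\lambda,\mu)$ if and only if $$\lambda\in\left\{\left(0,\tfrac{-1}{n+1}\right),\left(\tfrac{-1}{n+1},0\right),(0,0)\right\},$$ in which case this symbol map is not unique.
   Context: Everything is smooth; $x^1,\dots,x^n$ are the coordinates of $\mathbb R^n$, $\partial_i=\partial/\partial x^i$. For $\lambda\in\mathbb R$, densities of weight $\lambda$ are sections of the trivial line bundle $\Delta^\lambda(\mathbb R^n)$, identified with functions $\phi$ with $L_X\phi=\sum_iX^i\partial_i\phi+\lambda(\sum_i\partial_iX^i)\phi$. $\mathcal M^2_{\mathit{diff}}(\lambda,\mu)$ is the space of bidifferential operators $T:(f,g)\mapsto\sum A_{a,b}D^afD^bg$ (finite sums, $a,b$ multi-indices) from densities of weights $\lambda_1$, $\lambda_2$ to densities of weight $\mu$; the coefficients are $\delta$-densities. Module structure: $(L_XT)(f,g)=L_X(T(f,g))-T(L_Xf,g)-T(f,L_Xg)$. The total order of $T$ is the largest $|a|+|b|$ with $A_{a,b}\neq0$. The second order operators are those of total order not greater than $2$; they form a submodule. $\mathcal S^{(2)}_\delta=\bigoplus_{k,l\ge0}\Gamma(\vee^kT\mathbb R^n\otimes\vee^lT\mathbb R^n\otimes\Delta^\delta(\mathbb R^n))$, viewed as polynomials in $\alpha,\beta\in\mathbb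 R^{n*}$ with $\delta$-densities as coefficients, with $L_XP=\sum_iX^i\partial_iP-\sum_{i,j}(\partial_jX^i)(\alpha_iD_{\alpha_j}+\beta_iD_{\beta_j})P+\delta(\sum_i\partial_iX^i)P$. The polynomial form of $T$ is $\sum A_{a,b}\alpha^a\beta^b\in\mathcal S^{(2)}_\delta$; its principal symbol is the homogeneous component of highest total degree of its polynomial form. $sl_{n+1}$ is the Lie algebra of vector fields spanned by $\partial_i$, $x^j\partial_i$, $x^j\sum_ix^i\partial_i$ ($1\le i,j\le n$). A projectively equivariant symbol map for second order operators is a linear bijection $\sigma$ from the space of operators of total order $\le2$ in $\mathcal M^2_{\mathit{diff}}(\lambda,\mu)$ onto the space of elements of $\mathcal S^{(2)}_\delta$ of total degree $\le2$ in $(\alpha,\beta)$, that preserves the principal symbol (for $T$ of total order $r$, $\sigma(T)$ has degree $r$ and its homogeneous component of total degree $r$ is the principal symbol of $T$) and satisfies $\sigma(L_XT)=L_X(\sigma(T))$ for all $X\in sl_{n+1}$ and all such $T$. *)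

theory Defs
  imports "HOL-Analysis.Analysis"
begin

type_synonym 'n dens = "real^'n \<Rightarrow> real"

definition partial :: "'n::finite \<Rightarrow> 'n dens \<Rightarrow> 'n dens" where
  "partial i f x = frechet_derivative f (at x) (axis i 1)"

(* C^infinity: a function all of whose iterated partial derivatives are differentiable
   has continuous iterated partial derivatives of every order. *)
definition smooth :: "('n::finite) dens \<Rightarrow> bool" where
  "smooth f \<longleftrightarrow> (\<forall>js. foldr partial js f differentiable_on UNIV)"

definition divergence :: "(real^'n \<Rightarrow> real^'n) \<Rightarrow> ('n::finite) dens" where
  "divergence X x = (\<Sum>i\<in>UNIV. partial i (\<lambda>y. X y $ i) x)"

definition lie_dens :: "real \<Rightarrow> (real^'n \<Rightarrow> real^'n) \<Rightarrow> ('n::finite) dens \<Rightarrow> 'n dens" where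
  "lie_dens w X f x = (\<Sum>i\<in>UNIV. X x $ i * partial i f x) + w * divergence X x * f x"


type_synonym 'n multi_index = "'n \<Rightarrow> nat"

definition mi_size :: "('n::finite) multi_index \<Rightarrow> nat" where
  "mi_size a = (\<Sum>i\<in>UNIV. a i)"

definition mi_power :: "real^'n \<Rightarrow> ('n::finite) multi_index \<Rightarrow> real" where
  "mi_power \<alpha> a = (\<Prod>i\<in>UNIV. (\<alpha> $ i) ^ a i)"

(* The order in which the partial derivatives are taken is an arbitrary choice;
   it does not matter for smooth functions. *)
definition mi_deriv :: "('n::finite) multi_index \<Rightarrow> 'n dens \<Rightarrow> 'n dens" where
  "mi_deriv a f = foldr partial (SOME js. \<forall>i. count_list js i = a i) f"


(* Families of coefficients A a b, indexed by pairs of multi-indices, common to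
   bidifferential operators and to their symbols. *)
type_synonym 'n coeffs = "'n multi_index \<Rightarrow> 'n multi_index \<Rightarrow> 'n dens"

definition coeff_supp :: "('n::finite) coeffs \<Rightarrow> ('n multi_index \<times> 'n multi_index) set" where
  "coeff_supp A = {(a, b). A a b \<noteq> (\<lambda>x. 0)}"

definition smooth_coeffs :: "('n::finite) coeffs set" where
  "smooth_coeffs = {A. finite (coeff_supp A) \<and> (\<forall>a b. smooth (A a b))}"

(* The largest |a| + |b| with A a b nonzero; 0 for the zero family. *)
definition coeff_degree :: "('n::finite) coeffs \<Rightarrow> nat" where
  "coeff_degree A = Max (insert 0 ((\<lambda>(a, b). mi_size a + mi_size b) ` coeff_supp A))"

definition coeff_component :: "nat \<Rightarrow> ('n::finite) coeffs \<Rightarrow> 'n coeffs" where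
  "coeff_component r A = (\<lambda>a b. if mi_size a + mi_size b = r then A a b else (\<lambda>x. 0))"


(* Bidifferential operators act on smooth densities only. They are represented as total
   functions with the value 0 whenever an argument is not smooth, so that equality of
   representatives is equality of operators. *)
type_synonym 'n bi_operator = "'n dens \<Rightarrow> 'n dens \<Rightarrow> 'n dens"

definition bidiff_op :: "('n::finite) coeffs \<Rightarrow> 'n bi_operator" where
  "bidiff_op A f g x =
     (if smooth f \<and> smooth g
      then \<Sum>(a, b)\<in>coeff_supp A. A a b x * mi_deriv a f x * mi_deriv b g x else 0)"

(* As a vector space this does not depend on the weights of the densities; these only
   enter the module structure lie_op. *)
definition bidiff_ops :: "('n::finite) bi_operator set" where
  "bidiff_ops = bidiff_op ` smooth_coeffs"

(* A bidifferential operator determines its coefficients. *)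
definition op_coeffs :: "('n::finite) bi_operator \<Rightarrow> 'n coeffs" where
  "op_coeffs T = (THE A. A \<in> smooth_coeffs \<and> bidiff_op A = T)"

definition total_order :: "('n::finite) bi_operator \<Rightarrow> nat" where
  "total_order T = coeff_degree (op_coeffs T)"

definition second_order_ops :: "('n::finite) bi_operator set" where
  "second_order_ops = {T \<in> bidiff_ops. total_order T \<le> 2}"

(* Arguments: weights l1, l2 of the arguments of T and weight m of its values. *)
definition lie_op ::
    "real \<Rightarrow> real \<Rightarrow> real \<Rightarrow> (real^'n \<Rightarrow> real^'n) \<Rightarrow> ('n::finite) bi_operator \<Rightarrow> 'n bi_operator" where
  "lie_op l1 l2 m X T f g x =
     (if smooth f \<and> smooth g
      then lie_dens m X (T f g) x - T (lie_dens l1 X f) g x - T f (lie_dens l2 X g) x else 0)"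


(* P x \<alpha> \<beta>, polynomial in the covectors \<alpha> and \<beta>. *)
type_synonym 'n bi_symbol = "real^'n \<Rightarrow> real^'n \<Rightarrow> real^'n \<Rightarrow> real"

definition bi_symbol_of :: "('n::finite) coeffs \<Rightarrow> 'n bi_symbol" where
  "bi_symbol_of A x \<alpha> \<beta> = (\<Sum>(a, b)\<in>coeff_supp A. A a b x * mi_power \<alpha> a * mi_power \<beta> b)"

definition bi_symbols :: "('n::finite) bi_symbol set" where
  "bi_symbols = bi_symbol_of ` smooth_coeffs"

(* A polynomial function with coefficients in the densities determines its coefficients. *)
definition symbol_coeffs :: "('n::finite) bi_symbol \<Rightarrow> 'n coeffs" where
  "symbol_coeffs P = (THE A. A \<in> smooth_coeffs \<and> bi_symbol_of A = P)"

definition symbol_degree :: "('n::finite) bi_symbol \<Rightarrow> nat" where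
  "symbol_degree P = coeff_degree (symbol_coeffs P)"

definition hom_component :: "nat \<Rightarrow> ('n::finite) bi_symbol \<Rightarrow> 'n bi_symbol" where
  "hom_component r P = bi_symbol_of (coeff_component r (symbol_coeffs P))"

definition second_order_symbols :: "('n::finite) bi_symbol set" where
  "second_order_symbols = {P \<in> bi_symbols. symbol_degree P \<le> 2}"

definition lie_symbol ::
    "real \<Rightarrow> (real^'n \<Rightarrow> real^'n) \<Rightarrow> ('n::finite) bi_symbol \<Rightarrow> 'n bi_symbol" where
  "lie_symbol d X P x \<alpha> \<beta> =
     (\<Sum>i\<in>UNIV. X x $ i * partial i (\<lambda>y. P y \<alpha> \<beta>) x)
     - (\<Sum>i\<in>UNIV. \<Sum>j\<in>UNIV. partial j (\<lambda>y. X y $ i) x *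
          (\<alpha> $ i * partial j (\<lambda>\<xi>. P x \<xi> \<beta>) \<alpha> + \<beta> $ i * partial j (\<lambda>\<xi>. P x \<alpha> \<xi>) \<beta>))
     + d * divergence X x * P x \<alpha> \<beta>"

definition polynomial_form :: "('n::finite) bi_operator \<Rightarrow> 'n bi_symbol" where
  "polynomial_form T = bi_symbol_of (op_coeffs T)"

definition principal_symbol :: "('n::finite) bi_operator \<Rightarrow> 'n bi_symbol" where
  "principal_symbol T = hom_component (symbol_degree (polynomial_form T)) (polynomial_form T)"


(* The vector fields x^j (x^1 d_1 + ... + x^n d_n) are written x $ j *\<^sub>R x. *)
definition sl_fields :: "(real^'n::finite \<Rightarrow> real^'n) set" where
  "sl_fields = {X. \<exists>c A b. X = (\<lambda>x.
     (\<Sum>i\<in>UNIV. c i *\<^sub>R axis i 1)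
     + (\<Sum>i\<in>UNIV. \<Sum>j\<in>UNIV. (A i j * x $ j) *\<^sub>R axis i 1)
     + (\<Sum>j\<in>UNIV. (b j * x $ j) *\<^sub>R x))}"

(* Only the restriction of \<sigma> to second_order_ops is constrained. *)
definition proj_equiv_symbol_map ::
    "real \<Rightarrow> real \<Rightarrow> real \<Rightarrow> (('n::finite) bi_operator \<Rightarrow> 'n bi_symbol) \<Rightarrow> bool" where
  "proj_equiv_symbol_map l1 l2 m \<sigma> \<longleftrightarrow>
     bij_betw \<sigma> second_order_ops second_order_symbols \<and>
     (\<forall>T\<in>second_order_ops. \<forall>S\<in>second_order_ops. \<forall>c d.
        \<sigma> (\<lambda>f g x. c * T f g x + d * S f g x) = (\<lambda>x \<alpha> \<beta>. c * \<sigma> T x \<alpha> \<beta> + d * \<sigma> S x \<alpha> \<beta>)) \<and>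
     (\<forall>T\<in>second_order_ops. symbol_degree (\<sigma> T) = total_order T \<and>
        hom_component (total_order T) (\<sigma> T) = principal_symbol T) \<and>
     (\<forall>X\<in>sl_fields. \<forall>T\<in>second_order_ops.
        \<sigma> (lie_op l1 l2 m X T) = lie_symbol (m - l1 - l2) X (\<sigma> T))"

end

theory Submission
  imports Defs
begin

text \<open>
For a vector field \<open>X\<close> of degree two, the Lie derivative of an operator and the Lie derivative of its
polynomial form differ by terms of lower order that stem from the second derivatives of \<open>X\<close>. For the
fields of \<open>sl\<^sub>n\<^sub>+\<^sub>1\<close> these second derivatives are constant and governed by one covector \<open>b\<close>, so the terms
are contractions of the coefficients with \<open>b\<close> (\<open>lie_op_quad_op\<close>, \<open>lie_symbol_quad_symbol\<close>). A symbol map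
absorbs them by adding divergences of the coefficients, because divergences commute with \<open>L\<^sub>X\<close> only up
to contractions with \<open>b\<close> as well.

The covectors \<open>\<alpha>\<close> and \<open>\<beta>\<close> are treated as one covector with \<open>2 n\<close> components, indexed by slots \<open>(s, i)\<close>:
the side \<open>s\<close> tells the two arguments apart, \<open>w s\<close> is the weight of that argument, and \<open>i\<close> is a coordinate.
An operator of order two is then a triple \<open>(h, U, Q)\<close> of a function, a vector and a symmetric matrix over
the slots.

Two divergences carry \<open>Q\<close> to a function. With weight \<open>\<delta>\<close>, the first contributes \<open>(n + 1) \<delta> - (n + 3)\<close> and
the second \<open>(n + 1) (\<delta> - 1)\<close> times \<open>b\<close> contracted with the divergence of \<open>Q\<close> to the failure of
commutation (for symmetric \<open>Q\<close> on one side). At \<open>\<delta> = (n + 2) / (n + 1)\<close> these are \<open>-1\<close> and \<open>1\<close>, so the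
double divergence is equivariant (\<open>double_divergence_lie2\<close>). Hence a multiple of it can be added to any
symbol map, which destroys uniqueness; and the term of order zero that is left over by the corrections of
the first order cannot be compensated by it. That term vanishes as soon as
\<open>w t * ([s = t] + (n + 1) * w s) = 0\<close> for all sides \<open>s\<close>, \<open>t\<close>, where \<open>[s = t]\<close> is \<open>1\<close> or \<open>0\<close>, and this
condition describes the three pairs of weights of the theorem. Under it the corrected polynomial forms are
symbol maps (\<open>proj_equiv_symbol_map_symbol_map\<close>).

Conversely, a symbol map need not be given by differential operators. Only its component of order zero
matters, which is its value at \<open>\<alpha> = \<beta> = 0\<close>. Translations and the Euler field determine this
component on operators with constant or linear coefficients, and a sum over the fields \<open>x\<^sup>k \<Sum>\<^sub>i x\<^sup>i \<partial>\<^sub>i\<close> in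
which the leading terms cancel leaves an equation between the weights (\<open>symbol_map_obstruction\<close>).
\<close>

section \<open>Partial derivatives of smooth functions\<close>

lemma differentiable_on_UNIV_at: "f differentiable_on UNIV \<Longrightarrow> f differentiable (at x)"
  by (simp add: differentiable_on_def)

lemma smooth_differentiable: "smooth f \<Longrightarrow> f differentiable (at x)"
  unfolding smooth_def by (metis differentiable_on_UNIV_at foldr.simps(1) id_apply)

lemma smooth_partial: "smooth f \<Longrightarrow> smooth (partial i f)"
  unfolding smooth_def
proof
  fix js assume "\<forall>js. foldr partial js f differentiable_on UNIV"
  then have "foldr partial (js @ [i]) f differentiable_on UNIV" by blast
  then show "foldr partial js (partial i f) differentiable_on UNIV" by simp
qed

lemma smooth_iff: "smooth f \<longleftrightarrow> (\<forall>x. f differentiable (at x)) \<and> (\<forall>i. smooth (partial i f))"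
proof
  assume r: "(\<forall>x. f differentiable (at x)) \<and> (\<forall>i. smooth (partial i f))"
  have "foldr partial js f differentiable_on UNIV" for js
  proof (cases js rule: rev_cases)
    case Nil
    then show ?thesis using r by (simp add: differentiable_on_def)
  next
    case (snoc ys y)
    then show ?thesis using r by (simp add: smooth_def)
  qed
  then show "smooth f" by (simp add: smooth_def)
qed (auto simp: smooth_differentiable smooth_partial)

lemma partialI: "(f has_derivative f') (at x) \<Longrightarrow> partial i f x = f' (axis i 1)"
  by (metis frechet_derivative_at partial_def)

lemma has_derivative_partial:
  assumes "f differentiable (at x)"
  shows "(f has_derivative (\<lambda>h. \<Sum>i\<in>UNIV. h $ i * partial i f x)) (at x)"
proof -
  have d: "(f has_derivative frechet_derivative f (at x)) (at x)"
    using assms by (simp add: frechet_derivative_works)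
  then have l: "linear (frechet_derivative f (at x))"
    by (rule has_derivative_linear)
  have "frechet_derivative f (at x) h = (\<Sum>i\<in>UNIV. h $ i * partial i f x)" for h
  proof -
    have "frechet_derivative f (at x) h = frechet_derivative f (at x) (\<Sum>i\<in>UNIV. h $ i *\<^sub>R axis i 1)"
      by (simp add: basis_expansion flip: scalar_mult_eq_scaleR)
    also have "\<dots> = (\<Sum>i\<in>UNIV. h $ i * frechet_derivative f (at x) (axis i 1))"
      by (simp add: linear_sum[OF l] linear_cmul[OF l])
    finally show ?thesis by (simp add: partial_def)
  qed
  then show ?thesis using d by presburger
qed

lemma partial_const: "partial i (\<lambda>x. c) x = 0"
  by (rule partialI[where f'="\<lambda>h. 0", simplified]) simp

lemma partial_coord: "partial i (\<lambda>x. x $ j) x = of_bool (i = j)"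
  by (subst partialI[where f'="\<lambda>h. h $ j"])
    (auto intro!: bounded_linear_imp_has_derivative bounded_linear_vec_nth simp: axis_def)

lemma partial_add:
  assumes "f differentiable (at x)" "g differentiable (at x)"
  shows "partial i (\<lambda>x. f x + g x) x = partial i f x + partial i g x"
proof -
  have "((\<lambda>x. f x + g x) has_derivative (\<lambda>h. (\<Sum>i\<in>UNIV. h $ i * partial i f x) + (\<Sum>i\<in>UNIV. h $ i * partial i g x))) (at x)"
    by (intro has_derivative_add has_derivative_partial assms)
  from partialI[OF this, of i] show ?thesis by (simp add: axis_def if_distrib [of "\<lambda>z. z * _"] cong: if_cong)
qed

lemma partial_mult:
  assumes "f differentiable (at x)" "g differentiable (at x)"
  shows "partial i (\<lambda>x. f x * g x) x = partial i f x * g x + f x * partial i g x"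
proof -
  have "((\<lambda>x. f x * g x) has_derivative (\<lambda>h. f x * (\<Sum>i\<in>UNIV. h $ i * partial i g x) + (\<Sum>i\<in>UNIV. h $ i * partial i f x) * g x)) (at x)"
    by (intro has_derivative_mult has_derivative_partial assms)
  from partialI[OF this, of i] show ?thesis by (simp add: axis_def if_distrib [of "\<lambda>z. z * _"] cong: if_cong)
qed

lemma partial_cmult:
  assumes "f differentiable (at x)"
  shows "partial i (\<lambda>x. c * f x) x = c * partial i f x"
  using partial_mult[of "\<lambda>x. c" x f i] assms by (simp add: partial_const)

lemma partial_minus:
  assumes "f differentiable (at x)"
  shows "partial i (\<lambda>x. - f x) x = - partial i f x"
  using partial_cmult[OF assms, of i "-1"] by simp

lemma partial_diff:
  assumes "f differentiable (at x)" "g differentiable (at x)"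
  shows "partial i (\<lambda>x. f x - g x) x = partial i f x - partial i g x"
  using partial_add[of f x "\<lambda>x. - g x" i] assms
  by (simp add: partial_minus differentiable_minus)

lemma partial_sum:
  assumes "finite I" "\<And>k. k \<in> I \<Longrightarrow> f k differentiable (at x)"
  shows "partial i (\<lambda>x. \<Sum>k\<in>I. f k x) x = (\<Sum>k\<in>I. partial i (f k) x)"
  using assms
proof (induction I rule: finite_induct)
  case (insert a F)
  then show ?case
    by (simp add: partial_add differentiable_sum)
qed (simp add: partial_const)

lemma smooth_const [simp]: "smooth (\<lambda>x. c)"
proof -
  have "foldr partial js (\<lambda>x. c) \<in> range (\<lambda>c x. c)" for js :: "'a list"
  proof (induction js)
    case (Cons i js)
    then obtain d where "foldr partial js (\<lambda>x. c) = (\<lambda>x. d)" by auto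
    then show ?case by (auto simp: partial_const[abs_def])
  qed simp
  then have "foldr partial js (\<lambda>x. c) differentiable_on UNIV" for js :: "'a list"
    by (smt (verit) rangeE differentiable_on_const)
  then show ?thesis by (simp add: smooth_def)
qed

text \<open>Smoothness is a greatest fixed point: it is inherited by every class of differentiable functions that is
closed under partial derivatives.\<close>
lemma smooth_coinduct:
  assumes "P f" and "\<And>f. P f \<Longrightarrow> (\<forall>x. f differentiable (at x)) \<and> (\<forall>i. P (partial i f))"
  shows "smooth f"
proof -
  have "P (foldr partial js f)" for js
    by (induction js) (use assms in auto)
  then show ?thesis
    by (simp add: smooth_def differentiable_on_def assms(2))
qed

text \<open>The derivative of a product is a sum of products, so sums and products are only closed under
differentiation jointly. The algebra generated by the smooth functions is the invariant class to which
coinduction applies.\<close>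
inductive smooth_algebra :: "('n::finite) dens \<Rightarrow> bool" where
  base: "smooth f \<Longrightarrow> smooth_algebra f"
| add: "smooth_algebra f \<Longrightarrow> smooth_algebra g \<Longrightarrow> smooth_algebra (\<lambda>x. f x + g x)"
| mult: "smooth_algebra f \<Longrightarrow> smooth_algebra g \<Longrightarrow> smooth_algebra (\<lambda>x. f x * g x)"

lemma smooth_algebra_smooth: "smooth_algebra f \<Longrightarrow> smooth f"
proof (rule smooth_coinduct[of smooth_algebra])
  fix f :: "'a dens" assume "smooth_algebra f"
  then show "(\<forall>x. f differentiable (at x)) \<and> (\<forall>i. smooth_algebra (partial i f))"
  proof induction
    case (base f)
    then show ?case
      by (auto simp: smooth_differentiable intro: smooth_algebra.base smooth_partial)
  next
    case (add f g)
    then have "partial i (\<lambda>x. f x + g x) = (\<lambda>x. partial i f x + partial i g x)" for i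
      by (auto simp: partial_add)
    then show ?case using add by (auto intro!: smooth_algebra.add)
  next
    case (mult f g)
    then have "partial i (\<lambda>x. f x * g x) = (\<lambda>x. partial i f x * g x + f x * partial i g x)" for i
      by (auto simp: partial_mult)
    then show ?case using mult by (auto intro!: smooth_algebra.add smooth_algebra.mult)
  qed
qed

lemma smooth_add : "smooth f \<Longrightarrow> smooth g \<Longrightarrow> smooth (\<lambda>x. f x + g x)"
  by (rule smooth_algebra_smooth) (simp add: smooth_algebra.intros)

lemma smooth_mult : "smooth f \<Longrightarrow> smooth g \<Longrightarrow> smooth (\<lambda>x. f x * g x)"
  by (rule smooth_algebra_smooth) (simp add: smooth_algebra.intros)

lemma smooth_minus : "smooth f \<Longrightarrow> smooth (\<lambda>x. - f x)"
  using smooth_mult[of "\<lambda>x. -1" f] by simp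

lemma smooth_diff : "smooth f \<Longrightarrow> smooth g \<Longrightarrow> smooth (\<lambda>x. f x - g x)"
  using smooth_add[OF _ smooth_minus, of f g] by simp

lemma smooth_sum : "(\<And>k. k \<in> I \<Longrightarrow> smooth (f k)) \<Longrightarrow> smooth (\<lambda>x. \<Sum>k\<in>I. f k x)"
  by (induction I rule: infinite_finite_induct) (simp_all add: smooth_add)

lemma smooth_coord [simp]: "smooth (\<lambda>x. x $ i)"
proof -
  have "(\<lambda>x. x $ i) differentiable (at x)" for x :: "real^'a"
    by (rule bounded_linear_imp_differentiable[OF bounded_linear_vec_nth])
  moreover have "smooth (partial j (\<lambda>x. x $ i))" for j :: 'a
    by (simp add: partial_coord[abs_def])
  ultimately show ?thesis using smooth_iff by blast
qed

text \<open>The second difference of \<open>f\<close> over a square of side \<open>h\<close> is an expression symmetric in \<open>i\<close> and \<open>j\<close>; the mean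
value theorem, applied in one direction after the other, turns it into a mixed derivative at a nearby
point.\<close>
lemma second_difference:
  assumes "smooth f" "h > 0"
  shows "\<exists>s t. 0 < s \<and> s < h \<and> 0 < t \<and> t < h \<and>
    f (x + h *\<^sub>R axis i 1 + h *\<^sub>R axis j 1) - f (x + h *\<^sub>R axis i 1) - f (x + h *\<^sub>R axis j 1) + f x
      = h * h * partial j (partial i f) (x + s *\<^sub>R axis i 1 + t *\<^sub>R axis j 1)"
proof -
  have line: "((\<lambda>s. g (y + s *\<^sub>R axis k 1)) has_real_derivative partial k g (y + s *\<^sub>R axis k 1)) (at s)"
    if "smooth g" for g k y and s :: real
  proof -
    have "((\<lambda>s. g (y + s *\<^sub>R axis k 1)) has_derivative
        (\<lambda>u. \<Sum>i\<in>UNIV. (u *\<^sub>R axis k 1) $ i * partial i g (y + s *\<^sub>R axis k 1))) (at s)"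
    proof (rule has_derivative_compose[OF _ has_derivative_partial[OF smooth_differentiable[OF that]]])
      show "((\<lambda>s. y + s *\<^sub>R axis k 1) has_derivative (\<lambda>u. u *\<^sub>R axis k 1)) (at s)"
        by (auto intro!: derivative_eq_intros)
    qed
    moreover have "(\<lambda>u. \<Sum>i\<in>UNIV. (u *\<^sub>R axis k 1) $ i * partial i g (y + s *\<^sub>R axis k 1))
        = (*) (partial k g (y + s *\<^sub>R axis k 1))"
      by (auto simp: axis_def if_distrib[of "\<lambda>z. z * _"] if_distrib[of "\<lambda>z. _ * z"] cong: if_cong)
    ultimately show ?thesis by (simp add: has_field_derivative_def)
  qed
  let ?i = "axis i 1 :: real^'a" and ?j = "axis j 1 :: real^'a"
  \<comment> \<open>the increment in direction \<open>j\<close>, as a function on the edge in direction \<open>i\<close>\<close>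
  define \<phi> where "\<phi> s = f ((x + h *\<^sub>R ?j) + s *\<^sub>R ?i) - f (x + s *\<^sub>R ?i)" for s
  have "\<exists>s. 0 < s \<and> s < h \<and> \<phi> h - \<phi> 0 = (h - 0) *
      (partial i f ((x + h *\<^sub>R ?j) + s *\<^sub>R ?i) - partial i f (x + s *\<^sub>R ?i))"
    unfolding \<phi>_def using assms by (intro MVT2 DERIV_diff line)
  then obtain s where s: "0 < s" "s < h" "\<phi> h - \<phi> 0 = h *
      (partial i f ((x + s *\<^sub>R ?i) + h *\<^sub>R ?j) - partial i f ((x + s *\<^sub>R ?i) + 0 *\<^sub>R ?j))"
    by (auto simp: algebra_simps)
  have "\<exists>t. 0 < t \<and> t < h \<and> partial i f ((x + s *\<^sub>R ?i) + h *\<^sub>R ?j) - partial i f ((x + s *\<^sub>R ?i) + 0 *\<^sub>R ?j)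
      = (h - 0) * partial j (partial i f) ((x + s *\<^sub>R ?i) + t *\<^sub>R ?j)"
    using assms by (intro MVT2 line smooth_partial)
  then obtain t where t: "0 < t" "t < h" "partial i f ((x + s *\<^sub>R ?i) + h *\<^sub>R ?j) - partial i f ((x + s *\<^sub>R ?i) + 0 *\<^sub>R ?j)
      = h * partial j (partial i f) ((x + s *\<^sub>R ?i) + t *\<^sub>R ?j)"
    by auto
  have "f (x + h *\<^sub>R ?i + h *\<^sub>R ?j) - f (x + h *\<^sub>R ?i) - f (x + h *\<^sub>R ?j) + f x = \<phi> h - \<phi> 0"
    by (simp add: \<phi>_def algebra_simps)
  also have "\<dots> = h * h * partial j (partial i f) (x + s *\<^sub>R ?i + t *\<^sub>R ?j)"
    using s(3) t(3) by simp
  finally show ?thesis using s(1,2) t(1,2) by blast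
qed

text \<open>Both mixed derivatives are limits of the same second differences as the square shrinks to \<open>x\<close>.\<close>
lemma partial_commute:
  assumes "smooth f"
  shows "partial i (partial j f) = partial j (partial i f)"
proof
  fix x
  let ?i = "axis i 1 :: real^'a" and ?j = "axis j 1 :: real^'a"
  define h where "h n = inverse (real (Suc n))" for n
  have h: "h n > 0" "h \<longlonglongrightarrow> 0" for n
    using LIMSEQ_inverse_real_of_nat by (auto simp: h_def[abs_def])
  have "\<exists>s t u v. 0 < s \<and> s < h n \<and> 0 < t \<and> t < h n \<and> 0 < u \<and> u < h n \<and> 0 < v \<and> v < h n \<and>
      partial j (partial i f) (x + s *\<^sub>R ?i + t *\<^sub>R ?j) = partial i (partial j f) (x + u *\<^sub>R ?j + v *\<^sub>R ?i)" for n
  proof -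
    obtain s t where st: "0 < s" "s < h n" "0 < t" "t < h n"
      "f (x + h n *\<^sub>R ?i + h n *\<^sub>R ?j) - f (x + h n *\<^sub>R ?i) - f (x + h n *\<^sub>R ?j) + f x
        = h n * h n * partial j (partial i f) (x + s *\<^sub>R ?i + t *\<^sub>R ?j)"
      using second_difference[OF assms h(1)] by blast
    obtain u v where uv: "0 < u" "u < h n" "0 < v" "v < h n"
      "f (x + h n *\<^sub>R ?j + h n *\<^sub>R ?i) - f (x + h n *\<^sub>R ?j) - f (x + h n *\<^sub>R ?i) + f x
        = h n * h n * partial i (partial j f) (x + u *\<^sub>R ?j + v *\<^sub>R ?i)"
      using second_difference[OF assms h(1)] by blast
    have "f (x + h n *\<^sub>R ?j + h n *\<^sub>R ?i) = f (x + h n *\<^sub>R ?i + h n *\<^sub>R ?j)"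
      by (simp add: add_ac)
    then have "h n * h n * partial j (partial i f) (x + s *\<^sub>R ?i + t *\<^sub>R ?j)
        = h n * h n * partial i (partial j f) (x + u *\<^sub>R ?j + v *\<^sub>R ?i)"
      using st(5) uv(5) by linarith
    moreover have "h n * h n \<noteq> 0" using h(1)[of n] by simp
    ultimately have "partial j (partial i f) (x + s *\<^sub>R ?i + t *\<^sub>R ?j)
        = partial i (partial j f) (x + u *\<^sub>R ?j + v *\<^sub>R ?i)"
      using mult_left_cancel by blast
    then show ?thesis using st(1-4) uv(1-4) by blast
  qed
  then obtain s t u v where b: "\<And>n. 0 < s n \<and> s n < h n \<and> 0 < t n \<and> t n < h n \<and> 0 < u n \<and> u n < h n \<and> 0 < v n \<and> v n < h n"
    and e: "\<And>n. partial j (partial i f) (x + s n *\<^sub>R ?i + t n *\<^sub>R ?j) = partial i (partial j f) (x + u n *\<^sub>R ?j + v n *\<^sub>R ?i)"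
    by metis
  have lim: "r \<longlonglongrightarrow> 0" if "\<And>n. 0 < r n \<and> r n < h n" for r
    by (rule tendsto_sandwich[OF _ _ tendsto_const h(2)]) (use that in \<open>auto intro: always_eventually less_imp_le\<close>)
  have st: "s \<longlonglongrightarrow> 0" "t \<longlonglongrightarrow> 0" "u \<longlonglongrightarrow> 0" "v \<longlonglongrightarrow> 0"
    by (intro lim; use b in blast)+
  have cont: "isCont (partial k (partial l f)) x" for k l
    using assms by (simp add: differentiable_imp_continuous_within smooth_differentiable smooth_partial)
  have "(\<lambda>n. x + s n *\<^sub>R ?i + t n *\<^sub>R ?j) \<longlonglongrightarrow> x + 0 *\<^sub>R ?i + 0 *\<^sub>R ?j"
    by (intro tendsto_intros st)
  then have 1: "(\<lambda>n. partial j (partial i f) (x + s n *\<^sub>R ?i + t n *\<^sub>R ?j)) \<longlonglongrightarrow> partial j (partial i f) x"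
    using isCont_tendsto_compose[OF cont] by simp
  have "(\<lambda>n. x + u n *\<^sub>R ?j + v n *\<^sub>R ?i) \<longlonglongrightarrow> x + 0 *\<^sub>R ?j + 0 *\<^sub>R ?i"
    by (intro tendsto_intros st)
  then have 2: "(\<lambda>n. partial i (partial j f) (x + u n *\<^sub>R ?j + v n *\<^sub>R ?i)) \<longlonglongrightarrow> partial i (partial j f) x"
    using isCont_tendsto_compose[OF cont] by simp
  show "partial i (partial j f) x = partial j (partial i f) x"
    using 1 2 LIMSEQ_unique unfolding e by blast
qed

section \<open>Coefficients are determined by symbols and by operators\<close>

text \<open>A polynomial that vanishes identically has no coefficients. The induction is on the set \<open>I\<close> of variables:
with the other variables fixed, the polynomial in the new variable has zero coefficients, and each of
these is a polynomial in fewer variables. The third assumption says that the exponents in \<open>F\<close> are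
distinguished by their restriction to \<open>I\<close>.\<close>
lemma multivariate_polynomial_zero_aux:
  fixes A :: "('k \<Rightarrow> nat) \<Rightarrow> real"
  assumes "finite I" "finite F"
    and "\<And>c d. c \<in> F \<Longrightarrow> d \<in> F \<Longrightarrow> (\<forall>i\<in>I. c i = d i) \<Longrightarrow> c = d"
    and "\<And>t. (\<Sum>c\<in>F. A c * (\<Prod>i\<in>I. t i ^ c i)) = 0" and "c \<in> F"
  shows "A c = 0"
  using assms
proof (induction I arbitrary: F rule: finite_induct)
  case empty
  then have "F = {c}" by blast
  then show ?case using empty by simp
next
  case (insert k I)
  define N where "N = Max ((\<lambda>c. c k) ` F)"
  have N: "d k \<le> N" if "d \<in> F" for d
    using that insert.prems(1) by (simp add: N_def)
  define G where "G = {d \<in> F. d k = c k}"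
  have "(\<Sum>d\<in>G. A d * (\<Prod>i\<in>I. t i ^ d i)) = 0" for t
  proof -
    have "(\<Sum>m\<le>N. (\<Sum>d\<in>{d \<in> F. d k = m}. A d * (\<Prod>i\<in>I. t i ^ d i)) * y ^ m) = 0" for y
    proof -
      have "0 = (\<Sum>d\<in>F. A d * (\<Prod>i\<in>insert k I. (t(k := y)) i ^ d i))"
        using insert.prems(3) by simp
      also have "\<dots> = (\<Sum>d\<in>F. A d * (\<Prod>i\<in>I. t i ^ d i) * y ^ d k)"
      proof (intro sum.cong refl)
        fix d
        have "(\<Prod>i\<in>I. (t(k := y)) i ^ d i) = (\<Prod>i\<in>I. t i ^ d i)"
          using insert.hyps by (intro prod.cong) auto
        then show "A d * (\<Prod>i\<in>insert k I. (t(k := y)) i ^ d i) = A d * (\<Prod>i\<in>I. t i ^ d i) * y ^ d k"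
          using insert.hyps by simp
      qed
      also have "\<dots> = (\<Sum>m\<le>N. \<Sum>d\<in>{d \<in> F. d k = m}. A d * (\<Prod>i\<in>I. t i ^ d i) * y ^ d k)"
        by (rule sum.group[symmetric]) (use insert.prems(1) N in auto)
      also have "\<dots> = (\<Sum>m\<le>N. (\<Sum>d\<in>{d \<in> F. d k = m}. A d * (\<Prod>i\<in>I. t i ^ d i)) * y ^ m)"
        by (auto intro!: sum.cong simp: sum_distrib_right)
      finally show ?thesis by simp
    qed
    then have "\<forall>m\<le>N. (\<Sum>d\<in>{d \<in> F. d k = m}. A d * (\<Prod>i\<in>I. t i ^ d i)) = 0"
      using polyfun_eq_0[of "\<lambda>m. \<Sum>d\<in>{d \<in> F. d k = m}. A d * (\<Prod>i\<in>I. t i ^ d i)" N] by blast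
    then show ?thesis
      using N insert.prems(4) by (simp add: G_def)
  qed
  then show ?case
    using insert.prems by (intro insert.IH[of G]) (auto simp: G_def)
qed

lemma multivariate_polynomial_zero:
  fixes A :: "('k::finite \<Rightarrow> nat) \<Rightarrow> real"
  assumes "finite F" "\<And>t. (\<Sum>c\<in>F. A c * (\<Prod>i\<in>UNIV. t i ^ c i)) = 0" "c \<in> F"
  shows "A c = 0"
  using multivariate_polynomial_zero_aux[of UNIV F A c] assms by auto

text \<open>A slot \<open>(s, i)\<close> is the coordinate \<open>i\<close> of \<open>\<alpha>\<close> (\<open>s = False\<close>) or of \<open>\<beta>\<close> (\<open>s = True\<close>); likewise it is a
derivative in direction \<open>i\<close> of the first or of the second argument. A pair of multi-indices becomes a
single exponent function on slots.\<close>
type_synonym 'n slot = "bool \<times> 'n"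

definition slot_index :: "'n multi_index \<Rightarrow> 'n multi_index \<Rightarrow> 'n slot \<Rightarrow> nat" where
  "slot_index a b p = (if fst p then b (snd p) else a (snd p))"

definition left_index :: "('n slot \<Rightarrow> nat) \<Rightarrow> 'n multi_index" where
  "left_index c = (\<lambda>i. c (False, i))"

definition right_index :: "('n slot \<Rightarrow> nat) \<Rightarrow> 'n multi_index" where
  "right_index c = (\<lambda>i. c (True, i))"

definition slot_var :: "real^'n \<Rightarrow> real^'n \<Rightarrow> 'n slot \<Rightarrow> real" where
  "slot_var \<alpha> \<beta> p = (if fst p then \<beta> $ snd p else \<alpha> $ snd p)"

lemma index_slot_index [simp]:
  "left_index (slot_index a b) = a" "right_index (slot_index a b) = b"
  "slot_index (left_index c) (right_index c) = c"
  by (auto simp: left_index_def right_index_def slot_index_def)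

lemma slot_index_eq_iff: "slot_index a b = c \<longleftrightarrow> a = left_index c \<and> b = right_index c"
  by auto

lemma sum_slot: "(\<Sum>p\<in>UNIV. F p) = (\<Sum>i\<in>UNIV. F (False, i)) + (\<Sum>i\<in>UNIV. F (True, i))"
  for F :: "'n::finite slot \<Rightarrow> 'b::comm_monoid_add"
  by (simp add: UNIV_Times_UNIV[symmetric] sum.cartesian_product' UNIV_bool add.commute
      del: UNIV_Times_UNIV)

lemma prod_slot: "(\<Prod>p\<in>UNIV. F p) = (\<Prod>i\<in>UNIV. F (False, i)) * (\<Prod>i\<in>UNIV. F (True, i))"
  for F :: "'n::finite slot \<Rightarrow> 'b::comm_monoid_mult"
  by (simp add: UNIV_Times_UNIV[symmetric] prod.cartesian_product' UNIV_bool mult.commute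
      del: UNIV_Times_UNIV)

lemma mi_power_slot:
  "mi_power \<alpha> a * mi_power \<beta> b = (\<Prod>p\<in>UNIV. slot_var \<alpha> \<beta> p ^ slot_index a b p)"
  by (simp add: prod_slot mi_power_def slot_var_def slot_index_def)

lemma mi_size_slot: "mi_size a + mi_size b = (\<Sum>p\<in>UNIV. slot_index a b p)"
  by (simp add: sum_slot mi_size_def slot_index_def)

lemma sum_coeff_supp_superset:
  assumes "finite S" "coeff_supp A \<subseteq> S"
  shows "(\<Sum>(a, b)\<in>coeff_supp A. A a b x * F a b) = (\<Sum>(a, b)\<in>S. A a b x * F a b)"
  using assms by (intro sum.mono_neutral_left) (auto simp: coeff_supp_def)

lemma bi_symbol_of_inj: "inj_on bi_symbol_of smooth_coeffs"
proof (rule inj_onI)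
  fix A B :: "'n::finite coeffs"
  assume A: "A \<in> smooth_coeffs" and B: "B \<in> smooth_coeffs" and eq: "bi_symbol_of A = bi_symbol_of B"
  let ?S = "coeff_supp A \<union> coeff_supp B"
  have fin: "finite ?S" using A B by (simp add: smooth_coeffs_def)
  have "A a b x = B a b x" for a b x
  proof (cases "(a, b) \<in> ?S")
    case True
    let ?D = "\<lambda>c. A (left_index c) (right_index c) x - B (left_index c) (right_index c) x"
    have "?D (slot_index a b) = 0"
    proof (rule multivariate_polynomial_zero[where F="(\<lambda>(a, b). slot_index a b) ` ?S"])
      fix t :: "'n slot \<Rightarrow> real"
      define \<alpha> :: "real^'n" where "\<alpha> = (\<chi> i. t (False, i))"
      define \<beta> :: "real^'n" where "\<beta> = (\<chi> i. t (True, i))"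
      have t: "t = slot_var \<alpha> \<beta>"
        by (auto simp: slot_var_def \<alpha>_def \<beta>_def fun_eq_iff)
      have sym: "bi_symbol_of C x \<alpha> \<beta> = (\<Sum>(a, b)\<in>?S. C a b x * (mi_power \<alpha> a * mi_power \<beta> b))"
        if "coeff_supp C \<subseteq> ?S" for C
        using sum_coeff_supp_superset[OF fin that, of x "\<lambda>a b. mi_power \<alpha> a * mi_power \<beta> b"]
        by (simp add: bi_symbol_of_def mult.assoc)
      have "(\<Sum>c\<in>(\<lambda>(a, b). slot_index a b) ` ?S. ?D c * (\<Prod>i\<in>UNIV. t i ^ c i)) =
          (\<Sum>(a, b)\<in>?S. (A a b x - B a b x) * (\<Prod>i\<in>UNIV. t i ^ slot_index a b i))"
        by (subst sum.reindex) (auto intro!: inj_onI sum.cong simp: slot_index_eq_iff)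
      also have "\<dots> = bi_symbol_of A x \<alpha> \<beta> - bi_symbol_of B x \<alpha> \<beta>"
        by (subst (1 2) sym) (auto simp: t mi_power_slot sum_subtractf[symmetric] left_diff_distrib intro!: sum.cong)
      finally show "(\<Sum>c\<in>(\<lambda>(a, b). slot_index a b) ` ?S. ?D c * (\<Prod>i\<in>UNIV. t i ^ c i)) = 0"
        by (simp add: eq)
    qed (use fin True in auto)
    then show ?thesis by simp
  qed (simp add: coeff_supp_def)
  then show "A = B" by blast
qed

lemma ex_list_of_multi_index: "\<exists>js. \<forall>i. count_list js i = a i" for a :: "('n::finite) multi_index"
proof -
  have "finite {x. 0 < a x}" by simp
  then obtain js where "mset js = Abs_multiset a" "count (Abs_multiset a) = a"
    by (metis count_Abs_multiset ex_mset)
  then show ?thesis by (metis count_mset)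
qed

lemma mi_deriv_list:
  obtains js where "\<And>i. count_list js i = a i" "\<And>f. mi_deriv a f = foldr partial js f"
  using someI_ex[OF ex_list_of_multi_index[of a]] by (auto simp: mi_deriv_def)

definition exp_dens :: "real^'n \<Rightarrow> ('n::finite) dens" where
  "exp_dens \<alpha> x = exp (\<alpha> \<bullet> x)"

lemma exp_dens_derivative:
  "(exp_dens \<alpha> has_derivative (\<lambda>h. (\<alpha> \<bullet> h) * exp_dens \<alpha> x)) (at x)"
  unfolding exp_dens_def[abs_def] by (auto intro!: derivative_eq_intros)

lemma partial_exp_dens: "partial i (exp_dens \<alpha>) = (\<lambda>x. \<alpha> $ i * exp_dens \<alpha> x)"
  by (rule ext, subst partialI[OF exp_dens_derivative]) (simp add: inner_axis)

lemma partial_cmult_exp_dens: "partial i (\<lambda>x. c * exp_dens \<alpha> x) = (\<lambda>x. c * \<alpha> $ i * exp_dens \<alpha> x)"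
proof -
  have "exp_dens \<alpha> differentiable (at x)" for x
    using exp_dens_derivative differentiable_def by blast
  then have "partial i (\<lambda>x. c * exp_dens \<alpha> x) x = c * \<alpha> $ i * exp_dens \<alpha> x" for x
    by (subst partial_cmult) (auto simp: partial_exp_dens)
  then show ?thesis by blast
qed

lemma smooth_exp_dens: "smooth (exp_dens \<alpha>)"
proof (rule smooth_coinduct[of "\<lambda>f. \<exists>c. f = (\<lambda>x. c * exp_dens \<alpha> x)"])
  show "\<exists>c. exp_dens \<alpha> = (\<lambda>x. c * exp_dens \<alpha> x)" by (rule exI[of _ 1]) simp
  fix f assume "\<exists>c. f = (\<lambda>x. c * exp_dens \<alpha> x)"
  then obtain c where f: "f = (\<lambda>x. c * exp_dens \<alpha> x)" by blast
  have "exp_dens \<alpha> differentiable (at x)" for x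
    using exp_dens_derivative differentiable_def by blast
  then have "f differentiable (at x)" for x
    by (simp add: f)
  then show "(\<forall>x. f differentiable at x) \<and> (\<forall>i. \<exists>c. partial i f = (\<lambda>x. c * exp_dens \<alpha> x))"
    by (auto simp: f partial_cmult_exp_dens)
qed

lemma mi_deriv_exp_dens: "mi_deriv a (exp_dens \<alpha>) x = mi_power \<alpha> a * exp_dens \<alpha> x"
proof -
  obtain js where js: "\<And>i. count_list js i = a i" "\<And>f. mi_deriv a f = foldr partial js f"
    using mi_deriv_list[of a] by blast
  have "foldr partial js (exp_dens \<alpha>) = (\<lambda>x. mi_power \<alpha> (count_list js) * exp_dens \<alpha> x)" for js
  proof (induction js)
    case Nil
    then show ?case by (simp add: mi_power_def)
  next
    case (Cons i js)
    have "mi_power \<alpha> (count_list (i # js)) =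
        (\<Prod>j\<in>UNIV. (\<alpha> $ j) ^ count_list js j * (if j = i then \<alpha> $ i else 1))"
      unfolding mi_power_def by (rule prod.cong) auto
    then have "mi_power \<alpha> (count_list (i # js)) = mi_power \<alpha> (count_list js) * \<alpha> $ i"
      by (simp add: prod.distrib mi_power_def)
    then show ?case using Cons.IH by (simp add: partial_cmult_exp_dens del: count_list.simps)
  qed
  moreover have "count_list js = a" using js(1) by blast
  ultimately show ?thesis using js(2) by simp
qed

text \<open>Exponentials are common eigenfunctions of all derivatives, so evaluating an operator on them returns its
polynomial form. This reduces uniqueness of the coefficients of an operator to that of polynomials.\<close>
lemma bidiff_op_exp_dens:
  "bidiff_op A (exp_dens \<alpha>) (exp_dens \<beta>) x = bi_symbol_of A x \<alpha> \<beta> * (exp_dens \<alpha> x * exp_dens \<beta> x)"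
  by (simp add: bidiff_op_def bi_symbol_of_def smooth_exp_dens mi_deriv_exp_dens sum_distrib_left sum_distrib_right
      case_prod_unfold mult_ac)

lemma bidiff_op_inj: "inj_on bidiff_op smooth_coeffs"
proof (rule inj_onI)
  fix A B :: "'n::finite coeffs"
  assume AB: "A \<in> smooth_coeffs" "B \<in> smooth_coeffs" and eq: "bidiff_op A = bidiff_op B"
  have "bi_symbol_of A x \<alpha> \<beta> = bi_symbol_of B x \<alpha> \<beta>" for x \<alpha> \<beta>
    using bidiff_op_exp_dens[of A \<alpha> \<beta> x] bidiff_op_exp_dens[of B \<alpha> \<beta> x]
    by (simp add: eq exp_dens_def)
  then have "bi_symbol_of A = bi_symbol_of B" by blast
  then show "A = B" by (rule inj_onD[OF bi_symbol_of_inj _ AB])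
qed

lemma op_coeffs_bidiff_op: "A \<in> smooth_coeffs \<Longrightarrow> op_coeffs (bidiff_op A) = A"
  unfolding op_coeffs_def by (rule the_equality) (auto dest: inj_onD[OF bidiff_op_inj])

lemma symbol_coeffs_bi_symbol_of: "A \<in> smooth_coeffs \<Longrightarrow> symbol_coeffs (bi_symbol_of A) = A"
  unfolding symbol_coeffs_def by (rule the_equality) (auto dest: inj_onD[OF bi_symbol_of_inj])

section \<open>Operators and symbols of order two\<close>

text \<open>The exponents of degree one and two: \<open>index1 p\<close> stands for the monomial of the slot \<open>p\<close>, \<open>index2 p q\<close> for the
product of two slots, in which \<open>p\<close> and \<open>q\<close> may coincide.\<close>
definition index1 :: "'n slot \<Rightarrow> 'n slot \<Rightarrow> nat" where
  "index1 p r = of_bool (r = p)"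

definition index2 :: "'n slot \<Rightarrow> 'n slot \<Rightarrow> 'n slot \<Rightarrow> nat" where
  "index2 p q r = of_bool (r = p) + of_bool (r = q)"

text \<open>The bilinear operators \<open>jet1 p\<close> and \<open>jet2 p q\<close> have the polynomial forms \<open>\<xi>\<^sub>p\<close> and \<open>\<xi>\<^sub>p \<xi>\<^sub>q\<close>, where \<open>\<xi>\<close> is the
joint covector \<open>(\<alpha>, \<beta>)\<close>.\<close>
definition jet1 :: "('n::finite) slot \<Rightarrow> 'n bi_operator" where
  "jet1 p f g x = (if fst p then f x * partial (snd p) g x else partial (snd p) f x * g x)"

definition jet2 :: "('n::finite) slot \<Rightarrow> 'n slot \<Rightarrow> 'n bi_operator" where
  "jet2 p q f g x =
     (if fst p
      then if fst q then f x * partial (snd p) (partial (snd q) g) x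
           else partial (snd q) f x * partial (snd p) g x
      else if fst q then partial (snd p) f x * partial (snd q) g x
           else partial (snd p) (partial (snd q) f) x * g x)"

text \<open>Every pair of slots contributes \<open>Q p q\<close> to the coefficient of the monomial \<open>\<xi>\<^sub>p \<xi>\<^sub>q\<close>. An unordered pair of
distinct slots is therefore counted twice, and only symmetric \<open>Q\<close> is determined by the coefficients.\<close>
definition quad_coeffs ::
    "'n dens \<Rightarrow> ('n slot \<Rightarrow> 'n dens) \<Rightarrow> ('n slot \<Rightarrow> 'n slot \<Rightarrow> 'n dens) \<Rightarrow> ('n::finite) coeffs" where
  "quad_coeffs h U Q a b x =
     (if slot_index a b = (\<lambda>p. 0) then h x else 0)
     + (\<Sum>p\<in>UNIV. if slot_index a b = index1 p then U p x else 0)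
     + (\<Sum>p\<in>UNIV. \<Sum>q\<in>UNIV. if slot_index a b = index2 p q then Q p q x else 0)"

definition quad_op ::
    "'n dens \<Rightarrow> ('n slot \<Rightarrow> 'n dens) \<Rightarrow> ('n slot \<Rightarrow> 'n slot \<Rightarrow> 'n dens) \<Rightarrow> ('n::finite) bi_operator" where
  "quad_op h U Q f g x =
     (if smooth f \<and> smooth g
      then h x * (f x * g x) + (\<Sum>p\<in>UNIV. U p x * jet1 p f g x)
        + (\<Sum>p\<in>UNIV. \<Sum>q\<in>UNIV. Q p q x * jet2 p q f g x)
      else 0)"

definition quad_symbol ::
    "'n dens \<Rightarrow> ('n slot \<Rightarrow> 'n dens) \<Rightarrow> ('n slot \<Rightarrow> 'n slot \<Rightarrow> 'n dens) \<Rightarrow> ('n::finite) bi_symbol" where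
  "quad_symbol h U Q x \<alpha> \<beta> =
     h x + (\<Sum>p\<in>UNIV. U p x * slot_var \<alpha> \<beta> p)
     + (\<Sum>p\<in>UNIV. \<Sum>q\<in>UNIV. Q p q x * (slot_var \<alpha> \<beta> p * slot_var \<alpha> \<beta> q))"

definition smooth_quad ::
    "'n dens \<Rightarrow> ('n slot \<Rightarrow> 'n dens) \<Rightarrow> ('n slot \<Rightarrow> 'n slot \<Rightarrow> ('n::finite) dens) \<Rightarrow> bool" where
  "smooth_quad h U Q \<longleftrightarrow> smooth h \<and> (\<forall>p. smooth (U p)) \<and> (\<forall>p q. smooth (Q p q))"

definition symmetric :: "('a \<Rightarrow> 'a \<Rightarrow> 'b) \<Rightarrow> bool" where
  "symmetric Q \<longleftrightarrow> (\<forall>p q. Q p q = Q q p)"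

lemma sum_index [simp]:
  "(\<Sum>r\<in>UNIV. index1 p r) = 1" "(\<Sum>r\<in>UNIV. index2 p q r) = 2" for p :: "('n::finite) slot"
  by (simp_all add: index1_def index2_def sum.distrib)

lemma index_neq:
  "index1 p \<noteq> (\<lambda>p. 0)" "index2 p q \<noteq> (\<lambda>p. 0)" "index2 p q \<noteq> index1 r"
  "(\<lambda>p. 0) \<noteq> index1 p" "(\<lambda>p. 0) \<noteq> index2 p q" "index1 r \<noteq> index2 p q"
  for p q r :: "('n::finite) slot"
  by (metis sum_index sum.neutral_const zero_neq_one zero_neq_numeral one_eq_numeral_iff num.distinct(1))+

lemma index1_eq_iff: "index1 p = index1 q \<longleftrightarrow> p = q"
proof
  assume "index1 p = index1 q"
  then have "index1 p p = index1 q p" by simp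
  then show "p = q" by (simp add: index1_def of_bool_def split: if_splits)
qed simp

lemma index2_eq_iff: "index2 p q = index2 r s \<longleftrightarrow> (p = r \<and> q = s) \<or> (p = s \<and> q = r)"
proof
  assume eq: "index2 p q = index2 r s"
  then have at: "of_bool (x = p) + of_bool (x = q) = (of_bool (x = r) + of_bool (x = s) :: nat)" for x
    unfolding index2_def by (rule fun_cong)
  have "p = r \<or> p = s"
    using at[of p] by (cases "p = r"; cases "p = s") simp_all
  then show "(p = r \<and> q = s) \<or> (p = s \<and> q = r)"
  proof
    assume "p = r"
    then have "q = s" using at[of q] by (cases "q = s") simp_all
    then show ?thesis using \<open>p = r\<close> by simp
  next
    assume "p = s"
    then have "q = r" using at[of q] by (cases "q = r") simp_all
    then show ?thesis using \<open>p = s\<close> by simp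
  qed
qed (auto simp: index2_def fun_eq_iff)

lemma index2_commute: "index2 p q = index2 q p"
  by (auto simp: index2_def)

lemma ex_index_Suc:
  fixes c :: "('n::finite) slot \<Rightarrow> nat"
  assumes "(\<Sum>r\<in>UNIV. c r) = Suc m"
  obtains p d where "c = (\<lambda>r. index1 p r + d r)" "(\<Sum>r\<in>UNIV. d r) = m"
proof -
  obtain p where p: "c p > 0"
    using assms by (metis (no_types, lifting) not_gr_zero old.nat.distinct(2) sum.neutral)
  define d where "d = c(p := c p - 1)"
  have c: "c = (\<lambda>r. index1 p r + d r)"
    using p by (auto simp: d_def index1_def)
  moreover have "(\<Sum>r\<in>UNIV. d r) = m"
    using assms by (simp add: c sum.distrib)
  ultimately show thesis by (rule that)
qed

lemma index_cases:
  fixes c :: "('n::finite) slot \<Rightarrow> nat"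
  assumes "(\<Sum>r\<in>UNIV. c r) \<le> 2"
  obtains "c = (\<lambda>p. 0)" | p where "c = index1 p" | p q where "c = index2 p q"
proof -
  have 0: "d = (\<lambda>p. 0)" if "(\<Sum>r\<in>UNIV. d r) = 0" for d :: "'n slot \<Rightarrow> nat"
    using that by auto
  have 1: "\<exists>p. d = index1 p" if "(\<Sum>r\<in>UNIV. d r) = Suc 0" for d :: "'n slot \<Rightarrow> nat"
  proof -
    obtain p e where "d = (\<lambda>r. index1 p r + e r)" "(\<Sum>r\<in>UNIV. e r) = 0"
      using ex_index_Suc[OF \<open>(\<Sum>r\<in>UNIV. d r) = Suc 0\<close>] .
    then have "d = index1 p" using 0[of e] by simp
    then show ?thesis by blast
  qed
  have 2: "\<exists>p q. d = index2 p q" if "(\<Sum>r\<in>UNIV. d r) = Suc (Suc 0)" for d :: "'n slot \<Rightarrow> nat"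
  proof -
    obtain p e where e: "d = (\<lambda>r. index1 p r + e r)" "(\<Sum>r\<in>UNIV. e r) = Suc 0"
      using ex_index_Suc[OF \<open>(\<Sum>r\<in>UNIV. d r) = Suc (Suc 0)\<close>] .
    then obtain q where "e = index1 q" using 1 by blast
    then have "d = index2 p q" by (simp add: e(1) index1_def index2_def fun_eq_iff)
    then show ?thesis by blast
  qed
  have "(\<Sum>r\<in>UNIV. c r) = 0 \<or> (\<Sum>r\<in>UNIV. c r) = Suc 0 \<or> (\<Sum>r\<in>UNIV. c r) = Suc (Suc 0)"
    using assms by linarith
  then show thesis using 0 1 2 that by blast
qed

text \<open>The order of differentiation hidden in \<open>mi_deriv\<close> is irrelevant, by symmetry of second derivatives.\<close>
lemma mi_deriv_eq_foldr:
  assumes "smooth f" "length js \<le> 2" "\<And>i. a i = count_list js i"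
  shows "mi_deriv a f = foldr partial js f"
proof -
  obtain ks where ks: "\<And>i. count_list ks i = a i" "\<And>f. mi_deriv a f = foldr partial ks f"
    using mi_deriv_list[of a] by blast
  have eq: "mset ks = mset js"
    by (rule multiset_eqI) (simp add: ks(1) assms(3) count_mset)
  consider "js = []" | i where "js = [i]" | i j where "js = [i, j]"
  proof -
    have "length js = 0 \<or> length js = Suc 0 \<or> length js = Suc (Suc 0)" using assms(2) by linarith
    then show thesis using that by (auto simp: length_Suc_conv)
  qed
  then have "foldr partial ks f = foldr partial js f"
  proof cases
    case (3 i j)
    then have "length ks = Suc (Suc 0)" using eq by (metis length_Cons list.size(3) size_mset)
    then obtain k l where "ks = [k, l]" by (auto simp: length_Suc_conv)
    then show ?thesis using eq 3 partial_commute[OF assms(1)]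
      by (auto simp: add_eq_conv_diff)
  qed (use eq in auto)
  then show ?thesis by (simp add: ks(2))
qed

definition index_jet :: "('n::finite) dens \<Rightarrow> 'n dens \<Rightarrow> real^'n \<Rightarrow> ('n slot \<Rightarrow> nat) \<Rightarrow> real" where
  "index_jet f g x c = mi_deriv (left_index c) f x * mi_deriv (right_index c) g x"

lemma index_jet_eq:
  fixes f g :: "('n::finite) dens"
  assumes "smooth f" "smooth g"
  shows "index_jet f g x (\<lambda>p. 0) = f x * g x"
    and "index_jet f g x (index1 p) = jet1 p f g x"
    and "index_jet f g x (index2 p q) = jet2 p q f g x"
proof -
  have 0: "mi_deriv (\<lambda>i. 0) f = f" if "smooth f" for f :: "'n dens"
    using mi_deriv_eq_foldr[OF that, of "[]"] by simp
  have 1: "mi_deriv (\<lambda>j. of_bool (j = i)) f = partial i f" if "smooth f" for f :: "'n dens" and i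
  proof -
    have "mi_deriv (\<lambda>j. of_bool (j = i)) f = foldr partial [i] f"
      using that by (intro mi_deriv_eq_foldr) auto
    then show ?thesis by simp
  qed
  have 2: "mi_deriv (\<lambda>k. of_bool (k = i) + of_bool (k = j)) f = partial i (partial j f)" if "smooth f" for f :: "'n dens" and i j
  proof -
    have "mi_deriv (\<lambda>k. of_bool (k = i) + of_bool (k = j)) f = foldr partial [i, j] f"
      using that by (intro mi_deriv_eq_foldr) auto
    then show ?thesis by simp
  qed
  show "index_jet f g x (\<lambda>p. 0) = f x * g x"
    by (simp add: index_jet_def left_index_def right_index_def 0 assms)
  show "index_jet f g x (index1 p) = jet1 p f g x"
    by (cases p) (auto simp: index_jet_def left_index_def right_index_def index1_def jet1_def 0 1 assms)
  show "index_jet f g x (index2 p q) = jet2 p q f g x"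
    by (cases p; cases q)
      (auto simp: index_jet_def left_index_def right_index_def index2_def jet2_def 0 1 2 assms)
qed

definition small_indices :: "(('n::finite) multi_index \<times> 'n multi_index) set" where
  "small_indices = (\<lambda>c. (left_index c, right_index c)) `
     (insert (\<lambda>p. 0) (range index1 \<union> range (\<lambda>(p, q). index2 p q)))"

lemma finite_small_indices: "finite small_indices"
  by (simp add: small_indices_def)

lemma small_indices_iff: "(a, b) \<in> small_indices \<longleftrightarrow> mi_size a + mi_size b \<le> 2"
proof
  assume "(a, b) \<in> small_indices"
  then show "mi_size a + mi_size b \<le> 2"
    by (auto simp: small_indices_def mi_size_slot)
next
  assume "mi_size a + mi_size b \<le> 2"
  then have "(\<Sum>p\<in>UNIV. slot_index a b p) \<le> 2" by (simp add: mi_size_slot)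
  then obtain c where "slot_index a b = c" "c \<in> insert (\<lambda>p. 0) (range index1 \<union> range (\<lambda>(p, q). index2 p q))"
    by (rule index_cases) auto
  then show "(a, b) \<in> small_indices"
    unfolding small_indices_def by (intro image_eqI[of _ _ c]) (auto simp: slot_index_eq_iff)
qed

lemma coeff_supp_quad_coeffs:
  fixes h :: "('n::finite) dens"
  shows "coeff_supp (quad_coeffs h U Q) \<subseteq> small_indices"
proof clarify
  fix a b :: "'n multi_index" assume supp: "(a, b) \<in> coeff_supp (quad_coeffs h U Q)"
  show "(a, b) \<in> small_indices"
  proof (rule ccontr)
    assume "(a, b) \<notin> small_indices"
    then have "(\<Sum>r\<in>UNIV. slot_index a b r) > 2"
      by (simp add: small_indices_iff mi_size_slot)
    then have "slot_index a b \<noteq> (\<lambda>p. 0)" "slot_index a b \<noteq> index1 p" "slot_index a b \<noteq> index2 p q" for p q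
      by auto
    then have "quad_coeffs h U Q a b = (\<lambda>x. 0)"
      by (simp add: quad_coeffs_def[abs_def])
    then show False using supp by (simp add: coeff_supp_def)
  qed
qed

text \<open>A sum over the support of the coefficients, taken over unordered monomials, becomes a sum over ordered
pairs of slots. Applied to two choices of \<open>F\<close> it evaluates both the operator and its polynomial form.\<close>
lemma quad_coeffs_sum:
  fixes h :: "('n::finite) dens"
  shows "(\<Sum>(a, b)\<in>coeff_supp (quad_coeffs h U Q). quad_coeffs h U Q a b x * F (slot_index a b)) =
    h x * F (\<lambda>p. 0) + (\<Sum>p\<in>UNIV. U p x * F (index1 p)) + (\<Sum>p\<in>UNIV. \<Sum>q\<in>UNIV. Q p q x * F (index2 p q))"
proof -
  have single: "(\<Sum>(a, b)\<in>small_indices. if slot_index a b = c then v * F c else 0) = v * F c"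
    if "(left_index c, right_index c) \<in> small_indices" for c :: "'n slot \<Rightarrow> nat" and v :: real
  proof -
    have "(\<Sum>(a, b)\<in>small_indices. if slot_index a b = c then v * F c else 0) =
        (\<Sum>y\<in>small_indices. if y = (left_index c, right_index c) then v * F c else 0)"
      by (intro sum.cong refl) (simp add: case_prod_unfold prod_eq_iff slot_index_eq_iff)
    also have "\<dots> = v * F c"
      using that by (simp only: sum.delta[OF finite_small_indices] if_True)
    finally show ?thesis .
  qed
  have at_index: "(if slot_index a b = c then v else 0) * F (slot_index a b) = (if slot_index a b = c then v * F c else 0)"
    for a b c and v :: real
    by simp
  have swap2: "(\<Sum>y\<in>S. \<Sum>p\<in>UNIV. \<Sum>q\<in>UNIV. G y p q) = (\<Sum>p\<in>UNIV. \<Sum>q\<in>UNIV. \<Sum>y\<in>S. G y p q)"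
    for G :: "'c \<Rightarrow> 'n slot \<Rightarrow> 'n slot \<Rightarrow> real" and S
    by (subst sum.swap) (intro sum.cong refl sum.swap)
  have "(\<Sum>(a, b)\<in>coeff_supp (quad_coeffs h U Q). quad_coeffs h U Q a b x * F (slot_index a b)) =
      (\<Sum>(a, b)\<in>small_indices. quad_coeffs h U Q a b x * F (slot_index a b))"
    by (rule sum_coeff_supp_superset[OF finite_small_indices coeff_supp_quad_coeffs])
  also have "\<dots> = (\<Sum>(a, b)\<in>small_indices.
      (if slot_index a b = (\<lambda>p :: 'n slot. 0) then h x * F (\<lambda>p. 0) else 0)
     + (\<Sum>p\<in>UNIV. if slot_index a b = index1 p then U p x * F (index1 p) else 0)
     + (\<Sum>p\<in>UNIV. \<Sum>q\<in>UNIV. if slot_index a b = index2 p q then Q p q x * F (index2 p q) else 0))"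
    unfolding quad_coeffs_def distrib_right sum_distrib_right at_index ..
  also have "\<dots> = (\<Sum>(a, b)\<in>small_indices. if slot_index a b = (\<lambda>p :: 'n slot. 0) then h x * F (\<lambda>p. 0) else 0)
     + (\<Sum>p\<in>UNIV. \<Sum>(a, b)\<in>small_indices. if slot_index a b = index1 p then U p x * F (index1 p) else 0)
     + (\<Sum>p\<in>UNIV. \<Sum>q\<in>UNIV. \<Sum>(a, b)\<in>small_indices. if slot_index a b = index2 p q then Q p q x * F (index2 p q) else 0)"
    unfolding case_prod_unfold sum.distrib swap2
    by (subst sum.swap[where A=small_indices and B=UNIV]) (rule refl)
  also have "\<dots> = h x * F (\<lambda>p. 0) + (\<Sum>p\<in>UNIV. U p x * F (index1 p)) + (\<Sum>p\<in>UNIV. \<Sum>q\<in>UNIV. Q p q x * F (index2 p q))"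
    by (subst (1 2 3) single) (auto simp: small_indices_def)
  finally show ?thesis .
qed

lemma bidiff_op_quad_coeffs: "bidiff_op (quad_coeffs h U Q) = quad_op h U Q"
proof (intro ext)
  fix f g x
  show "bidiff_op (quad_coeffs h U Q) f g x = quad_op h U Q f g x"
    using quad_coeffs_sum[of h U Q x "index_jet f g x"]
    by (auto simp: bidiff_op_def quad_op_def index_jet_eq) (simp add: index_jet_def mult.assoc)
qed

lemma bi_symbol_of_quad_coeffs: "bi_symbol_of (quad_coeffs h U Q) = quad_symbol h U Q"
proof (intro ext)
  fix x \<alpha> \<beta>
  have "(\<Prod>p\<in>UNIV. v p ^ index1 r p) = v r" for r and v :: "'a slot \<Rightarrow> real"
    by (simp add: index1_def of_bool_def if_distrib[of "\<lambda>n. _ ^ n"] cong: if_cong)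
  moreover have "index2 r s = (\<lambda>p. index1 r p + index1 s p)" for r s :: "'a slot"
    by (simp add: index1_def index2_def fun_eq_iff)
  ultimately show "bi_symbol_of (quad_coeffs h U Q) x \<alpha> \<beta> = quad_symbol h U Q x \<alpha> \<beta>"
    using quad_coeffs_sum[of h U Q x "\<lambda>c. \<Prod>p\<in>UNIV. slot_var \<alpha> \<beta> p ^ c p"]
    by (simp add: bi_symbol_of_def quad_symbol_def mi_power_slot mult.assoc power_add prod.distrib)
qed

lemma smooth_if_zero: "smooth f \<Longrightarrow> smooth (\<lambda>x. if P then f x else 0)"
  by (cases P) auto

lemma quad_coeffs_smooth:
  assumes "smooth_quad h U Q"
  shows "quad_coeffs h U Q \<in> smooth_coeffs"
proof -
  have "smooth (quad_coeffs h U Q a b)" for a b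
    using assms unfolding quad_coeffs_def[abs_def] smooth_quad_def
    by (intro smooth_add smooth_sum smooth_if_zero) auto
  then show ?thesis
    using finite_subset[OF coeff_supp_quad_coeffs finite_small_indices]
    by (auto simp: smooth_coeffs_def)
qed

lemma coeff_degree_le_iff:
  assumes "finite (coeff_supp A)"
  shows "coeff_degree A \<le> r \<longleftrightarrow> (\<forall>a b. r < mi_size a + mi_size b \<longrightarrow> A a b = (\<lambda>x. 0))"
proof -
  have "coeff_degree A \<le> r \<longleftrightarrow> (\<forall>(a, b)\<in>coeff_supp A. mi_size a + mi_size b \<le> r)"
    using assms by (simp add: coeff_degree_def case_prod_unfold)
  also have "\<dots> \<longleftrightarrow> (\<forall>a b. r < mi_size a + mi_size b \<longrightarrow> A a b = (\<lambda>x. 0))"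
    unfolding coeff_supp_def using not_less by blast
  finally show ?thesis .
qed

lemma coeff_degree_quad_coeffs: "coeff_degree (quad_coeffs h U Q) \<le> 2"
proof -
  have "quad_coeffs h U Q a b = (\<lambda>x. 0)" if "2 < mi_size a + mi_size b" for a b
  proof -
    have "(a, b) \<notin> small_indices" using that by (simp add: small_indices_iff)
    then have "(a, b) \<notin> coeff_supp (quad_coeffs h U Q)" using coeff_supp_quad_coeffs by blast
    then show ?thesis by (simp add: coeff_supp_def)
  qed
  then show ?thesis
    using coeff_degree_le_iff[OF finite_subset[OF coeff_supp_quad_coeffs finite_small_indices]] by blast
qed

lemma quad_coeffs_eval:
  "quad_coeffs h U Q (left_index (\<lambda>p. 0)) (right_index (\<lambda>p. 0)) x = h x"
  "quad_coeffs h U Q (left_index (index1 p)) (right_index (index1 p)) x = U p x"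
  "quad_coeffs h U Q (left_index (index2 p q)) (right_index (index2 p q)) x =
    (if p = q then Q p p x else Q p q x + Q q p x)"
proof -
  show "quad_coeffs h U Q (left_index (\<lambda>p. 0)) (right_index (\<lambda>p. 0)) x = h x"
    "quad_coeffs h U Q (left_index (index1 p)) (right_index (index1 p)) x = U p x"
    by (simp_all add: quad_coeffs_def index_neq index1_eq_iff)
  have single: "(if index2 p q = index2 r s then Q r s x else 0) =
      (if s = q then if r = p then Q p q x else 0 else 0) +
      (if s = p then if r = q then if p = q then 0 else Q q p x else 0 else 0)" for r s
    unfolding index2_eq_iff by (cases "r = p"; cases "s = q"; cases "r = q"; cases "s = p") simp_all
  have "quad_coeffs h U Q (left_index (index2 p q)) (right_index (index2 p q)) x =
      (\<Sum>r\<in>UNIV. \<Sum>s\<in>UNIV. if index2 p q = index2 r s then Q r s x else 0)"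
    by (simp only: quad_coeffs_def index_slot_index index_neq if_False sum.neutral_const add_0)
  also have "\<dots> = (if p = q then Q p p x else Q p q x + Q q p x)"
    unfolding single sum.distrib by (cases "p = q") simp_all
  finally show "quad_coeffs h U Q (left_index (index2 p q)) (right_index (index2 p q)) x =
      (if p = q then Q p p x else Q p q x + Q q p x)" .
qed

text \<open>The coefficient of a mixed monomial is split evenly between the two orders of its slots.\<close>
lemma symmetric_quad_cases:
  assumes A: "A \<in> smooth_coeffs" "coeff_degree A \<le> 2"
  obtains h U Q where "smooth_quad h U Q" "symmetric Q" "A = quad_coeffs h U Q"
proof
  let ?A = "\<lambda>c. A (left_index c) (right_index c)"
  let ?h = "?A (\<lambda>p. 0)" and ?U = "\<lambda>p. ?A (index1 p)"
    and ?Q = "\<lambda>p q x. (if p = q then 1 else 1 / 2) * ?A (index2 p q) x"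
  show "smooth_quad ?h ?U ?Q"
  proof -
    have "smooth (A a b)" for a b
      using A by (simp add: smooth_coeffs_def)
    then show ?thesis
      unfolding smooth_quad_def by (intro conjI allI smooth_mult smooth_const)
  qed
  show "symmetric ?Q"
    unfolding symmetric_def
  proof (intro allI)
    fix p q :: "'a slot"
    show "?Q p q = ?Q q p"
      unfolding index2_commute[of q p] by (cases "p = q") simp_all
  qed
  have "A a b x = quad_coeffs ?h ?U ?Q a b x" for a b x
  proof (cases "mi_size a + mi_size b \<le> 2")
    case True
    then have "(\<Sum>p\<in>UNIV. slot_index a b p) \<le> 2" by (simp add: mi_size_slot)
    then show ?thesis
    proof (cases rule: index_cases)
      case 1
      then have ab: "a = left_index (\<lambda>p. 0)" "b = right_index (\<lambda>p. 0)" by (simp_all add: slot_index_eq_iff)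
      show ?thesis unfolding ab quad_coeffs_eval ..
    next
      case (2 p)
      then have ab: "a = left_index (index1 p)" "b = right_index (index1 p)" by (simp_all add: slot_index_eq_iff)
      show ?thesis unfolding ab quad_coeffs_eval ..
    next
      case (3 p q)
      then have ab: "a = left_index (index2 p q)" "b = right_index (index2 p q)" by (simp_all add: slot_index_eq_iff)
      show ?thesis unfolding ab quad_coeffs_eval by (simp add: index2_commute[of q p])
    qed
  next
    case False
    then have "A a b = (\<lambda>x. 0)"
      using A coeff_degree_le_iff[of A 2] by (simp add: smooth_coeffs_def)
    moreover have "(a, b) \<notin> coeff_supp (quad_coeffs ?h ?U ?Q)"
      using False coeff_supp_quad_coeffs small_indices_iff by blast
    ultimately show ?thesis by (simp add: coeff_supp_def)
  qed
  then show "A = quad_coeffs ?h ?U ?Q" by (intro ext)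
qed

lemma quad_coeffs_inj:
  assumes "symmetric Q" "symmetric Q'" "quad_coeffs h U Q = quad_coeffs h' U' Q'"
  shows "h = h' \<and> U = U' \<and> Q = Q'"
proof -
  have e: "quad_coeffs h U Q a b x = quad_coeffs h' U' Q' a b x" for a b x
    by (simp add: assms(3))
  have "h x = h' x" for x
    using e[of "left_index (\<lambda>p. 0)" "right_index (\<lambda>p. 0)" x] unfolding quad_coeffs_eval .
  moreover have "U p x = U' p x" for p x
    using e[of "left_index (index1 p)" "right_index (index1 p)" x] unfolding quad_coeffs_eval .
  moreover have "Q p q x = Q' p q x" for p q x
  proof -
    have "Q q p = Q p q" "Q' q p = Q' p q" using assms unfolding symmetric_def by blast+
    then show ?thesis
      using e[of "left_index (index2 p q)" "right_index (index2 p q)" x] unfolding quad_coeffs_eval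
      by (cases "p = q") simp_all
  qed
  ultimately show ?thesis by (intro conjI ext)
qed

lemma quad_op_second_order:
  assumes "smooth_quad h U Q"
  shows "quad_op h U Q \<in> second_order_ops"
  using quad_coeffs_smooth[OF assms] coeff_degree_quad_coeffs[of h U Q]
  unfolding bidiff_op_quad_coeffs[symmetric]
  by (simp add: second_order_ops_def bidiff_ops_def total_order_def op_coeffs_bidiff_op)

lemma quad_symbol_second_order:
  assumes "smooth_quad h U Q"
  shows "quad_symbol h U Q \<in> second_order_symbols"
  using quad_coeffs_smooth[OF assms] coeff_degree_quad_coeffs[of h U Q]
  unfolding bi_symbol_of_quad_coeffs[symmetric]
  by (simp add: second_order_symbols_def bi_symbols_def symbol_degree_def symbol_coeffs_bi_symbol_of)

lemma second_order_op_cases: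
  assumes "T \<in> second_order_ops"
  obtains h U Q where "smooth_quad h U Q" "symmetric Q" "T = quad_op h U Q"
proof -
  obtain A where A: "A \<in> smooth_coeffs" "T = bidiff_op A" "coeff_degree A \<le> 2"
    using assms by (auto simp: second_order_ops_def bidiff_ops_def total_order_def op_coeffs_bidiff_op)
  obtain h U Q where q: "smooth_quad h U Q" "symmetric Q" "A = quad_coeffs h U Q"
    using symmetric_quad_cases[OF A(1,3)] .
  show thesis
    using that[OF q(1,2)] by (simp add: A(2) q(3) bidiff_op_quad_coeffs)
qed

lemma second_order_symbol_cases:
  assumes "P \<in> second_order_symbols"
  obtains h U Q where "smooth_quad h U Q" "symmetric Q" "P = quad_symbol h U Q"
proof -
  obtain A where A: "A \<in> smooth_coeffs" "P = bi_symbol_of A" "coeff_degree A \<le> 2"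
    using assms by (auto simp: second_order_symbols_def bi_symbols_def symbol_degree_def symbol_coeffs_bi_symbol_of)
  obtain h U Q where q: "smooth_quad h U Q" "symmetric Q" "A = quad_coeffs h U Q"
    using symmetric_quad_cases[OF A(1,3)] .
  show thesis
    using that[OF q(1,2)] by (simp add: A(2) q(3) bi_symbol_of_quad_coeffs)
qed

lemma quad_op_inj:
  assumes "smooth_quad h U Q" "symmetric Q" "smooth_quad h' U' Q'" "symmetric Q'"
    and "quad_op h U Q = quad_op h' U' Q'"
  shows "h = h' \<and> U = U' \<and> Q = Q'"
proof (rule quad_coeffs_inj[OF assms(2,4)])
  show "quad_coeffs h U Q = quad_coeffs h' U' Q'"
    using assms by (intro inj_onD[OF bidiff_op_inj]) (auto simp: bidiff_op_quad_coeffs quad_coeffs_smooth)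
qed

lemma quad_symbol_inj:
  assumes "smooth_quad h U Q" "symmetric Q" "smooth_quad h' U' Q'" "symmetric Q'"
    and "quad_symbol h U Q = quad_symbol h' U' Q'"
  shows "h = h' \<and> U = U' \<and> Q = Q'"
proof (rule quad_coeffs_inj[OF assms(2,4)])
  show "quad_coeffs h U Q = quad_coeffs h' U' Q'"
    using assms by (intro inj_onD[OF bi_symbol_of_inj]) (auto simp: bi_symbol_of_quad_coeffs quad_coeffs_smooth)
qed

section \<open>Lie derivatives along projective vector fields\<close>

definition field_jacobian :: "(real^'n \<Rightarrow> real^'n) \<Rightarrow> 'n \<Rightarrow> 'n \<Rightarrow> ('n::finite) dens" where
  "field_jacobian X i j = partial j (\<lambda>y. X y $ i)"

text \<open>Of the fields in \<open>sl\<^sub>n\<^sub>+\<^sub>1\<close> only the shape of their second derivatives matters. The covector \<open>b\<close> is the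
coefficient vector of the quadratic part \<open>(\<Sum>\<^sub>j b\<^sub>j x\<^sup>j) \<Sum>\<^sub>i x\<^sup>i \<partial>\<^sub>i\<close>.\<close>
definition projective_field :: "(real^'n \<Rightarrow> real^'n) \<Rightarrow> (('n::finite) \<Rightarrow> real) \<Rightarrow> bool" where
  "projective_field X b \<longleftrightarrow> (\<forall>i. smooth (\<lambda>y. X y $ i)) \<and>
     (\<forall>i j k x. partial k (field_jacobian X i j) x = of_bool (i = j) * b k + of_bool (i = k) * b j)"

abbreviation succ_dim :: "'n::finite itself \<Rightarrow> real" where
  "succ_dim n \<equiv> real CARD('n) + 1"

text \<open>These are the Lie derivatives of tensors over the slots: \<open>L\<^sub>X\<close> acts on the coordinate of a slot as on a
vector index and leaves its side alone.\<close>
definition lie1 :: "real \<Rightarrow> (real^'n \<Rightarrow> real^'n) \<Rightarrow> ('n slot \<Rightarrow> 'n dens) \<Rightarrow> 'n slot \<Rightarrow> ('n::finite) dens" where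
  "lie1 d X U p x = lie_dens d X (U p) x - (\<Sum>j\<in>UNIV. field_jacobian X (snd p) j x * U (fst p, j) x)"

definition lie2 :: "real \<Rightarrow> (real^'n \<Rightarrow> real^'n) \<Rightarrow> ('n slot \<Rightarrow> 'n slot \<Rightarrow> 'n dens) \<Rightarrow>
    'n slot \<Rightarrow> 'n slot \<Rightarrow> ('n::finite) dens" where
  "lie2 d X Q p q x = lie_dens d X (Q p q) x
     - (\<Sum>j\<in>UNIV. field_jacobian X (snd p) j x * Q (fst p, j) q x)
     - (\<Sum>j\<in>UNIV. field_jacobian X (snd q) j x * Q p (fst q, j) x)"

text \<open>The terms by which \<open>L\<^sub>X\<close> of an operator differs from \<open>L\<^sub>X\<close> of its polynomial form: a first order term
\<open>U\<close> loses a function, a second order term \<open>Q\<close> loses a vector.\<close>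
definition twist1 :: "(bool \<Rightarrow> real) \<Rightarrow> ('n \<Rightarrow> real) \<Rightarrow> ('n slot \<Rightarrow> 'n dens) \<Rightarrow> ('n::finite) dens" where
  "twist1 w b U x = (\<Sum>p\<in>UNIV. U p x * b (snd p) * (succ_dim TYPE('n) * w (fst p)))"

definition twist2 :: "(bool \<Rightarrow> real) \<Rightarrow> ('n \<Rightarrow> real) \<Rightarrow> ('n slot \<Rightarrow> 'n slot \<Rightarrow> 'n dens) \<Rightarrow>
    'n slot \<Rightarrow> ('n::finite) dens" where
  "twist2 w b Q q x = (\<Sum>p\<in>UNIV. (Q p q x + Q q p x) * b (snd p) *
     (of_bool (fst p = fst q) + succ_dim TYPE('n) * w (fst p)))"

lemma projective_field_smooth:
  assumes "projective_field X b"
  shows "smooth (\<lambda>y. X y $ i)" "smooth (field_jacobian X i j)"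
  using assms by (auto simp: projective_field_def field_jacobian_def smooth_partial)

lemma partial_jacobian:
  "projective_field X b \<Longrightarrow>
    partial k (field_jacobian X i j) x = of_bool (i = j) * b k + of_bool (i = k) * b j"
  by (simp add: projective_field_def)

lemma divergence_jacobian: "divergence X = (\<lambda>x. \<Sum>i\<in>UNIV. field_jacobian X i i x)"
  by (simp add: fun_eq_iff divergence_def field_jacobian_def)

lemma smooth_divergence: "projective_field X b \<Longrightarrow> smooth (divergence X)"
  unfolding divergence_jacobian by (intro smooth_sum projective_field_smooth)

text \<open>The trace of \<open>\<partial>\<^sub>k \<partial>\<^sub>j X\<^sup>i\<close> over \<open>i = j\<close> gives \<open>n b\<^sub>k\<close> from the first and \<open>b\<^sub>k\<close> from the second summand.\<close>
lemma partial_divergence: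
  fixes X :: "real^'n::finite \<Rightarrow> real^'n"
  assumes "projective_field X b"
  shows "partial k (divergence X) x = succ_dim TYPE('n) * b k"
  unfolding divergence_jacobian using projective_field_smooth[OF assms]
  by (subst partial_sum) (simp_all add: smooth_differentiable partial_jacobian[OF assms] sum.distrib algebra_simps)

lemma smooth_lie_dens:
  assumes "projective_field X b" "smooth f"
  shows "smooth (lie_dens w X f)"
  unfolding lie_dens_def[abs_def]
  by (intro smooth_add smooth_sum smooth_mult smooth_const smooth_partial assms
      projective_field_smooth[OF assms(1)] smooth_divergence[OF assms(1)])

lemma lie_dens_add:
  assumes "smooth f" "smooth g"
  shows "lie_dens w X (\<lambda>x. f x + g x) x = lie_dens w X f x + lie_dens w X g x"
  using assms by (simp add: lie_dens_def partial_add smooth_differentiable sum.distrib algebra_simps)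

lemma lie_dens_sum:
  assumes "finite I" "\<And>k. k \<in> I \<Longrightarrow> smooth (f k)"
  shows "lie_dens w X (\<lambda>x. \<Sum>k\<in>I. f k x) x = (\<Sum>k\<in>I. lie_dens w X (f k) x)"
  using assms
proof (induction I rule: finite_induct)
  case (insert a F)
  then show ?case by (simp add: lie_dens_add smooth_sum)
qed (simp add: lie_dens_def partial_const)

lemma lie_dens_mult:
  assumes "smooth f" "smooth g" "w = u + v"
  shows "lie_dens w X (\<lambda>x. f x * g x) x = lie_dens u X f x * g x + f x * lie_dens v X g x"
  using assms by (simp add: lie_dens_def partial_mult smooth_differentiable sum.distrib sum_distrib_left
      sum_distrib_right algebra_simps)

lemma partial_lie_dens:
  fixes X :: "real^'n::finite \<Rightarrow> real^'n"
  assumes X: "projective_field X b" and f: "smooth f"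
  shows "partial j (lie_dens w X f) x =
    lie_dens w X (partial j f) x + (\<Sum>i\<in>UNIV. field_jacobian X i j x * partial i f x)
      + w * succ_dim TYPE('n) * b j * f x"
proof -
  have sm: "smooth (\<lambda>y. X y $ i)" "smooth (partial i f)" "smooth (divergence X)" for i
    using projective_field_smooth[OF X] smooth_divergence[OF X] f by (auto intro: smooth_partial)
  have 1: "partial j (lie_dens w X f) x =
      partial j (\<lambda>x. \<Sum>i\<in>UNIV. X x $ i * partial i f x) x + partial j (\<lambda>x. w * (divergence X x * f x)) x"
    unfolding lie_dens_def[abs_def] mult.assoc
    by (intro partial_add smooth_differentiable smooth_sum smooth_mult sm f smooth_const)
  have 2: "partial j (\<lambda>x. w * (divergence X x * f x)) x = w * (succ_dim TYPE('n) * b j * f x + divergence X x * partial j f x)"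
    by (subst partial_cmult) (simp_all add: smooth_differentiable smooth_mult sm f partial_mult partial_divergence[OF X])
  have 3: "partial j (\<lambda>x. \<Sum>i\<in>UNIV. X x $ i * partial i f x) x =
      (\<Sum>i\<in>UNIV. field_jacobian X i j x * partial i f x + X x $ i * partial i (partial j f) x)"
    by (subst partial_sum) (simp_all add: smooth_differentiable smooth_mult sm f partial_mult
        partial_commute[OF f, of j] field_jacobian_def)
  show ?thesis
    unfolding 1 2 3
    by (simp add: lie_dens_def sum.distrib algebra_simps)
qed

text \<open>The last summand is the source of every lower order term. Its coefficient is \<open>1\<close> from the second
derivatives of \<open>X\<close> acting on \<open>f\<close> as a function, plus \<open>(n + 1) w\<close> from those acting on its weight.\<close>
lemma partial_partial_lie_dens:
  fixes X :: "real^'n::finite \<Rightarrow> real^'n"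
  assumes X: "projective_field X b" and f: "smooth f"
  shows "partial j (partial k (lie_dens w X f)) x =
    lie_dens w X (partial j (partial k f)) x
      + (\<Sum>i\<in>UNIV. field_jacobian X i j x * partial i (partial k f) x)
      + (\<Sum>i\<in>UNIV. field_jacobian X i k x * partial j (partial i f) x)
      + (1 + succ_dim TYPE('n) * w) * (b j * partial k f x + b k * partial j f x)"
proof -
  have sm: "smooth (field_jacobian X i k)" "smooth (partial i f)" for i
    using projective_field_smooth[OF X] f by (auto intro: smooth_partial)
  have "partial k (lie_dens w X f) = (\<lambda>x. lie_dens w X (partial k f) x +
      ((\<Sum>i\<in>UNIV. field_jacobian X i k x * partial i f x) + w * succ_dim TYPE('n) * b k * f x))"
    using partial_lie_dens[OF X f] by (simp add: fun_eq_iff)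
  then have 1: "partial j (partial k (lie_dens w X f)) x = partial j (lie_dens w X (partial k f)) x +
      (partial j (\<lambda>x. \<Sum>i\<in>UNIV. field_jacobian X i k x * partial i f x) x + partial j (\<lambda>x. w * succ_dim TYPE('n) * b k * f x) x)"
    by (simp only:) (subst partial_add, (intro smooth_differentiable smooth_add smooth_sum smooth_mult sm f smooth_const
          smooth_lie_dens[OF X])+, subst partial_add,
        (intro smooth_differentiable smooth_sum smooth_mult sm f smooth_const)+, rule refl)
  have 2: "partial j (\<lambda>x. w * succ_dim TYPE('n) * b k * f x) x = w * succ_dim TYPE('n) * b k * partial j f x"
    by (rule partial_cmult) (rule smooth_differentiable[OF f])
  have "partial j (\<lambda>x. \<Sum>i\<in>UNIV. field_jacobian X i k x * partial i f x) x =
     (\<Sum>i\<in>UNIV. (of_bool (i = k) * b j + of_bool (i = j) * b k) * partial i f x + field_jacobian X i k x * partial j (partial i f) x)"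
    by (subst partial_sum) (simp_all add: smooth_differentiable smooth_mult sm partial_mult partial_jacobian[OF X])
  also have "\<dots> = b j * partial k f x + b k * partial j f x + (\<Sum>i\<in>UNIV. field_jacobian X i k x * partial j (partial i f) x)"
    by (simp add: sum.distrib distrib_right mult.assoc)
  finally have 3: "partial j (\<lambda>x. \<Sum>i\<in>UNIV. field_jacobian X i k x * partial i f x) x = \<dots>" .
  have 4: "partial j (lie_dens w X (partial k f)) x = lie_dens w X (partial j (partial k f)) x
      + (\<Sum>i\<in>UNIV. field_jacobian X i j x * partial i (partial k f) x) + w * succ_dim TYPE('n) * b j * partial k f x"
    by (rule partial_lie_dens[OF X smooth_partial[OF f]])
  show ?thesis unfolding 1 2 3 4 by (simp add: algebra_simps)
qed

lemma slot_sum_swap: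
  fixes F :: "bool \<Rightarrow> 'n::finite \<Rightarrow> 'n \<Rightarrow> real"
  shows "(\<Sum>p\<in>UNIV. \<Sum>i\<in>UNIV. F (fst p) (snd p) i) = (\<Sum>p\<in>UNIV. \<Sum>i\<in>UNIV. F (fst p) i (snd p))"
  unfolding sum_slot by (simp add: sum.swap[of "\<lambda>i j. F _ j i"])

lemma smooth_jet1: "smooth f \<Longrightarrow> smooth g \<Longrightarrow> smooth (jet1 p f g)"
  unfolding jet1_def[abs_def] by (cases "fst p") (simp_all add: smooth_mult smooth_partial)

lemma smooth_jet2: "smooth f \<Longrightarrow> smooth g \<Longrightarrow> smooth (jet2 p q f g)"
  unfolding jet2_def[abs_def] by (cases "fst p"; cases "fst q") (simp_all add: smooth_mult smooth_partial)

text \<open>The left hand side is the Lie derivative of the bilinear operator \<open>jet1 p\<close>, whose values are regarded as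
densities of weight \<open>w False + w True\<close>.\<close>
lemma lie_jet1:
  fixes X :: "real^'n::finite \<Rightarrow> real^'n"
  assumes X: "projective_field X b" and f: "smooth f" and g: "smooth g"
  shows "lie_dens (w False + w True) X (jet1 p f g) x
      - jet1 p (lie_dens (w False) X f) g x - jet1 p f (lie_dens (w True) X g) x =
    - (\<Sum>i\<in>UNIV. field_jacobian X i (snd p) x * jet1 (fst p, i) f g x)
      - b (snd p) * (succ_dim TYPE('n) * w (fst p)) * (f x * g x)"
proof (cases p)
  case (Pair s j)
  show ?thesis
  proof (cases s)
    case True
    have "jet1 p f g = (\<lambda>x. f x * partial j g x)"
      by (simp add: jet1_def fun_eq_iff Pair True)
    then show ?thesis
      by (simp add: lie_dens_mult[OF f smooth_partial[OF g] refl])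
        (simp add: jet1_def Pair True algebra_simps sum_distrib_left partial_lie_dens[OF X g])
  next
    case False
    have "jet1 p f g = (\<lambda>x. partial j f x * g x)"
      by (simp add: jet1_def fun_eq_iff Pair False)
    then show ?thesis
      by (simp add: lie_dens_mult[OF smooth_partial[OF f] g refl])
        (simp add: jet1_def Pair False algebra_simps sum_distrib_left partial_lie_dens[OF X f])
  qed
qed

text \<open>Second derivatives of the components of \<open>X\<close> arise only if both derivatives of \<open>jet2\<close> fall on the same
argument; hence the indicator of equal sides. The weights enter through derivatives of the divergence of
\<open>X\<close>, one of which arises from each slot.\<close>
lemma lie_jet2:
  fixes X :: "real^'n::finite \<Rightarrow> real^'n"
  assumes X: "projective_field X b" and f: "smooth f" and g: "smooth g"
  shows "lie_dens (w False + w True) X (jet2 p q f g) x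
      - jet2 p q (lie_dens (w False) X f) g x - jet2 p q f (lie_dens (w True) X g) x =
    - (\<Sum>i\<in>UNIV. field_jacobian X i (snd p) x * jet2 (fst p, i) q f g x)
      - (\<Sum>i\<in>UNIV. field_jacobian X i (snd q) x * jet2 p (fst q, i) f g x)
      - b (snd p) * (of_bool (fst p = fst q) + succ_dim TYPE('n) * w (fst p)) * jet1 q f g x
      - b (snd q) * (of_bool (fst q = fst p) + succ_dim TYPE('n) * w (fst q)) * jet1 p f g x"
proof (cases p; cases q)
  fix s j t k assume p: "p = (s, j)" and q: "q = (t, k)"
  note pl = partial_lie_dens[OF X] partial_partial_lie_dens[OF X]
  show ?thesis
  proof (cases s; cases t)
    assume st: s t
    have "jet2 p q f g = (\<lambda>x. f x * partial j (partial k g) x)"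
      by (simp add: jet2_def fun_eq_iff p q st)
    then show ?thesis
      by (simp add: lie_dens_mult[OF f smooth_partial[OF smooth_partial[OF g]] refl])
        (simp add: jet2_def jet1_def p q st algebra_simps sum_distrib_left pl[OF g])
  next
    assume st: s "\<not> t"
    have "jet2 p q f g = (\<lambda>x. partial k f x * partial j g x)"
      by (simp add: jet2_def fun_eq_iff p q st)
    then show ?thesis
      by (simp add: lie_dens_mult[OF smooth_partial[OF f] smooth_partial[OF g] refl])
        (simp add: jet2_def jet1_def p q st algebra_simps sum_distrib_left pl[OF g] pl[OF f])
  next
    assume st: "\<not> s" t
    have "jet2 p q f g = (\<lambda>x. partial j f x * partial k g x)"
      by (simp add: jet2_def fun_eq_iff p q st)
    then show ?thesis
      by (simp add: lie_dens_mult[OF smooth_partial[OF f] smooth_partial[OF g] refl])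
        (simp add: jet2_def jet1_def p q st algebra_simps sum_distrib_left pl[OF g] pl[OF f])
  next
    assume st: "\<not> s" "\<not> t"
    have "jet2 p q f g = (\<lambda>x. partial j (partial k f) x * g x)"
      by (simp add: jet2_def fun_eq_iff p q st)
    then show ?thesis
      by (simp add: lie_dens_mult[OF smooth_partial[OF smooth_partial[OF f]] g refl])
        (simp add: jet2_def jet1_def p q st algebra_simps sum_distrib_left pl[OF f])
  qed
qed

text \<open>By the product rule, \<open>L\<^sub>X\<close> of a coefficient times a jet is the derivative of the coefficient as a
\<open>d\<close>-density, plus the coefficient times the commutator of \<open>L\<^sub>X\<close> with the jet. Transposing the matrix
\<open>field_jacobian\<close> in the commutators turns them into the tensor action on the coefficients.\<close>
lemma lie_op_quad_op:
  fixes X :: "real^'n::finite \<Rightarrow> real^'n"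
  assumes X: "projective_field X b" and q: "smooth_quad h U Q" and d: "m = d + w False + w True"
  shows "lie_op (w False) (w True) m X (quad_op h U Q) =
    quad_op (\<lambda>x. lie_dens d X h x - twist1 w b U x)
      (\<lambda>p x. lie1 d X U p x - twist2 w b Q p x) (lie2 d X Q)"
proof (intro ext)
  fix f g :: "'n dens" and x
  show "lie_op (w False) (w True) m X (quad_op h U Q) f g x =
    quad_op (\<lambda>x. lie_dens d X h x - twist1 w b U x)
      (\<lambda>p x. lie1 d X U p x - twist2 w b Q p x) (lie2 d X Q) f g x"
  proof (cases "smooth f \<and> smooth g")
    case True
    then have f: "smooth f" and g: "smooth g" by auto
    let ?L = "lie_dens (w False) X f" and ?M = "lie_dens (w True) X g" and ?s = "w False + w True"
    let ?J = "\<lambda>p. jet1 p f g x" and ?K = "\<lambda>p q. jet2 p q f g x"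
    define c0 where "c0 = lie_dens ?s X (\<lambda>x. f x * g x) x - ?L x * g x - f x * ?M x"
    define c1 where "c1 p = lie_dens ?s X (jet1 p f g) x - jet1 p ?L g x - jet1 p f ?M x" for p
    define c2 where "c2 p q = lie_dens ?s X (jet2 p q f g) x - jet2 p q ?L g x - jet2 p q f ?M x" for p q
    have LM: "smooth ?L" "smooth ?M" using smooth_lie_dens[OF X] f g by auto
    have h: "smooth h" and U: "smooth (U p)" and Q: "smooth (Q p q)" for p q
      using q unfolding smooth_quad_def by blast+
    have s: "m = d + ?s" using d by simp
    note J = smooth_jet1[OF f g] and K = smooth_jet2[OF f g]
    have c0: "c0 = 0"
      by (simp add: c0_def lie_dens_mult[OF f g refl])
    have "quad_op h U Q f g = (\<lambda>x. (h x * (f x * g x) + (\<Sum>p\<in>UNIV. U p x * jet1 p f g x))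
        + (\<Sum>p\<in>UNIV. \<Sum>q\<in>UNIV. Q p q x * jet2 p q f g x))"
      using f g by (simp add: quad_op_def fun_eq_iff)
    then have "lie_dens m X (quad_op h U Q f g) x =
        lie_dens m X (\<lambda>x. h x * (f x * g x)) x
        + (\<Sum>p\<in>UNIV. lie_dens m X (\<lambda>x. U p x * jet1 p f g x) x)
        + (\<Sum>p\<in>UNIV. \<Sum>q\<in>UNIV. lie_dens m X (\<lambda>x. Q p q x * jet2 p q f g x) x)"
      using f g h U Q J K
      by (simp add: lie_dens_add lie_dens_sum smooth_add smooth_mult smooth_sum)
    also have "\<dots> =
        (lie_dens d X h x * (f x * g x) + h x * lie_dens ?s X (\<lambda>x. f x * g x) x)
        + (\<Sum>p\<in>UNIV. lie_dens d X (U p) x * ?J p + U p x * lie_dens ?s X (jet1 p f g) x)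
        + (\<Sum>p\<in>UNIV. \<Sum>q\<in>UNIV. lie_dens d X (Q p q) x * ?K p q + Q p q x * lie_dens ?s X (jet2 p q f g) x)"
      by (simp add: lie_dens_mult[OF h smooth_mult[OF f g] s] lie_dens_mult[OF U J s] lie_dens_mult[OF Q K s])
    finally have "lie_op (w False) (w True) m X (quad_op h U Q) f g x =
        (lie_dens d X h x * (f x * g x) + h x * c0)
        + (\<Sum>p\<in>UNIV. lie_dens d X (U p) x * ?J p + U p x * c1 p)
        + (\<Sum>p\<in>UNIV. \<Sum>q\<in>UNIV. lie_dens d X (Q p q) x * ?K p q + Q p q x * c2 p q)"
      using f g LM
      by (simp add: lie_op_def quad_op_def c0_def c1_def c2_def right_diff_distrib sum.distrib sum_subtractf)
    moreover have "(\<Sum>p\<in>UNIV. U p x * c1 p) =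
        - (\<Sum>p\<in>UNIV. (\<Sum>j\<in>UNIV. field_jacobian X (snd p) j x * U (fst p, j) x) * ?J p)
        - twist1 w b U x * (f x * g x)"
    proof -
      have "(\<Sum>p\<in>UNIV. U p x * c1 p) =
          - (\<Sum>p\<in>UNIV. \<Sum>i\<in>UNIV. field_jacobian X i (snd p) x * U (fst p, snd p) x * ?J (fst p, i))
          - twist1 w b U x * (f x * g x)"
        unfolding c1_def lie_jet1[OF X f g] twist1_def
        by (simp add: right_diff_distrib sum_subtractf sum_negf sum_distrib_left sum_distrib_right mult_ac)
      also have "(\<Sum>p\<in>UNIV. \<Sum>i\<in>UNIV. field_jacobian X i (snd p) x * U (fst p, snd p) x * ?J (fst p, i)) =
          (\<Sum>p\<in>UNIV. (\<Sum>j\<in>UNIV. field_jacobian X (snd p) j x * U (fst p, j) x) * ?J p)"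
        by (subst slot_sum_swap) (simp add: sum_distrib_right)
      finally show ?thesis .
    qed
    moreover have "(\<Sum>p\<in>UNIV. \<Sum>q\<in>UNIV. Q p q x * c2 p q) =
        - (\<Sum>p\<in>UNIV. \<Sum>q\<in>UNIV. (\<Sum>j\<in>UNIV. field_jacobian X (snd p) j x * Q (fst p, j) q x) * ?K p q)
        - (\<Sum>p\<in>UNIV. \<Sum>q\<in>UNIV. (\<Sum>j\<in>UNIV. field_jacobian X (snd q) j x * Q p (fst q, j) x) * ?K p q)
        - (\<Sum>q\<in>UNIV. twist2 w b Q q x * ?J q)"
    proof -
      let ?k = "\<lambda>p q. of_bool (fst p = fst q) + succ_dim TYPE('n) * w (fst p) :: real"
      have "(\<Sum>p\<in>UNIV. \<Sum>q\<in>UNIV. Q p q x * c2 p q) =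
          - (\<Sum>p\<in>UNIV. \<Sum>q\<in>UNIV. \<Sum>i\<in>UNIV. field_jacobian X i (snd p) x * Q (fst p, snd p) q x * ?K (fst p, i) q)
          - (\<Sum>p\<in>UNIV. \<Sum>q\<in>UNIV. \<Sum>i\<in>UNIV. field_jacobian X i (snd q) x * Q p (fst q, snd q) x * ?K p (fst q, i))
          - (\<Sum>p\<in>UNIV. \<Sum>q\<in>UNIV. Q p q x * (b (snd p) * ?k p q) * ?J q)
          - (\<Sum>p\<in>UNIV. \<Sum>q\<in>UNIV. Q p q x * (b (snd q) * ?k q p) * ?J p)"
        unfolding c2_def lie_jet2[OF X f g]
        by (simp only: right_diff_distrib sum_subtractf sum_negf sum_distrib_left mult_ac mult_minus_right prod.collapse)
      also have "(\<Sum>p\<in>UNIV. \<Sum>q\<in>UNIV. \<Sum>i\<in>UNIV. field_jacobian X i (snd p) x * Q (fst p, snd p) q x * ?K (fst p, i) q)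
          = (\<Sum>p\<in>UNIV. \<Sum>q\<in>UNIV. (\<Sum>j\<in>UNIV. field_jacobian X (snd p) j x * Q (fst p, j) q x) * ?K p q)"
        by (subst (1 3) sum.swap, subst slot_sum_swap) (simp add: sum_distrib_right)
      also have "(\<Sum>p\<in>UNIV. \<Sum>q\<in>UNIV. \<Sum>i\<in>UNIV. field_jacobian X i (snd q) x * Q p (fst q, snd q) x * ?K p (fst q, i))
          = (\<Sum>p\<in>UNIV. \<Sum>q\<in>UNIV. (\<Sum>j\<in>UNIV. field_jacobian X (snd q) j x * Q p (fst q, j) x) * ?K p q)"
        by (subst slot_sum_swap) (simp add: sum_distrib_right)
      also have "(\<Sum>p\<in>UNIV. \<Sum>q\<in>UNIV. Q p q x * (b (snd p) * ?k p q) * ?J q) =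
          (\<Sum>q\<in>UNIV. \<Sum>p\<in>UNIV. Q p q x * (b (snd p) * ?k p q) * ?J q)"
        by (rule sum.swap)
      finally show ?thesis
        unfolding twist2_def
        by (simp add: algebra_simps sum_distrib_right sum_distrib_left sum.distrib)
    qed
    ultimately show ?thesis
      using f g by (simp add: quad_op_def lie1_def lie2_def c0 left_diff_distrib sum.distrib sum_subtractf)
  qed (auto simp: lie_op_def quad_op_def)
qed

lemma partial_slot_var:
  "partial j (\<lambda>\<xi>. slot_var \<xi> \<beta> p) \<alpha> = of_bool (p = (False, j))"
  "partial j (\<lambda>\<xi>. slot_var \<alpha> \<xi> p) \<beta> = of_bool (p = (True, j))"
proof -
  obtain s i where p: "p = (s, i)" by (cases p)
  show "partial j (\<lambda>\<xi>. slot_var \<xi> \<beta> p) \<alpha> = of_bool (p = (False, j))"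
    by (cases s) (auto simp: p slot_var_def partial_const partial_coord)
  show "partial j (\<lambda>\<xi>. slot_var \<alpha> \<xi> p) \<beta> = of_bool (p = (True, j))"
    by (cases s) (auto simp: p slot_var_def partial_const partial_coord)
qed

lemma smooth_slot_var: "smooth (\<lambda>\<xi>. slot_var \<xi> \<beta> p)" "smooth (\<lambda>\<xi>. slot_var \<alpha> \<xi> p)"
  by (cases "fst p"; simp add: slot_var_def)+

lemma partial_quad_symbol:
  fixes h :: "('n::finite) dens"
  shows "partial j (\<lambda>\<xi>. quad_symbol h U Q x \<xi> \<beta>) \<alpha> =
    U (False, j) x + (\<Sum>q\<in>UNIV. (Q (False, j) q x + Q q (False, j) x) * slot_var \<alpha> \<beta> q)"
  "partial j (\<lambda>\<xi>. quad_symbol h U Q x \<alpha> \<xi>) \<beta> =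
    U (True, j) x + (\<Sum>q\<in>UNIV. (Q (True, j) q x + Q q (True, j) x) * slot_var \<alpha> \<beta> q)"
proof -
  have gen: "partial j (\<lambda>\<xi>. h x + (\<Sum>p\<in>UNIV. U p x * v \<xi> p) + (\<Sum>p\<in>UNIV. \<Sum>q\<in>UNIV. Q p q x * (v \<xi> p * v \<xi> q))) \<zeta> =
      U r x + (\<Sum>q\<in>UNIV. (Q r q x + Q q r x) * v \<zeta> q)"
    if v: "\<And>p. smooth (\<lambda>\<xi>. v \<xi> p)" and dv: "\<And>p. partial j (\<lambda>\<xi>. v \<xi> p) \<zeta> = of_bool (p = r)"
    for v :: "real^'n \<Rightarrow> 'n slot \<Rightarrow> real" and r \<zeta>
  proof -
    have 1: "partial j (\<lambda>\<xi>. \<Sum>p\<in>UNIV. U p x * v \<xi> p) \<zeta> = U r x"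
      by (subst partial_sum) (simp_all add: smooth_differentiable smooth_mult v partial_cmult dv)
    have "partial j (\<lambda>\<xi>. \<Sum>p\<in>UNIV. \<Sum>q\<in>UNIV. Q p q x * (v \<xi> p * v \<xi> q)) \<zeta> =
        (\<Sum>p\<in>UNIV. \<Sum>q\<in>UNIV. Q p q x * (of_bool (p = r) * v \<zeta> q + v \<zeta> p * of_bool (q = r)))"
      by (simp add: partial_sum smooth_differentiable smooth_mult smooth_sum v partial_cmult partial_mult dv)
    also have "\<dots> = (\<Sum>q\<in>UNIV. \<Sum>p\<in>UNIV. of_bool (p = r) * (Q p q x * v \<zeta> q))
        + (\<Sum>p\<in>UNIV. \<Sum>q\<in>UNIV. of_bool (q = r) * (Q p q x * v \<zeta> p))"
      by (subst (2) sum.swap) (simp only: sum.distrib distrib_left mult_ac)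
    also have "\<dots> = (\<Sum>q\<in>UNIV. (Q r q x + Q q r x) * v \<zeta> q)"
      by (simp add: sum.distrib distrib_right)
    finally have 2: "partial j (\<lambda>\<xi>. \<Sum>p\<in>UNIV. \<Sum>q\<in>UNIV. Q p q x * (v \<xi> p * v \<xi> q)) \<zeta> = \<dots>" .
    show ?thesis
      by (simp add: partial_add 1 2 partial_const smooth_differentiable smooth_sum smooth_add smooth_mult v)
  qed
  show "partial j (\<lambda>\<xi>. quad_symbol h U Q x \<xi> \<beta>) \<alpha> =
    U (False, j) x + (\<Sum>q\<in>UNIV. (Q (False, j) q x + Q q (False, j) x) * slot_var \<alpha> \<beta> q)"
    unfolding quad_symbol_def by (rule gen) (simp_all add: partial_slot_var smooth_slot_var)
  show "partial j (\<lambda>\<xi>. quad_symbol h U Q x \<alpha> \<xi>) \<beta> =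
    U (True, j) x + (\<Sum>q\<in>UNIV. (Q (True, j) q x + Q q (True, j) x) * slot_var \<alpha> \<beta> q)"
    unfolding quad_symbol_def by (rule gen) (simp_all add: partial_slot_var smooth_slot_var)
qed

lemma lie_symbol_quad_symbol:
  fixes X :: "real^'n::finite \<Rightarrow> real^'n"
  assumes q: "smooth_quad h U Q"
  shows "lie_symbol d X (quad_symbol h U Q) = quad_symbol (lie_dens d X h) (lie1 d X U) (lie2 d X Q)"
proof (intro ext)
  fix x \<alpha> \<beta> :: "real^'n"
  let ?v = "slot_var \<alpha> \<beta>"
  have h: "smooth h" and U: "smooth (U p)" and Q: "smooth (Q p q)" for p q
    using q unfolding smooth_quad_def by blast+
  define D where "D p = U p x + (\<Sum>q\<in>UNIV. (Q p q x + Q q p x) * ?v q)" for p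
  have "lie_symbol d X (quad_symbol h U Q) x \<alpha> \<beta> =
      lie_dens d X (\<lambda>y. quad_symbol h U Q y \<alpha> \<beta>) x
      - (\<Sum>i\<in>UNIV. \<Sum>j\<in>UNIV. field_jacobian X i j x * (\<alpha> $ i * D (False, j) + \<beta> $ i * D (True, j)))"
    by (simp add: lie_symbol_def lie_dens_def partial_quad_symbol D_def field_jacobian_def)
  also have "(\<Sum>i\<in>UNIV. \<Sum>j\<in>UNIV. field_jacobian X i j x * (\<alpha> $ i * D (False, j) + \<beta> $ i * D (True, j))) =
      (\<Sum>p\<in>UNIV. \<Sum>j\<in>UNIV. field_jacobian X (snd p) j x * ?v p * D (fst p, j))"
    by (simp add: sum_slot slot_var_def sum.distrib distrib_left mult.assoc)
  also have "\<dots> = (\<Sum>p\<in>UNIV. (\<Sum>j\<in>UNIV. field_jacobian X (snd p) j x * U (fst p, j) x) * ?v p)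
      + (\<Sum>p\<in>UNIV. \<Sum>q\<in>UNIV. (\<Sum>j\<in>UNIV. field_jacobian X (snd p) j x * Q (fst p, j) q x) * (?v p * ?v q))
      + (\<Sum>p\<in>UNIV. \<Sum>q\<in>UNIV. (\<Sum>j\<in>UNIV. field_jacobian X (snd p) j x * Q q (fst p, j) x) * (?v p * ?v q))"
    unfolding D_def
    by (simp add: sum_distrib_left sum_distrib_right sum.distrib distrib_left distrib_right mult_ac
        sum.swap[of _ "UNIV :: 'n set" "UNIV :: 'n slot set"])
  also have "(\<Sum>p\<in>UNIV. \<Sum>q\<in>UNIV. (\<Sum>j\<in>UNIV. field_jacobian X (snd p) j x * Q q (fst p, j) x) * (?v p * ?v q)) =
      (\<Sum>p\<in>UNIV. \<Sum>q\<in>UNIV. (\<Sum>j\<in>UNIV. field_jacobian X (snd q) j x * Q p (fst q, j) x) * (?v p * ?v q))"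
    by (subst sum.swap) (simp add: mult.commute)
  also have "lie_dens d X (\<lambda>y. quad_symbol h U Q y \<alpha> \<beta>) x =
      lie_dens d X h x + (\<Sum>p\<in>UNIV. lie_dens d X (U p) x * ?v p)
      + (\<Sum>p\<in>UNIV. \<Sum>q\<in>UNIV. lie_dens d X (Q p q) x * (?v p * ?v q))"
  proof -
    have cm: "lie_dens d X (\<lambda>y. f y * c) x = lie_dens d X f x * c" if "smooth f" for f c
      using lie_dens_mult[OF that smooth_const[of c], of d d 0 X x] by (simp add: lie_dens_def partial_const)
    show ?thesis
      unfolding quad_symbol_def
      by (simp add: lie_dens_add lie_dens_sum smooth_add smooth_sum smooth_mult h U Q cm)
  qed
  finally have lie: "lie_symbol d X (quad_symbol h U Q) x \<alpha> \<beta> = \<dots>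
      - ((\<Sum>p\<in>UNIV. (\<Sum>j\<in>UNIV. field_jacobian X (snd p) j x * U (fst p, j) x) * ?v p)
      + (\<Sum>p\<in>UNIV. \<Sum>q\<in>UNIV. (\<Sum>j\<in>UNIV. field_jacobian X (snd p) j x * Q (fst p, j) q x) * (?v p * ?v q))
      + (\<Sum>p\<in>UNIV. \<Sum>q\<in>UNIV. (\<Sum>j\<in>UNIV. field_jacobian X (snd q) j x * Q p (fst q, j) x) * (?v p * ?v q)))" .
  show "lie_symbol d X (quad_symbol h U Q) x \<alpha> \<beta> =
      quad_symbol (lie_dens d X h) (lie1 d X U) (lie2 d X Q) x \<alpha> \<beta>"
    unfolding lie unfolding quad_symbol_def lie1_def lie2_def by (simp add: left_diff_distrib sum_subtractf)
qed

section \<open>The fields of the projective algebra\<close>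

definition sl_field :: "('n \<Rightarrow> real) \<Rightarrow> ('n \<Rightarrow> 'n \<Rightarrow> real) \<Rightarrow> ('n \<Rightarrow> real) \<Rightarrow> real^'n \<Rightarrow> real^('n::finite)" where
  "sl_field c A b x = (\<Sum>i\<in>UNIV. c i *\<^sub>R axis i 1)
     + (\<Sum>i\<in>UNIV. \<Sum>j\<in>UNIV. (A i j * x $ j) *\<^sub>R axis i 1)
     + (\<Sum>j\<in>UNIV. (b j * x $ j) *\<^sub>R x)"

lemma sl_fields_eq: "sl_fields = {sl_field c A b |c A b. True}"
  by (auto simp: sl_fields_def sl_field_def[abs_def])

lemma sl_field_nth:
  "sl_field c A b x $ i = c i + (\<Sum>j\<in>UNIV. A i j * x $ j) + (\<Sum>j\<in>UNIV. b j * x $ j) * x $ i"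
proof -
  have "(\<Sum>k\<in>UNIV. f k * axis k 1 $ i) = f i" for f :: "'a \<Rightarrow> real"
    by (simp add: axis_def if_distrib cong: if_cong)
  then show ?thesis
    by (simp add: sl_field_def sum_distrib_right[symmetric])
qed

lemma jacobian_sl_field:
  "field_jacobian (sl_field c A b) i j x =
    A i j + b j * x $ i + of_bool (i = j) * (\<Sum>k\<in>UNIV. b k * x $ k)"
  unfolding field_jacobian_def sl_field_nth
  by (simp add: partial_add partial_sum partial_mult partial_const partial_coord smooth_differentiable
      smooth_add smooth_mult smooth_sum eq_commute[of i j])

text \<open>Only the quadratic part of an element of \<open>sl\<^sub>n\<^sub>+\<^sub>1\<close> has second derivatives.\<close>
lemma projective_sl_field: "projective_field (sl_field c A b) b"
  unfolding projective_field_def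
proof (intro conjI allI)
  show "smooth (\<lambda>y. sl_field c A b y $ i)" for i
    unfolding sl_field_nth by (simp add: smooth_add smooth_mult smooth_sum)
  show "partial k (field_jacobian (sl_field c A b) i j) x = of_bool (i = j) * b k + of_bool (i = k) * b j" for i j k x
    unfolding jacobian_sl_field[abs_def]
    by (simp add: partial_add partial_sum partial_mult partial_const partial_coord smooth_differentiable
      smooth_add smooth_mult smooth_sum eq_commute[of i k])
qed

section \<open>The obstruction\<close>

definition translation :: "'n \<Rightarrow> real^'n \<Rightarrow> real^('n::finite)" where
  "translation j = sl_field (\<lambda>i. of_bool (i = j)) (\<lambda>i j. 0) (\<lambda>i. 0)"

definition euler :: "real^'n \<Rightarrow> real^('n::finite)" where
  "euler = sl_field (\<lambda>i. 0) (\<lambda>i j. of_bool (i = j)) (\<lambda>i. 0)"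

text \<open>The fields \<open>x\<^sup>k \<Sum>\<^sub>i x\<^sup>i \<partial>\<^sub>i\<close>.\<close>
definition inversion :: "'n \<Rightarrow> real^'n \<Rightarrow> real^('n::finite)" where
  "inversion k = sl_field (\<lambda>i. 0) (\<lambda>i j. 0) (\<lambda>i. of_bool (i = k))"

lemma projective_basic_fields:
  "projective_field (translation j) (\<lambda>i. 0)" "projective_field euler (\<lambda>i. 0)"
  "projective_field (inversion k) (\<lambda>i. of_bool (i = k))"
  unfolding translation_def euler_def inversion_def by (rule projective_sl_field)+

lemma basic_fields_sl: "translation j \<in> sl_fields" "euler \<in> sl_fields" "inversion k \<in> sl_fields"
  unfolding translation_def euler_def inversion_def sl_fields_eq by blast+

lemma jacobian_basic_fields:
  "field_jacobian (translation j) = (\<lambda>i k x. 0)"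
  "field_jacobian euler = (\<lambda>i k x. of_bool (i = k))"
  "field_jacobian (inversion k) = (\<lambda>i j x. of_bool (j = k) * x $ i + of_bool (i = j) * x $ k)"
  by (simp_all add: fun_eq_iff translation_def euler_def inversion_def jacobian_sl_field)

lemma basic_fields_nth:
  "translation j x $ i = of_bool (i = j)" "euler x $ i = x $ i" "inversion k x $ i = x $ k * x $ i"
  by (simp_all add: translation_def euler_def inversion_def sl_field_nth)

lemma divergence_basic_fields:
  fixes x :: "real^'n::finite"
  shows "divergence (translation j) x = 0" "divergence euler x = real CARD('n)"
    "divergence (inversion k) x = succ_dim TYPE('n) * x $ k"
  by (simp_all add: divergence_jacobian jacobian_basic_fields sum.distrib algebra_simps)

lemma lie_dens_basic_fields:
  fixes f :: "('n::finite) dens"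
  shows "lie_dens d (translation j) f x = partial j f x"
    and "lie_dens d euler f x = (\<Sum>i\<in>UNIV. x $ i * partial i f x) + d * real CARD('n) * f x"
    and "lie_dens d (inversion k) f x =
      x $ k * (\<Sum>i\<in>UNIV. x $ i * partial i f x) + d * succ_dim TYPE('n) * x $ k * f x"
  by (simp_all add: lie_dens_def basic_fields_nth divergence_basic_fields sum_distrib_left mult_ac)

lemma quad_op_combination:
  "(\<lambda>f g x. s * quad_op h U Q f g x + t * quad_op h' U' Q' f g x) =
    quad_op (\<lambda>x. s * h x + t * h' x) (\<lambda>p x. s * U p x + t * U' p x) (\<lambda>p q x. s * Q p q x + t * Q' p q x)"
proof (intro ext)
  fix f g x
  show "s * quad_op h U Q f g x + t * quad_op h' U' Q' f g x =
    quad_op (\<lambda>x. s * h x + t * h' x) (\<lambda>p x. s * U p x + t * U' p x) (\<lambda>p q x. s * Q p q x + t * Q' p q x) f g x"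
  proof (cases "smooth f \<and> smooth g")
    case True
    then show ?thesis
      by (simp add: quad_op_def sum.distrib sum_distrib_left algebra_simps)
  qed (auto simp: quad_op_def)
qed

lemma smooth_quad_combination:
  assumes "smooth_quad h U Q" "smooth_quad h' U' Q'"
  shows "smooth_quad (\<lambda>x. s * h x + t * h' x) (\<lambda>p x. s * U p x + t * U' p x) (\<lambda>p q x. s * Q p q x + t * Q' p q x)"
  using assms unfolding smooth_quad_def by (simp add: smooth_add smooth_mult)

lemma smooth_quad_lie:
  assumes X: "projective_field X b" and q: "smooth_quad h U Q"
  shows "smooth_quad (\<lambda>x. lie_dens d X h x - twist1 w b U x)
    (\<lambda>p x. lie1 d X U p x - twist2 w b Q p x) (lie2 d X Q)"
proof -
  have "smooth h" "smooth (U p)" "smooth (Q p q)" for p q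
    using q unfolding smooth_quad_def by blast+
  then show ?thesis
    unfolding smooth_quad_def twist1_def[abs_def] twist2_def[abs_def] lie1_def[abs_def] lie2_def[abs_def]
    by (intro conjI allI smooth_diff smooth_sum smooth_mult smooth_const smooth_add
        projective_field_smooth[OF X] smooth_lie_dens[OF X]) simp_all
qed

lemma quad_symbol_0: "quad_symbol h U Q x 0 0 = h x"
  by (simp add: quad_symbol_def slot_var_def)

text \<open>The components of the Euler field \<open>\<Sum>\<^sub>i x\<^sup>i \<partial>\<^sub>i\<close>, placed on the side \<open>s\<close>. As a first order operator it is
\<open>\<Sum>\<^sub>i x\<^sup>i \<partial>\<^sub>i\<close> acting on one of the two arguments.\<close>
definition radial :: "bool \<Rightarrow> 'n slot \<Rightarrow> ('n::finite) dens" where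
  "radial s p x = of_bool (fst p = s) * x $ snd p"

definition unit_slot :: "'n slot \<Rightarrow> 'n slot \<Rightarrow> ('n::finite) dens" where
  "unit_slot r p x = of_bool (p = r)"

lemma smooth_radial: "smooth (radial s p)"
  unfolding radial_def[abs_def] by (simp add: smooth_mult)

lemma smooth_unit_slot: "smooth (unit_slot r p)"
  unfolding unit_slot_def[abs_def] by simp

lemma partial_radial: "partial j (radial s p) x = unit_slot (s, j) p x"
  unfolding radial_def[abs_def] unit_slot_def
  by (cases p) (auto simp: partial_cmult partial_coord smooth_differentiable)

lemma partial_unit_slot: "partial j (unit_slot r p) x = 0"
  unfolding unit_slot_def[abs_def] by (rule partial_const)

lemma sum_unit_slot:
  fixes x :: "real^'n::finite"
  shows "(\<Sum>j\<in>UNIV. F j * unit_slot (s, k) (t, j) x) = of_bool (t = s) * F k"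
    and "(\<Sum>k\<in>UNIV. G k * unit_slot (s, k) p x) = of_bool (fst p = s) * G (snd p)"
    and "(\<Sum>p\<in>UNIV. unit_slot r p x * H p) = H r"
proof -
  show "(\<Sum>j\<in>UNIV. F j * unit_slot (s, k) (t, j) x) = of_bool (t = s) * F k"
    by (cases "t = s") (simp_all add: unit_slot_def)
  obtain t i where p: "p = (t, i)" by (cases p)
  show "(\<Sum>k\<in>UNIV. G k * unit_slot (s, k) p x) = of_bool (fst p = s) * G (snd p)"
    by (cases "t = s") (simp_all add: unit_slot_def p)
  show "(\<Sum>p\<in>UNIV. unit_slot r p x * H p) = H r"
    unfolding unit_slot_def by simp
qed

lemma unit_slot_factor: "of_bool (fst p = s) * of_bool (snd p = k) = unit_slot (s, k) p x"
  by (cases p) (simp add: unit_slot_def)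

lemma sum_radial:
  "(\<Sum>j\<in>UNIV. F j * radial s (t, j) x) = of_bool (t = s) * (\<Sum>j\<in>UNIV. F j * x $ j)"
  "(\<Sum>k\<in>UNIV. x $ k * unit_slot (s, k) p x) = radial s p x"
  unfolding sum_unit_slot(2) by (cases "t = s") (simp_all add: radial_def)

text \<open>Summed over \<open>k\<close>, this gives \<open>(n + 1) - n = 1\<close> times the radial vector.\<close>
lemma lie1_inversion_unit_slot:
  fixes x :: "real^'n::finite"
  assumes d: "d * succ_dim TYPE('n) = succ_dim TYPE('n) + 1"
  shows "lie1 d (inversion k) (unit_slot (s, k)) p x =
    succ_dim TYPE('n) * (x $ k * unit_slot (s, k) p x) - radial s p x"
proof -
  have "lie1 d (inversion k) (unit_slot (s, k)) p x = d * succ_dim TYPE('n) * x $ k * unit_slot (s, k) p x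
      - of_bool (fst p = s) * (x $ snd p + of_bool (snd p = k) * x $ k)"
    unfolding lie1_def lie_dens_basic_fields partial_unit_slot jacobian_basic_fields sum_unit_slot by simp
  also have "\<dots> = d * succ_dim TYPE('n) * x $ k * unit_slot (s, k) p x - radial s p x
      - of_bool (fst p = s) * of_bool (snd p = k) * x $ k"
    by (simp add: radial_def algebra_simps)
  finally show ?thesis
    unfolding unit_slot_factor[of _ _ _ x] d by (simp add: algebra_simps)
qed

text \<open>Summed over \<open>k\<close>, this vanishes: the sum of the vectors \<open>x\<^sup>k unit_slot (t, k)\<close> is the radial vector, here with the
factor \<open>n\<close>, and the subtracted radial vector occurs \<open>n\<close> times. This cancellation at the resonant weight is what makes the obstruction
visible, since the operators \<open>radial s \<otimes> unit_slot (t, k)\<close> then produce only first order terms.\<close>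
lemma lie2_inversion_radial:
  fixes x :: "real^'n::finite"
  assumes d: "d * succ_dim TYPE('n) = succ_dim TYPE('n) + 1"
  shows "lie2 d (inversion k) (\<lambda>p q x. radial s p x * unit_slot (t, k) q x) p q x =
    radial s p x * (real CARD('n) * (x $ k * unit_slot (t, k) q x) - radial t q x)"
proof -
  have par: "partial i (\<lambda>x. radial s p x * unit_slot (t, k) q x) x = unit_slot (s, i) p x * unit_slot (t, k) q x" for i
    by (simp add: partial_mult smooth_differentiable smooth_radial smooth_unit_slot partial_radial partial_unit_slot)
  have 1: "lie_dens d (inversion k) (\<lambda>x. radial s p x * unit_slot (t, k) q x) x =
      x $ k * (radial s p x * unit_slot (t, k) q x) + (succ_dim TYPE('n) + 1) * x $ k * (radial s p x * unit_slot (t, k) q x)"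
    unfolding lie_dens_basic_fields par d mult.assoc[symmetric] sum_distrib_right[symmetric] sum_radial(2) ..
  have 2: "(\<Sum>j\<in>UNIV. field_jacobian (inversion k) (snd p) j x * (radial s (fst p, j) x * unit_slot (t, k) q x)) =
      2 * x $ k * (radial s p x * unit_slot (t, k) q x)"
    unfolding mult.assoc[symmetric] sum_distrib_right[symmetric] sum_radial(1)
    by (simp add: jacobian_basic_fields distrib_right sum.distrib radial_def mult.assoc)
  have 3: "(\<Sum>j\<in>UNIV. field_jacobian (inversion k) (snd q) j x * (radial s p x * unit_slot (t, k) (fst q, j) x)) =
      radial s p x * (radial t q x + x $ k * unit_slot (t, k) q x)"
  proof -
    have "(\<Sum>j\<in>UNIV. field_jacobian (inversion k) (snd q) j x * (radial s p x * unit_slot (t, k) (fst q, j) x)) =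
        (\<Sum>j\<in>UNIV. (radial s p x * field_jacobian (inversion k) (snd q) j x) * unit_slot (t, k) (fst q, j) x)"
      by (simp add: mult_ac)
    also have "\<dots> = radial s p x * (of_bool (fst q = t) * field_jacobian (inversion k) (snd q) k x)"
      unfolding sum_unit_slot(1) by (simp add: mult_ac)
    also have "of_bool (fst q = t) * field_jacobian (inversion k) (snd q) k x =
        radial t q x + x $ k * (of_bool (fst q = t) * of_bool (snd q = k))"
      by (simp add: jacobian_basic_fields radial_def algebra_simps)
    finally show ?thesis unfolding unit_slot_factor[of _ _ _ x] .
  qed
  show ?thesis
    unfolding lie2_def 1 2 3 by (simp add: algebra_simps)
qed

lemma twist1_inversion_unit_slot:
  fixes x :: "real^'n::finite"
  shows "twist1 w (\<lambda>i. of_bool (i = k)) (unit_slot (s, k)) x = succ_dim TYPE('n) * w s"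
  unfolding twist1_def mult.assoc sum_unit_slot by simp

lemma twist2_inversion_radial:
  fixes x :: "real^'n::finite"
  shows "twist2 w (\<lambda>i. of_bool (i = k)) (\<lambda>p q x. radial s p x * unit_slot (t, k) q x) q x =
    (of_bool (s = t) + succ_dim TYPE('n) * w s) * (x $ k * unit_slot (t, k) q x)
    + (of_bool (s = t) + succ_dim TYPE('n) * w t) * radial s q x"
proof -
  let ?\<kappa> = "\<lambda>p. of_bool (fst p = fst q) + succ_dim TYPE('n) * w (fst p)"
  have u: "radial s p x * of_bool (snd p = k) = unit_slot (s, k) p x * x $ k" for p
    by (cases p) (simp add: radial_def unit_slot_def)
  have "twist2 w (\<lambda>i. of_bool (i = k)) (\<lambda>p q x. radial s p x * unit_slot (t, k) q x) q x =
      (\<Sum>p\<in>UNIV. radial s p x * of_bool (snd p = k) * (?\<kappa> p * unit_slot (t, k) q x))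
      + (\<Sum>p\<in>UNIV. unit_slot (t, k) p x * (of_bool (snd p = k) * ?\<kappa> p * radial s q x))"
    by (simp add: twist2_def sum.distrib distrib_left distrib_right mult_ac)
  also have "\<dots> = (of_bool (s = fst q) + succ_dim TYPE('n) * w s) * (x $ k * unit_slot (t, k) q x)
      + (of_bool (t = fst q) + succ_dim TYPE('n) * w t) * radial s q x"
    unfolding u mult.assoc sum_unit_slot by (simp add: mult_ac)
  also have "\<dots> = (of_bool (s = t) + succ_dim TYPE('n) * w s) * (x $ k * unit_slot (t, k) q x)
    + (of_bool (s = t) + succ_dim TYPE('n) * w t) * radial s q x"
    by (cases "fst q = t"; cases "fst q = s") (auto simp: unit_slot_def radial_def)
  finally show ?thesis .
qed

lemma principal_symbol_bidiff_op:
  assumes "A \<in> smooth_coeffs"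
  shows "total_order (bidiff_op A) = coeff_degree A"
    and "principal_symbol (bidiff_op A) = bi_symbol_of (coeff_component (coeff_degree A) A)"
    and "symbol_degree (bi_symbol_of A) = coeff_degree A"
    and "hom_component r (bi_symbol_of A) = bi_symbol_of (coeff_component r A)"
  using assms
  by (simp_all add: total_order_def principal_symbol_def polynomial_form_def symbol_degree_def
      hom_component_def op_coeffs_bidiff_op symbol_coeffs_bi_symbol_of)

lemma coeff_component_0:
  assumes "A \<in> smooth_coeffs" "coeff_degree A = 0"
  shows "coeff_component 0 A = A"
proof (intro ext)
  fix a b x
  have "finite (coeff_supp A)" using assms by (simp add: smooth_coeffs_def)
  then have "0 < mi_size a + mi_size b \<longrightarrow> A a b = (\<lambda>x. 0)"
    using coeff_degree_le_iff[of A 0] assms(2) by (metis le_zero_eq)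
  then show "coeff_component 0 A a b x = A a b x"
    by (simp add: coeff_component_def)
qed

text \<open>For an operator of order zero the principal symbol is everything, so the symbol map is forced.\<close>
lemma symbol_map_order_0:
  assumes \<sigma>: "proj_equiv_symbol_map l1 l2 m \<sigma>"
    and A: "A \<in> smooth_coeffs" "coeff_degree A = 0"
  shows "\<sigma> (bidiff_op A) = bi_symbol_of A"
proof -
  have "bidiff_op A \<in> second_order_ops"
    using A by (simp add: second_order_ops_def bidiff_ops_def principal_symbol_bidiff_op)
  then have P: "\<sigma> (bidiff_op A) \<in> second_order_symbols" "symbol_degree (\<sigma> (bidiff_op A)) = 0"
    "hom_component 0 (\<sigma> (bidiff_op A)) = bi_symbol_of A"
    using \<sigma> A by (auto simp: proj_equiv_symbol_map_def principal_symbol_bidiff_op coeff_component_0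
        dest: bij_betwE)
  then obtain B where B: "B \<in> smooth_coeffs" "\<sigma> (bidiff_op A) = bi_symbol_of B"
    by (auto simp: second_order_symbols_def bi_symbols_def)
  then show ?thesis
    using P by (simp add: principal_symbol_bidiff_op coeff_component_0)
qed

text \<open>The functional \<open>V\<close> below is the component of order zero of \<open>\<sigma>\<close>; it is linear and intertwines \<open>L\<^sub>X\<close> of
operators with \<open>L\<^sub>X\<close> of \<open>d\<close>-densities, because \<open>L\<^sub>X\<close> of symbols preserves degrees. Evaluated on the
Euler field it is \<open>n (n + 1) w s\<close>. The operators \<open>radial s \<otimes> unit_slot (t, k)\<close> lie in its kernel, so it also
kills the sum over \<open>k\<close> of their derivatives along \<open>x\<^sup>k \<Sum>\<^sub>i x\<^sup>i \<partial>\<^sub>i\<close>; this sum is a combination of Euler fields,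
and its value is the asserted expression up to a nonzero factor.\<close>
lemma symbol_map_obstruction:
  fixes \<sigma> :: "('n::finite) bi_operator \<Rightarrow> 'n bi_symbol"
  assumes \<sigma>: "proj_equiv_symbol_map (w False) (w True) m \<sigma>"
    and d: "m = d + w False + w True" "d * succ_dim TYPE('n) = succ_dim TYPE('n) + 1"
  shows "(of_bool (s = t) + succ_dim TYPE('n) * w s) * w t
    + real CARD('n) * (of_bool (s = t) + succ_dim TYPE('n) * w t) * w s = 0"
proof -
  define V where "V h U Q = (\<lambda>x. \<sigma> (quad_op h U Q) x 0 0)"
    for h :: "'n dens" and U Q
  let ?N = "real CARD('n)"
  let ?u = "unit_slot :: 'n slot \<Rightarrow> 'n slot \<Rightarrow> 'n dens"
  have symbol: "\<exists>h' U' Q'. smooth_quad h' U' Q' \<and> \<sigma> (quad_op h U Q) = quad_symbol h' U' Q'"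
    if "smooth_quad h U Q" for h U Q
  proof -
    have "\<sigma> (quad_op h U Q) \<in> second_order_symbols"
      using \<sigma> quad_op_second_order[OF that] by (auto simp: proj_equiv_symbol_map_def dest: bij_betwE)
    then show ?thesis using second_order_symbol_cases by metis
  qed
  have V_smooth: "smooth (V h U Q)" if sm: "smooth_quad h U Q" for h U Q
  proof -
    obtain h' U' Q' where "smooth_quad h' U' Q'" "\<sigma> (quad_op h U Q) = quad_symbol h' U' Q'"
      using symbol[OF sm] by blast
    then show ?thesis by (simp add: V_def quad_symbol_0 smooth_quad_def)
  qed
  have V_lie: "V (\<lambda>x. lie_dens d X h x - twist1 w b U x) (\<lambda>p x. lie1 d X U p x - twist2 w b Q p x) (lie2 d X Q)
      = lie_dens d X (V h U Q)"
    if sm: "smooth_quad h U Q" and X: "X \<in> sl_fields" "projective_field X b" for h U Q X b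
  proof -
    obtain h' U' Q' where q: "smooth_quad h' U' Q'" "\<sigma> (quad_op h U Q) = quad_symbol h' U' Q'"
      using symbol[OF sm] by blast
    have "\<sigma> (lie_op (w False) (w True) m X (quad_op h U Q)) = lie_symbol d X (\<sigma> (quad_op h U Q))"
      using \<sigma> X(1) quad_op_second_order[OF sm] d(1) by (simp add: proj_equiv_symbol_map_def)
    then show ?thesis
      unfolding lie_op_quad_op[OF X(2) sm d(1)]
      by (simp add: V_def q(2) lie_symbol_quad_symbol[OF q(1)] quad_symbol_0)
  qed
  have V_combination: "V (\<lambda>x. a * h x + c * h' x) (\<lambda>p x. a * U p x + c * U' p x) (\<lambda>p q x. a * Q p q x + c * Q' p q x)
      = (\<lambda>x. a * V h U Q x + c * V h' U' Q' x)"
    if "smooth_quad h U Q" "smooth_quad h' U' Q'" for a c h U Q h' U' Q'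
    using \<sigma> quad_op_second_order[OF that(1)] quad_op_second_order[OF that(2)]
    unfolding V_def quad_op_combination[symmetric] by (simp add: proj_equiv_symbol_map_def)
  have sq0: "smooth_quad (\<lambda>x. 0) (\<lambda>p x. 0) (\<lambda>p q x. 0)"
    by (simp add: smooth_quad_def)
  have V_0: "V (\<lambda>x. 0) (\<lambda>p x. 0) (\<lambda>p q x. 0) = (\<lambda>x. 0)"
    using V_combination[OF sq0 sq0, of 0 0] by simp
  have V_sum: "V (\<lambda>x. \<Sum>k\<in>K. h k x) (\<lambda>p x. \<Sum>k\<in>K. U k p x) (\<lambda>p q x. \<Sum>k\<in>K. Q k p q x)
      = (\<lambda>x. \<Sum>k\<in>K. V (h k) (U k) (Q k) x)"
    if "\<And>k. smooth_quad (h k) (U k) (Q k)" for K :: "'n set" and h U Q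
  proof (induction K rule: infinite_finite_induct)
    case (insert k K)
    have "smooth_quad (\<lambda>x. \<Sum>k\<in>K. h k x) (\<lambda>p x. \<Sum>k\<in>K. U k p x) (\<lambda>p q x. \<Sum>k\<in>K. Q k p q x)"
      using that unfolding smooth_quad_def by (simp add: smooth_sum)
    from V_combination[OF that this, of 1 k 1] show ?case
      using insert by simp
  qed (simp_all add: V_0)

  \<comment> \<open>Translations make the value of \<open>V\<close> constant, and then the Euler field multiplies it by \<open>d n\<close>, whereas
    it multiplies the operator by \<open>d n - r\<close>.\<close>
  have vanish: "V (\<lambda>x. 0) U Q = (\<lambda>x. 0)"
    if sm: "smooth_quad (\<lambda>x. 0) U Q" and r: "r \<noteq> 0"
      and tr: "\<And>j. V (\<lambda>x. 0) (\<lambda>p. partial j (U p)) (\<lambda>p q. partial j (Q p q)) = (\<lambda>x. 0)"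
      and eu: "\<And>p x. lie1 d euler U p x = (d * ?N - r) * U p x"
        "\<And>p q x. lie2 d euler Q p q x = (d * ?N - r) * Q p q x"
    for U Q r
  proof -
    have z: "lie_dens d X (\<lambda>x. 0) = (\<lambda>x. 0)" for X :: "real^'n \<Rightarrow> real^'n"
      by (simp add: fun_eq_iff lie_dens_def partial_const)
    have t: "twist1 w (\<lambda>i. 0) U = (\<lambda>x. 0)" "twist2 w (\<lambda>i. 0) Q = (\<lambda>p x. 0)" for U Q
      by (simp_all add: fun_eq_iff twist1_def twist2_def)
    have "partial j (V (\<lambda>x. 0) U Q) x = 0" for j x
    proof -
      have "lie1 d (translation j) U p = partial j (U p)" "lie2 d (translation j) Q p q = partial j (Q p q)" for p q
        by (simp_all add: fun_eq_iff lie1_def lie2_def lie_dens_basic_fields jacobian_basic_fields)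
      then have "lie_dens d (translation j) (V (\<lambda>x. 0) U Q) = (\<lambda>x. 0)"
        using V_lie[OF sm basic_fields_sl(1) projective_basic_fields(1), of j] tr[of j]
        by (simp add: z t lie2_def[abs_def])
      then show ?thesis by (metis lie_dens_basic_fields(1))
    qed
    moreover have "lie_dens d euler (V (\<lambda>x. 0) U Q) = (\<lambda>x. (d * ?N - r) * V (\<lambda>x. 0) U Q x)"
    proof -
      have "lie2 d euler Q = (\<lambda>p q x. (d * ?N - r) * Q p q x)"
        by (intro ext eu)
      then show ?thesis
        using V_lie[OF sm basic_fields_sl(2) projective_basic_fields(2)] V_combination[OF sm sq0, of "d * ?N - r" 0]
        by (simp add: z t eu)
    qed
    then have "lie_dens d euler (V (\<lambda>x. 0) U Q) x = (d * ?N - r) * V (\<lambda>x. 0) U Q x" for x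
      by (rule fun_cong)
    ultimately have "r * V (\<lambda>x. 0) U Q x = 0" for x
      by (simp add: lie_dens_basic_fields left_diff_distrib)
    then show ?thesis using r by (simp add: fun_eq_iff)
  qed
  have euler_unit: "lie_dens d euler (?u r p) x = d * ?N * ?u r p x" for r p x
    by (simp add: lie_dens_basic_fields partial_unit_slot)

  have V_unit: "V (\<lambda>x. 0) (?u r) (\<lambda>p q x. 0) = (\<lambda>x. 0)" for r
  proof (rule vanish[of _ _ 1])
    show "smooth_quad (\<lambda>x. 0) (?u r) (\<lambda>p q x. 0)"
      by (simp add: smooth_quad_def smooth_unit_slot)
    show "V (\<lambda>x. 0) (\<lambda>p. partial j (?u r p)) (\<lambda>p q. partial j (\<lambda>x. 0)) = (\<lambda>x. 0)" for j
      by (simp add: partial_unit_slot[abs_def] partial_const[abs_def] V_0)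
    show "lie1 d euler (?u r) p x = (d * ?N - 1) * ?u r p x" for p x
      by (cases p) (simp add: lie1_def euler_unit jacobian_basic_fields algebra_simps)
    show "lie2 d euler (\<lambda>p q x. 0) p q x = (d * ?N - 1) * 0" for p q and x :: "real^'n"
      by (simp add: lie2_def lie_dens_def partial_const)
  qed simp

  have V_unit_unit: "V (\<lambda>x. 0) (\<lambda>p x. 0) (\<lambda>p q x. ?u r p x * ?u r' q x) = (\<lambda>x. 0)" for r r'
  proof (rule vanish[of _ _ 2])
    show "smooth_quad (\<lambda>x. 0) (\<lambda>p x. 0) (\<lambda>p q x. ?u r p x * ?u r' q x)"
      by (simp add: smooth_quad_def smooth_unit_slot smooth_mult)
    have pc: "partial j (\<lambda>x. ?u r p x * ?u r' q x) = (\<lambda>x. 0)" for j p q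
      by (simp add: fun_eq_iff partial_mult smooth_differentiable smooth_unit_slot partial_unit_slot)
    show "V (\<lambda>x. 0) (\<lambda>p. partial j (\<lambda>x. 0)) (\<lambda>p q. partial j (\<lambda>x. ?u r p x * ?u r' q x)) = (\<lambda>x. 0)" for j
      by (simp add: pc partial_const[abs_def] V_0)
    show "lie1 d euler (\<lambda>p x. 0) p x = (d * ?N - 2) * 0" for p and x :: "real^'n"
      by (simp add: lie1_def lie_dens_def partial_const)
    show "lie2 d euler (\<lambda>p q x. ?u r p x * ?u r' q x) p q x = (d * ?N - 2) * (?u r p x * ?u r' q x)" for p q x
    proof -
      have "lie_dens d euler (\<lambda>x. ?u r p x * ?u r' q x) x = d * ?N * (?u r p x * ?u r' q x)"
        by (simp add: lie_dens_basic_fields pc)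
      then show ?thesis
        by (cases p; cases q) (simp add: lie2_def jacobian_basic_fields algebra_simps)
    qed
  qed simp

  have sm_rad: "smooth_quad (\<lambda>x. 0) (\<lambda>p x. 0) (\<lambda>p q x. radial s p x * ?u r q x)" for s r
    by (simp add: smooth_quad_def smooth_unit_slot smooth_mult smooth_radial)
  have V_radial_unit: "V (\<lambda>x. 0) (\<lambda>p x. 0) (\<lambda>p q x. radial s p x * ?u r q x) = (\<lambda>x. 0)" for s r
  proof (rule vanish[of _ _ 1])
    have pr: "partial j (\<lambda>x. radial s p x * ?u r q x) = (\<lambda>x. ?u (s, j) p x * ?u r q x)" for j p q
      by (simp add: fun_eq_iff partial_mult smooth_differentiable smooth_unit_slot smooth_radial partial_unit_slot partial_radial)
    show "V (\<lambda>x. 0) (\<lambda>p. partial j (\<lambda>x. 0)) (\<lambda>p q. partial j (\<lambda>x. radial s p x * ?u r q x)) = (\<lambda>x. 0)" for j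
      by (simp add: pr partial_const[abs_def] V_unit_unit)
    show "lie1 d euler (\<lambda>p x. 0) p x = (d * ?N - 1) * 0" for p and x :: "real^'n"
      by (simp add: lie1_def lie_dens_def partial_const)
    show "lie2 d euler (\<lambda>p q x. radial s p x * ?u r q x) p q x = (d * ?N - 1) * (radial s p x * ?u r q x)" for p q x
      by (cases p; cases q)
        (simp add: lie2_def lie_dens_basic_fields pr mult.assoc[symmetric] sum_distrib_right[symmetric] sum_radial(2),
         simp add: jacobian_basic_fields algebra_simps)
  qed (simp_all add: sm_rad)

  define e where "e = (\<lambda>x :: real^'n. 1 :: real)"
  \<comment> \<open>the multiplication \<open>(f, g) \<mapsto> f g\<close> fixes the normalisation of \<open>V\<close>\<close>
  have V_1: "V e (\<lambda>p x. 0) (\<lambda>p q x. 0) = e"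
  proof -
    let ?A = "quad_coeffs e (\<lambda>p x. 0) (\<lambda>p q x. 0)"
    have A: "?A \<in> smooth_coeffs"
      by (rule quad_coeffs_smooth) (simp add: smooth_quad_def e_def)
    have "coeff_degree ?A \<le> 0"
    proof (subst coeff_degree_le_iff)
      show "finite (coeff_supp ?A)" using A by (simp add: smooth_coeffs_def)
      show "\<forall>a b. 0 < mi_size a + mi_size b \<longrightarrow> ?A a b = (\<lambda>x. 0)"
      proof (intro allI impI ext)
        fix a b :: "'n multi_index" and x :: "real^'n"
        assume "0 < mi_size a + mi_size b"
        then have "slot_index a b \<noteq> (\<lambda>p. 0)" by (auto simp: mi_size_slot)
        then show "?A a b x = 0" by (simp add: quad_coeffs_def)
      qed
    qed
    then have "\<sigma> (bidiff_op ?A) = bi_symbol_of ?A"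
      using symbol_map_order_0[OF \<sigma> A] by simp
    then show ?thesis
      by (simp add: V_def bidiff_op_quad_coeffs bi_symbol_of_quad_coeffs quad_symbol_0)
  qed

  \<comment> \<open>an element of the kernel of \<open>V\<close> stays there when it is moved along the inversions\<close>
  have V_inversions: "V (\<lambda>x. \<Sum>k\<in>UNIV. - twist1 w (\<lambda>i. of_bool (i = k)) (U k) x)
      (\<lambda>p x. \<Sum>k\<in>UNIV. lie1 d (inversion k) (U k) p x - twist2 w (\<lambda>i. of_bool (i = k)) (Q k) p x)
      (\<lambda>p q x. \<Sum>k\<in>UNIV. lie2 d (inversion k) (Q k) p q x) = (\<lambda>x. 0)"
    if sm: "\<And>k. smooth_quad (\<lambda>x. 0) (U k) (Q k)" and 0: "\<And>k. V (\<lambda>x. 0) (U k) (Q k) = (\<lambda>x. 0)" for U Q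
  proof -
    have z: "lie_dens d X (\<lambda>x. 0) = (\<lambda>x. 0)" for X :: "real^'n \<Rightarrow> real^'n"
      by (simp add: fun_eq_iff lie_dens_def partial_const)
    have "V (\<lambda>x. - twist1 w (\<lambda>i. of_bool (i = k)) (U k) x)
        (\<lambda>p x. lie1 d (inversion k) (U k) p x - twist2 w (\<lambda>i. of_bool (i = k)) (Q k) p x)
        (lie2 d (inversion k) (Q k)) = (\<lambda>x. 0)" for k
      using V_lie[OF sm basic_fields_sl(3) projective_basic_fields(3), of k k] by (simp add: z 0)
    moreover have "smooth_quad (\<lambda>x. - twist1 w (\<lambda>i. of_bool (i = k)) (U k) x)
        (\<lambda>p x. lie1 d (inversion k) (U k) p x - twist2 w (\<lambda>i. of_bool (i = k)) (Q k) p x)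
        (lie2 d (inversion k) (Q k))" for k
      using smooth_quad_lie[OF projective_basic_fields(3) sm, of d k w k] by (simp add: z)
    ultimately show ?thesis
      by (subst V_sum) simp_all
  qed

  have V_radial: "V (\<lambda>x. 0) (radial s) (\<lambda>p q x. 0) = (\<lambda>x. ?N * succ_dim TYPE('n) * w s)" for s
  proof -
    have "V (\<lambda>x. - (?N * succ_dim TYPE('n) * w s)) (radial s) (\<lambda>p q x. 0) = (\<lambda>x. 0)"
    proof -
      have "(\<Sum>k\<in>UNIV. lie1 d (inversion k) (?u (s, k)) p x) = radial s p x" for p x
        unfolding lie1_inversion_unit_slot[OF d(2)] sum_subtractf sum_distrib_left[symmetric] sum_radial(2)
        by (simp add: algebra_simps)
      then show ?thesis
        using V_inversions[of "\<lambda>k. ?u (s, k)" "\<lambda>k p q x. 0"] V_unit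
        by (simp add: smooth_quad_def smooth_unit_slot twist1_inversion_unit_slot twist2_def lie2_def
            lie_dens_def partial_const mult.assoc cong: if_cong)
    qed
    moreover have "V (\<lambda>x. 1 * 0 + - (?N * succ_dim TYPE('n) * w s) * e x) (\<lambda>p x. 1 * radial s p x + - (?N * succ_dim TYPE('n) * w s) * 0) (\<lambda>p q x. 1 * 0 + - (?N * succ_dim TYPE('n) * w s) * 0)
        = (\<lambda>x. 1 * V (\<lambda>x. 0) (radial s) (\<lambda>p q x. 0) x + - (?N * succ_dim TYPE('n) * w s) * V e (\<lambda>p x. 0) (\<lambda>p q x. 0) x)"
      by (rule V_combination) (simp_all add: smooth_quad_def smooth_radial e_def)
    ultimately have "(\<lambda>x. V (\<lambda>x. 0) (radial s) (\<lambda>p q x. 0) x + - (?N * succ_dim TYPE('n) * w s)) = (\<lambda>x. 0)"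
      unfolding V_1 by (simp add: e_def)
    then show ?thesis by (simp add: fun_eq_iff)
  qed

  let ?a = "of_bool (s = t) + succ_dim TYPE('n) * w s" and ?c = "?N * (of_bool (s = t) + succ_dim TYPE('n) * w t)"
  have "V (\<lambda>x. 0) (\<lambda>p x. - ?a * radial t p x + - ?c * radial s p x) (\<lambda>p q x. 0) = (\<lambda>x. 0)"
  proof -
    have "(\<Sum>k\<in>UNIV. lie2 d (inversion k) (\<lambda>p q x. radial s p x * ?u (t, k) q x) p q x) = 0" for p q x
      unfolding lie2_inversion_radial[OF d(2)] sum_distrib_left[symmetric] sum_subtractf sum_radial(2) by simp
    moreover have "(\<Sum>k\<in>UNIV. lie1 d (inversion k) (\<lambda>p x. 0) p x -
        twist2 w (\<lambda>i. of_bool (i = k)) (\<lambda>p q x. radial s p x * ?u (t, k) q x) p x)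
        = - ?a * radial t p x + - ?c * radial s p x" for p x
    proof -
      have sum: "(\<Sum>k\<in>UNIV. 0 - (A * (x $ k * ?u (t, k) p x) + B)) = - A * radial t p x + - (?N * B)" for A B
        unfolding diff_0 sum_negf sum.distrib sum_distrib_left[symmetric] sum_radial(2) by simp
      have zero: "lie1 d (inversion k) (\<lambda>p x. 0) p x = 0" for k
        by (simp add: lie1_def lie_dens_def partial_const)
      show ?thesis
        unfolding twist2_inversion_radial zero sum by (simp only: mult_minus_left mult.assoc)
    qed
    ultimately show ?thesis
      using V_inversions[of "\<lambda>k p x. 0" "\<lambda>k p q x. radial s p x * ?u (t, k) q x"] V_radial_unit sm_rad
      by (simp add: twist1_def)
  qed
  moreover have "V (\<lambda>x. - ?a * 0 + - ?c * 0) (\<lambda>p x. - ?a * radial t p x + - ?c * radial s p x) (\<lambda>p q x. - ?a * 0 + - ?c * 0)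
      = (\<lambda>x. - ?a * V (\<lambda>x. 0) (radial t) (\<lambda>p q x. 0) x + - ?c * V (\<lambda>x. 0) (radial s) (\<lambda>p q x. 0) x)"
    by (rule V_combination) (simp_all add: smooth_quad_def smooth_radial)
  ultimately have "(\<lambda>x :: real^'n. - ?a * (?N * succ_dim TYPE('n) * w t) + - ?c * (?N * succ_dim TYPE('n) * w s)) = (\<lambda>x. 0)"
    unfolding V_radial by simp
  then have "?N * succ_dim TYPE('n) * (?a * w t + ?c * w s) = 0"
    by (simp add: fun_eq_iff algebra_simps)
  then show ?thesis by simp
qed

section \<open>The symbol maps at the resonant weights\<close>

definition slot_divergence :: "('n slot \<Rightarrow> 'n dens) \<Rightarrow> bool \<Rightarrow> ('n::finite) dens" where
  "slot_divergence U s x = (\<Sum>j\<in>UNIV. partial j (U (s, j)) x)"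

text \<open>The corrections are determined by the requirement that their failure to commute with \<open>L\<^sub>X\<close> equals the twist
of the operator. A divergence of \<open>U\<close> fails by \<open>b\<close> contracted with \<open>U\<close>, which fixes the coefficient
\<open>(n + 1) w s\<close>.\<close>
definition correction1 :: "(bool \<Rightarrow> real) \<Rightarrow> ('n slot \<Rightarrow> 'n dens) \<Rightarrow> ('n::finite) dens" where
  "correction1 w U x = (\<Sum>s\<in>UNIV. succ_dim TYPE('n) * w s * slot_divergence U s x)"

text \<open>The side \<open>fst q\<close> of the result is the side over which the divergence is taken, and the remaining index of \<open>Q\<close>
changes its side from \<open>s\<close> to \<open>fst q\<close>. This exchange is forced: the commutator of \<open>L\<^sub>X\<close> with the divergence
exchanges the two coordinates of \<open>Q\<close> but not their sides.\<close>
definition correction2 :: "(bool \<Rightarrow> real) \<Rightarrow> ('n slot \<Rightarrow> 'n slot \<Rightarrow> 'n dens) \<Rightarrow> 'n slot \<Rightarrow> ('n::finite) dens" where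
  "correction2 w Q q x = (\<Sum>s\<in>UNIV. - 2 * (of_bool (s = fst q) + succ_dim TYPE('n) * w s) *
     slot_divergence (\<lambda>p. Q p (s, snd q)) (fst q) x)"

text \<open>The choice of side is arbitrary; only one invariant is needed to violate uniqueness.\<close>
definition double_divergence :: "('n slot \<Rightarrow> 'n slot \<Rightarrow> 'n dens) \<Rightarrow> ('n::finite) dens" where
  "double_divergence Q = slot_divergence (\<lambda>q. slot_divergence (\<lambda>p. Q p q) False) False"

lemma smooth_slot_divergence: "(\<And>p. smooth (U p)) \<Longrightarrow> smooth (slot_divergence U s)"
  unfolding slot_divergence_def[abs_def] by (simp add: smooth_sum smooth_partial)

lemma slot_divergence_combination:
  assumes "\<And>p. smooth (U p)" "\<And>p. smooth (U' p)"
  shows "slot_divergence (\<lambda>p x. a * U p x + c * U' p x) s x = a * slot_divergence U s x + c * slot_divergence U' s x"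
  using assms
  by (simp add: slot_divergence_def partial_add partial_cmult smooth_differentiable smooth_mult sum.distrib sum_distrib_left)

lemma lie_dens_cmult:
  assumes "smooth f"
  shows "lie_dens d X (\<lambda>x. c * f x) x = c * lie_dens d X f x"
  using lie_dens_mult[OF smooth_const[of c] assms, of d 0 d X x] by (simp add: lie_dens_def partial_const)

text \<open>The density weight contributes \<open>(n + 1) d = n + 2\<close> and the tensor action \<open>-(n + 1)\<close>.\<close>
lemma slot_divergence_lie1:
  fixes X :: "real^'n::finite \<Rightarrow> real^'n"
  assumes X: "projective_field X b" and U: "\<And>p. smooth (U p)"
    and d: "d * succ_dim TYPE('n) = succ_dim TYPE('n) + 1"
  shows "slot_divergence (lie1 d X U) s x = lie_dens d X (slot_divergence U s) x + (\<Sum>i\<in>UNIV. b i * U (s, i) x)"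
proof -
  note J = projective_field_smooth(2)[OF X]
  have par: "partial i (lie1 d X U (s, i)) x = lie_dens d X (partial i (U (s, i))) x
      + (\<Sum>k\<in>UNIV. field_jacobian X k i x * partial k (U (s, i)) x)
      + d * succ_dim TYPE('n) * b i * U (s, i) x
      - (b i * U (s, i) x + (\<Sum>j\<in>UNIV. b j * U (s, j) x)
         + (\<Sum>j\<in>UNIV. field_jacobian X i j x * partial i (U (s, j)) x))" for i
  proof -
    have "partial i (lie1 d X U (s, i)) x = partial i (lie_dens d X (U (s, i))) x
        - (\<Sum>j\<in>UNIV. partial i (\<lambda>x. field_jacobian X i j x * U (s, j) x) x)"
      unfolding lie1_def[abs_def] fst_conv snd_conv
      by (subst partial_diff) (simp_all add: partial_sum smooth_differentiable smooth_lie_dens[OF X] smooth_sum smooth_mult J U)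
    also have "(\<Sum>j\<in>UNIV. partial i (\<lambda>x. field_jacobian X i j x * U (s, j) x) x) =
        (\<Sum>j\<in>UNIV. (of_bool (i = j) * b i + b j) * U (s, j) x + field_jacobian X i j x * partial i (U (s, j)) x)"
      by (simp add: partial_mult smooth_differentiable J U partial_jacobian[OF X])
    also have "\<dots> = b i * U (s, i) x + (\<Sum>j\<in>UNIV. b j * U (s, j) x)
         + (\<Sum>j\<in>UNIV. field_jacobian X i j x * partial i (U (s, j)) x)"
      by (simp add: sum.distrib distrib_right mult.assoc)
    finally show ?thesis
      unfolding partial_lie_dens[OF X U] .
  qed
  have swap: "(\<Sum>i\<in>UNIV. \<Sum>k\<in>UNIV. field_jacobian X k i x * partial k (U (s, i)) x) =
      (\<Sum>i\<in>UNIV. \<Sum>j\<in>UNIV. field_jacobian X i j x * partial i (U (s, j)) x)"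
    by (rule sum.swap)
  have lie: "lie_dens d X (slot_divergence U s) x = (\<Sum>i\<in>UNIV. lie_dens d X (partial i (U (s, i))) x)"
    unfolding slot_divergence_def[abs_def] by (rule lie_dens_sum) (simp_all add: smooth_partial U)
  have scale: "(\<Sum>i\<in>UNIV. c * b i * U (s, i) x) = c * (\<Sum>i\<in>UNIV. b i * U (s, i) x)" for c
    by (simp add: sum_distrib_left mult.assoc)
  show ?thesis
    unfolding slot_divergence_def[of "lie1 d X U"] par sum.distrib sum_subtractf lie swap d scale
    by (simp add: algebra_simps)
qed

text \<open>The two contractions of \<open>b\<close> with the index over which the divergence is taken cancel at this weight, and
only the one that exchanges the coordinates of the two slots remains.\<close>
lemma slot_divergence_lie2:
  fixes X :: "real^'n::finite \<Rightarrow> real^'n"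
  assumes X: "projective_field X b" and Q: "\<And>p q. smooth (Q p q)"
    and d: "d * succ_dim TYPE('n) = succ_dim TYPE('n) + 1"
  shows "slot_divergence (\<lambda>p. lie2 d X Q p q) t x =
    lie1 d X (\<lambda>q. slot_divergence (\<lambda>p. Q p q) t) q x - (\<Sum>j\<in>UNIV. b j * Q (t, snd q) (fst q, j) x)"
proof -
  note J = projective_field_smooth(2)[OF X]
  let ?R = "\<lambda>p x. \<Sum>j\<in>UNIV. field_jacobian X (snd q) j x * Q p (fst q, j) x"
  have lie1: "smooth (lie1 d X (\<lambda>p. Q p q) p)" for p
    unfolding lie1_def[abs_def] by (intro smooth_diff smooth_sum smooth_mult smooth_lie_dens[OF X] J Q)
  have R: "smooth (?R p)" for p
    by (intro smooth_sum smooth_mult J Q)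
  have "(\<lambda>p. lie2 d X Q p q) = (\<lambda>p x. 1 * lie1 d X (\<lambda>p. Q p q) p x + - 1 * ?R p x)"
    by (simp add: fun_eq_iff lie2_def lie1_def)
  then have "slot_divergence (\<lambda>p. lie2 d X Q p q) t x = slot_divergence (lie1 d X (\<lambda>p. Q p q)) t x - slot_divergence ?R t x"
    by (simp only: slot_divergence_combination[OF lie1 R])
  also have "slot_divergence (lie1 d X (\<lambda>p. Q p q)) t x =
      lie_dens d X (slot_divergence (\<lambda>p. Q p q) t) x + (\<Sum>i\<in>UNIV. b i * Q (t, i) q x)"
    by (rule slot_divergence_lie1[OF X Q d])
  also have "slot_divergence ?R t x = (\<Sum>i\<in>UNIV. b i * Q (t, i) q x)
      + (\<Sum>j\<in>UNIV. b j * Q (t, snd q) (fst q, j) x)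
      + (\<Sum>j\<in>UNIV. field_jacobian X (snd q) j x * slot_divergence (\<lambda>p. Q p (fst q, j)) t x)"
  proof -
    have "slot_divergence ?R t x = (\<Sum>i\<in>UNIV. \<Sum>j\<in>UNIV. (of_bool (snd q = j) * b i + of_bool (snd q = i) * b j) * Q (t, i) (fst q, j) x
        + field_jacobian X (snd q) j x * partial i (Q (t, i) (fst q, j)) x)"
      by (simp add: slot_divergence_def partial_sum partial_mult smooth_differentiable smooth_mult J Q partial_jacobian[OF X])
    also have "\<dots> = (\<Sum>i\<in>UNIV. \<Sum>j\<in>UNIV. of_bool (snd q = j) * (b i * Q (t, i) (fst q, j) x))
        + (\<Sum>i\<in>UNIV. of_bool (snd q = i) * (\<Sum>j\<in>UNIV. b j * Q (t, i) (fst q, j) x))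
        + (\<Sum>i\<in>UNIV. \<Sum>j\<in>UNIV. field_jacobian X (snd q) j x * partial i (Q (t, i) (fst q, j)) x)"
      by (simp only: sum.distrib distrib_right mult.assoc sum_distrib_left)
    also have "(\<Sum>i\<in>UNIV. \<Sum>j\<in>UNIV. field_jacobian X (snd q) j x * partial i (Q (t, i) (fst q, j)) x) =
        (\<Sum>j\<in>UNIV. field_jacobian X (snd q) j x * slot_divergence (\<lambda>p. Q p (fst q, j)) t x)"
      by (subst sum.swap) (simp add: slot_divergence_def sum_distrib_left)
    finally show ?thesis by simp
  qed
  finally show ?thesis by (simp add: lie1_def)
qed

text \<open>The first divergence leaves a contraction with \<open>-b\<close>, the second one with \<open>b\<close>, of the same divergence of
\<open>Q\<close>.\<close>
lemma double_divergence_lie2: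
  fixes X :: "real^'n::finite \<Rightarrow> real^'n"
  assumes X: "projective_field X b" and Q: "\<And>p q. smooth (Q p q)"
    and d: "d * succ_dim TYPE('n) = succ_dim TYPE('n) + 1"
  shows "double_divergence (lie2 d X Q) x = lie_dens d X (double_divergence Q) x"
proof -
  let ?G = "\<lambda>q. slot_divergence (\<lambda>p. Q p q) False"
  let ?R = "\<lambda>q x. \<Sum>j\<in>UNIV. b j * Q (False, snd q) (fst q, j) x"
  have G: "smooth (?G q)" for q by (rule smooth_slot_divergence) (rule Q)
  have lie1: "smooth (lie1 d X ?G p)" for p
    unfolding lie1_def[abs_def]
    by (intro smooth_diff smooth_sum smooth_mult smooth_lie_dens[OF X] projective_field_smooth[OF X] G)
  have R: "smooth (?R p)" for p
    by (intro smooth_sum smooth_mult smooth_const Q)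
  have "(\<lambda>q. slot_divergence (\<lambda>p. lie2 d X Q p q) False) = (\<lambda>q x. 1 * lie1 d X ?G q x + - 1 * ?R q x)"
    by (simp add: fun_eq_iff slot_divergence_lie2[OF X Q d])
  then have "double_divergence (lie2 d X Q) x = slot_divergence (lie1 d X ?G) False x - slot_divergence ?R False x"
    by (simp only: double_divergence_def slot_divergence_combination[OF lie1 R])
  also have "slot_divergence (lie1 d X ?G) False x = lie_dens d X (double_divergence Q) x + (\<Sum>i\<in>UNIV. b i * ?G (False, i) x)"
    unfolding double_divergence_def by (rule slot_divergence_lie1[OF X G d])
  also have "slot_divergence ?R False x = (\<Sum>i\<in>UNIV. b i * ?G (False, i) x)"
    unfolding slot_divergence_def
    by (simp add: partial_sum partial_cmult smooth_differentiable smooth_mult Q sum_distrib_left) (rule sum.swap)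
  finally show ?thesis by simp
qed

lemma smooth_correction1: "(\<And>p. smooth (U p)) \<Longrightarrow> smooth (correction1 w U)"
  unfolding correction1_def[abs_def] by (intro smooth_sum smooth_mult smooth_const smooth_slot_divergence)

lemma smooth_correction2: "(\<And>p q. smooth (Q p q)) \<Longrightarrow> smooth (correction2 w Q p)"
  unfolding correction2_def[abs_def] by (intro smooth_sum smooth_mult smooth_const smooth_slot_divergence)

lemma smooth_double_divergence: "(\<And>p q. smooth (Q p q)) \<Longrightarrow> smooth (double_divergence Q)"
  unfolding double_divergence_def by (intro smooth_slot_divergence)

lemma sum_combination:
  "(\<Sum>s\<in>S. K s * (a * f s + c * g s)) = a * (\<Sum>s\<in>S. K s * f s) + c * (\<Sum>s\<in>S. K s * g s)"
  for K :: "'a \<Rightarrow> real"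
  by (simp add: sum.distrib sum_distrib_left algebra_simps)

lemma correction1_combination:
  assumes "\<And>p. smooth (U p)" "\<And>p. smooth (U' p)"
  shows "correction1 w (\<lambda>p x. a * U p x + c * U' p x) x = a * correction1 w U x + c * correction1 w U' x"
  unfolding correction1_def slot_divergence_combination[OF assms] by (rule sum_combination)

lemma correction2_combination:
  assumes "\<And>p q. smooth (Q p q)" "\<And>p q. smooth (Q' p q)"
  shows "correction2 w (\<lambda>p q x. a * Q p q x + c * Q' p q x) q x = a * correction2 w Q q x + c * correction2 w Q' q x"
  unfolding correction2_def slot_divergence_combination[OF assms] by (rule sum_combination)

lemma double_divergence_combination:
  assumes "\<And>p q. smooth (Q p q)" "\<And>p q. smooth (Q' p q)"
  shows "double_divergence (\<lambda>p q x. a * Q p q x + c * Q' p q x) x = a * double_divergence Q x + c * double_divergence Q' x"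
proof -
  have "slot_divergence (\<lambda>p x. a * Q p q x + c * Q' p q x) False =
      (\<lambda>x. a * slot_divergence (\<lambda>p. Q p q) False x + c * slot_divergence (\<lambda>p. Q' p q) False x)" for q
    using slot_divergence_combination[of "\<lambda>p. Q p q" "\<lambda>p. Q' p q"] assms by (simp add: fun_eq_iff)
  then show ?thesis
    by (simp add: double_divergence_def slot_divergence_combination smooth_slot_divergence assms)
qed

lemma correction2_lie2:
  fixes X :: "real^'n::finite \<Rightarrow> real^'n"
  assumes X: "projective_field X b" and Q: "\<And>p q. smooth (Q p q)" and sym: "symmetric Q"
    and d: "d * succ_dim TYPE('n) = succ_dim TYPE('n) + 1"
  shows "correction2 w (lie2 d X Q) q x = lie1 d X (correction2 w Q) q x + twist2 w b Q q x"
proof (cases q)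
  case (Pair t k)
  define \<kappa> where "\<kappa> s = of_bool (s = t) + succ_dim TYPE('n) * w s" for s
  let ?G = "\<lambda>q. slot_divergence (\<lambda>p. Q p q) t"
  have G: "smooth (?G q)" for q by (rule smooth_slot_divergence) (rule Q)
  have c2: "correction2 w Q (t, i) = (\<lambda>x. \<Sum>s\<in>UNIV. - 2 * \<kappa> s * ?G (s, i) x)" for i
    by (simp add: fun_eq_iff correction2_def \<kappa>_def)
  have "lie_dens d X (\<lambda>x. \<Sum>s\<in>UNIV. - 2 * \<kappa> s * ?G (s, k) x) x = (\<Sum>s\<in>UNIV. - 2 * \<kappa> s * lie_dens d X (?G (s, k)) x)"
  proof (subst lie_dens_sum)
    show "smooth (\<lambda>x. - 2 * \<kappa> s * ?G (s, k) x)" for s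
      by (intro smooth_mult smooth_const G)
    show "(\<Sum>s\<in>UNIV. lie_dens d X (\<lambda>x. - 2 * \<kappa> s * ?G (s, k) x) x) = (\<Sum>s\<in>UNIV. - 2 * \<kappa> s * lie_dens d X (?G (s, k)) x)"
      by (intro sum.cong refl lie_dens_cmult G)
  qed simp
  then have "lie1 d X (correction2 w Q) (t, k) x = (\<Sum>s\<in>UNIV. - 2 * \<kappa> s * lie1 d X ?G (s, k) x)"
    unfolding lie1_def fst_conv snd_conv c2
    by (simp add: right_diff_distrib sum_subtractf sum_distrib_left mult_ac sum.swap[of _ "UNIV :: 'n set" "UNIV :: bool set"] sum_negf)
  moreover have "correction2 w (lie2 d X Q) (t, k) x =
      (\<Sum>s\<in>UNIV. - 2 * \<kappa> s * lie1 d X ?G (s, k) x) + (\<Sum>s\<in>UNIV. \<Sum>j\<in>UNIV. 2 * \<kappa> s * (b j * Q (t, k) (s, j) x))"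
    unfolding correction2_def slot_divergence_lie2[OF X Q d] fst_conv snd_conv \<kappa>_def[symmetric]
    by (simp add: right_diff_distrib sum_subtractf sum_distrib_left sum_negf mult_ac)
  moreover have "twist2 w b Q (t, k) x = (\<Sum>s\<in>UNIV. \<Sum>j\<in>UNIV. 2 * \<kappa> s * (b j * Q (t, k) (s, j) x))"
  proof -
    have flip: "Q p (t, k) = Q (t, k) p" for p using sym unfolding symmetric_def by blast
    show ?thesis
      unfolding twist2_def sum_slot fst_conv snd_conv flip \<kappa>_def[symmetric]
      by (simp add: UNIV_bool mult_ac)
  qed
  ultimately show ?thesis by (simp add: Pair)
qed

lemma correction1_lie1:
  fixes X :: "real^'n::finite \<Rightarrow> real^'n"
  assumes X: "projective_field X b" and U: "\<And>p. smooth (U p)"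
    and d: "d * succ_dim TYPE('n) = succ_dim TYPE('n) + 1"
  shows "correction1 w (lie1 d X U) x = lie_dens d X (correction1 w U) x + twist1 w b U x"
proof -
  have "lie_dens d X (correction1 w U) x = (\<Sum>s\<in>UNIV. succ_dim TYPE('n) * w s * lie_dens d X (slot_divergence U s) x)"
    unfolding correction1_def[abs_def]
    by (subst lie_dens_sum) (simp_all only: finite_class.finite_UNIV smooth_mult smooth_const smooth_slot_divergence U lie_dens_cmult)
  moreover have "twist1 w b U x = (\<Sum>s\<in>UNIV. succ_dim TYPE('n) * w s * (\<Sum>i\<in>UNIV. b i * U (s, i) x))"
    by (simp add: twist1_def sum_slot UNIV_bool sum_distrib_left mult_ac)
  ultimately show ?thesis
    by (simp add: correction1_def slot_divergence_lie1[OF X U d] sum.distrib distrib_left)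
qed

text \<open>This is the only place where the weights are restricted. A side of weight zero is skipped by
\<open>correction1\<close>, and on any other side \<open>twist2\<close> is zero by assumption.\<close>
lemma correction1_twist2:
  fixes Q :: "'n slot \<Rightarrow> 'n slot \<Rightarrow> ('n::finite) dens"
  assumes w: "\<And>s t. w t * (of_bool (s = t) + succ_dim TYPE('n) * w s) = 0"
  shows "correction1 w (twist2 w b Q) x = 0"
proof -
  have "w t * slot_divergence (twist2 w b Q) t x = 0" for t
  proof (cases "w t = 0")
    case False
    then have "of_bool (s = t) + succ_dim TYPE('n) * w s = 0" for s using w[of t s] by simp
    then have "twist2 w b Q (t, k) = (\<lambda>x. 0)" for k
      by (simp add: fun_eq_iff twist2_def)
    then show ?thesis by (simp add: slot_divergence_def partial_const)
  qed simp
  then show ?thesis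
    by (simp only: correction1_def mult.assoc mult_zero_right sum.neutral_const)
qed

definition corrected_symbol ::
    "(bool \<Rightarrow> real) \<Rightarrow> real \<Rightarrow> 'n dens \<Rightarrow> ('n slot \<Rightarrow> 'n dens) \<Rightarrow> ('n slot \<Rightarrow> 'n slot \<Rightarrow> 'n dens) \<Rightarrow> ('n::finite) bi_symbol" where
  "corrected_symbol w e h U Q =
     quad_symbol (\<lambda>x. h x + correction1 w U x + e * double_divergence Q x) (\<lambda>p x. U p x + correction2 w Q p x) Q"

lemma smooth_quadD:
  assumes "smooth_quad h U Q"
  shows "smooth h" "smooth (U p)" "smooth (Q p q)"
  using assms unfolding smooth_quad_def by blast+

lemma smooth_quad_corrected:
  assumes "smooth_quad h U Q"
  shows "smooth_quad (\<lambda>x. h x + correction1 w U x + e * double_divergence Q x) (\<lambda>p x. U p x + correction2 w Q p x) Q"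
  unfolding smooth_quad_def
  by (intro conjI allI smooth_add smooth_mult smooth_const smooth_correction1 smooth_correction2
      smooth_double_divergence smooth_quadD[OF assms])

lemma symmetric_lie2:
  assumes "symmetric Q"
  shows "symmetric (lie2 d X Q)"
  unfolding symmetric_def
proof (intro allI ext)
  fix p q x
  have s: "Q r r' = Q r' r" for r r'
    using assms unfolding symmetric_def by blast
  show "lie2 d X Q p q x = lie2 d X Q q p x"
    unfolding lie2_def s[of q p] s[of "(fst q, _)" p] s[of q "(fst p, _)"] by simp
qed

text \<open>The three lines of the cohomological equation: in degree two there is nothing to do, in degree one
\<open>correction2\<close> cancels \<open>twist2\<close>, and in degree zero \<open>correction1\<close> cancels \<open>twist1\<close>, while its value on
\<open>twist2\<close> vanishes and the double divergence commutes with \<open>L\<^sub>X\<close>.\<close>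
lemma corrected_symbol_equivariant:
  fixes X :: "real^'n::finite \<Rightarrow> real^'n"
  assumes X: "projective_field X b" and q: "smooth_quad h U Q" and sym: "symmetric Q"
    and d: "d * succ_dim TYPE('n) = succ_dim TYPE('n) + 1"
    and w: "\<And>s t. w t * (of_bool (s = t) + succ_dim TYPE('n) * w s) = 0"
  shows "corrected_symbol w e (\<lambda>x. lie_dens d X h x - twist1 w b U x)
      (\<lambda>p x. lie1 d X U p x - twist2 w b Q p x) (lie2 d X Q) =
    lie_symbol d X (corrected_symbol w e h U Q)"
proof -
  note sm = smooth_quadD[OF q]
  note sc = smooth_correction1[OF sm(2)] smooth_correction2[OF sm(3)] smooth_double_divergence[OF sm(3)]
  have lie1: "smooth (lie1 d X U p)" for p
    unfolding lie1_def[abs_def]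
    by (intro smooth_diff smooth_sum smooth_mult smooth_lie_dens[OF X] projective_field_smooth[OF X] sm)
  have tw2: "smooth (twist2 w b Q p)" for p
    unfolding twist2_def[abs_def] by (intro smooth_sum smooth_mult smooth_add smooth_const sm)
  have h: "lie_dens d X h x - twist1 w b U x + correction1 w (\<lambda>p x. lie1 d X U p x - twist2 w b Q p x) x
      + e * double_divergence (lie2 d X Q) x =
    lie_dens d X (\<lambda>x. h x + correction1 w U x + e * double_divergence Q x) x" for x
  proof -
    have "correction1 w (\<lambda>p x. lie1 d X U p x - twist2 w b Q p x) x =
        correction1 w (lie1 d X U) x - correction1 w (twist2 w b Q) x"
      using correction1_combination[OF lie1 tw2, where a=1 and c="-1"] by simp
    moreover have "lie_dens d X (\<lambda>x. e * double_divergence Q x) x = e * lie_dens d X (double_divergence Q) x"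
      by (rule lie_dens_cmult[OF sc(3)])
    ultimately show ?thesis
      by (simp add: lie_dens_add smooth_add smooth_mult sm sc correction1_lie1[OF X sm(2) d]
          correction1_twist2[OF w] double_divergence_lie2[OF X sm(3) d])
  qed
  have U: "lie1 d X U p x - twist2 w b Q p x + correction2 w (lie2 d X Q) p x =
      lie1 d X (\<lambda>p x. U p x + correction2 w Q p x) p x" for p x
    by (simp add: correction2_lie2[OF X sm(3) sym d])
      (simp add: lie1_def lie_dens_add sm sc distrib_left sum.distrib)
  show ?thesis
    unfolding corrected_symbol_def lie_symbol_quad_symbol[OF smooth_quad_corrected[OF q]] h U ..
qed

text \<open>Modifying coefficients of degree below the order changes neither the order nor the principal part.\<close>
lemma same_principal_part:
  assumes A: "finite (coeff_supp A)" and B: "finite (coeff_supp B)"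
    and eq: "\<And>a b. coeff_degree A \<le> mi_size a + mi_size b \<Longrightarrow> B a b = A a b"
  shows "coeff_degree B = coeff_degree A"
    and "coeff_component (coeff_degree A) B = coeff_component (coeff_degree A) A"
proof -
  have "B a b = (\<lambda>x. 0)" if "coeff_degree A < mi_size a + mi_size b" for a b
    using that eq[of a b] coeff_degree_le_iff[OF A, of "coeff_degree A"] by (metis less_imp_le order_refl)
  then have le: "coeff_degree B \<le> coeff_degree A"
    using coeff_degree_le_iff[OF B] by blast
  show "coeff_degree B = coeff_degree A"
  proof (rule ccontr)
    assume "coeff_degree B \<noteq> coeff_degree A"
    then have less: "coeff_degree B < coeff_degree A" using le by simp
    have "A a b = (\<lambda>x. 0)" if "coeff_degree A - 1 < mi_size a + mi_size b" for a b
    proof -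
      have "coeff_degree A \<le> mi_size a + mi_size b" using that by linarith
      moreover have "B a b = (\<lambda>x. 0)"
        using coeff_degree_le_iff[OF B, of "coeff_degree B"] calculation less
        by (meson less_le_trans order_refl)
      ultimately show ?thesis using eq by simp
    qed
    then have "coeff_degree A \<le> coeff_degree A - 1"
      using coeff_degree_le_iff[OF A] by blast
    then show False using less by linarith
  qed
  show "coeff_component (coeff_degree A) B = coeff_component (coeff_degree A) A"
    by (intro ext) (simp add: coeff_component_def eq)
qed

lemma quad_coeffs_low_degree:
  assumes "smooth_quad h U Q" "coeff_degree (quad_coeffs h U Q) \<le> r" "symmetric Q"
  shows "r < 2 \<Longrightarrow> Q = (\<lambda>p q x. 0)" and "r < 1 \<Longrightarrow> U = (\<lambda>p x. 0)"
proof -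
  have fin: "finite (coeff_supp (quad_coeffs h U Q))"
    using quad_coeffs_smooth[OF assms(1)] by (simp add: smooth_coeffs_def)
  have zero: "quad_coeffs h U Q (left_index c) (right_index c) x = 0" if "r < (\<Sum>p\<in>UNIV. c p)" for c x
  proof -
    have "r < mi_size (left_index c) + mi_size (right_index c)"
      using that by (simp add: mi_size_slot)
    then show ?thesis
      using coeff_degree_le_iff[OF fin] assms(2) by metis
  qed
  show "Q = (\<lambda>p q x. 0)" if "r < 2"
  proof (intro ext)
    fix p q x
    have "Q q p = Q p q" using assms(3) unfolding symmetric_def by blast
    then show "Q p q x = 0"
      using zero[of "index2 p q" x] that unfolding quad_coeffs_eval by (cases "p = q") simp_all
  qed
  show "U = (\<lambda>p x. 0)" if "r < 1"
    using zero[of "index1 _"] that unfolding quad_coeffs_eval by (intro ext) simp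
qed

lemma corrections_zero:
  "correction1 w (\<lambda>p x. 0) x = 0" "correction2 w (\<lambda>p q x. 0) p x = 0" "double_divergence (\<lambda>p q x. 0) x = 0"
  by (simp_all add: correction1_def correction2_def double_divergence_def slot_divergence_def[abs_def] partial_const)

text \<open>Corrections go from higher to lower degree. The coefficients of degree \<open>k\<close> are only changed if there are
nonzero ones of a higher degree, that is, if \<open>k\<close> is below the order.\<close>
lemma corrected_principal_part:
  fixes h :: "('n::finite) dens" and w :: "bool \<Rightarrow> real" and e :: real
  assumes q: "smooth_quad h U Q" and sym: "symmetric Q"
  defines "A \<equiv> quad_coeffs h U Q"
    and "B \<equiv> quad_coeffs (\<lambda>x. h x + correction1 w U x + e * double_divergence Q x) (\<lambda>p x. U p x + correction2 w Q p x) Q"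
  shows "coeff_degree B = coeff_degree A"
    and "coeff_component (coeff_degree A) B = coeff_component (coeff_degree A) A"
proof -
  have fin: "finite (coeff_supp A)" "finite (coeff_supp B)"
    using quad_coeffs_smooth[OF q] quad_coeffs_smooth[OF smooth_quad_corrected[OF q]]
    by (simp_all add: A_def B_def smooth_coeffs_def)
  have eq: "B a b = A a b" if deg: "coeff_degree A \<le> mi_size a + mi_size b" for a b
  proof (cases "mi_size a + mi_size b \<le> 2")
    case True
    then have "(\<Sum>p\<in>UNIV. slot_index a b p) \<le> 2" by (simp add: mi_size_slot)
    then show ?thesis
    proof (cases rule: index_cases)
      case 1
      then have ab: "a = left_index (\<lambda>p. 0)" "b = right_index (\<lambda>p. 0)" and "mi_size a + mi_size b = 0"
        by (simp_all add: slot_index_eq_iff mi_size_slot)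
      then have "coeff_degree (quad_coeffs h U Q) \<le> 0" using deg by (simp add: A_def)
      from quad_coeffs_low_degree[OF q this sym] have "U = (\<lambda>p x. 0)" "Q = (\<lambda>p q x. 0)"
        by simp_all
      then show ?thesis
        unfolding A_def B_def ab quad_coeffs_eval[abs_def] by (simp add: corrections_zero)
    next
      case (2 p)
      then have ab: "a = left_index (index1 p)" "b = right_index (index1 p)"
        by (simp_all add: slot_index_eq_iff)
      have "mi_size a + mi_size b = 1" using 2 by (simp only: mi_size_slot sum_index)
      then have "coeff_degree (quad_coeffs h U Q) \<le> 1" using deg by (simp add: A_def)
      from quad_coeffs_low_degree(1)[OF q this sym] have "Q = (\<lambda>p q x. 0)"
        by simp
      then show ?thesis
        unfolding A_def B_def ab quad_coeffs_eval[abs_def] by (simp add: corrections_zero)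
    next
      case (3 p q)
      then have ab: "a = left_index (index2 p q)" "b = right_index (index2 p q)"
        by (simp_all add: slot_index_eq_iff)
      show ?thesis
        unfolding A_def B_def ab quad_coeffs_eval[abs_def] ..
    qed
  next
    case False
    then have "(a, b) \<notin> coeff_supp A" "(a, b) \<notin> coeff_supp B"
      using coeff_supp_quad_coeffs small_indices_iff unfolding A_def B_def by blast+
    then show ?thesis by (simp add: coeff_supp_def)
  qed
  show "coeff_degree B = coeff_degree A"
    and "coeff_component (coeff_degree A) B = coeff_component (coeff_degree A) A"
    by (rule same_principal_part[OF fin eq]; assumption)+
qed

text \<open>The parameter \<open>e\<close> is the multiple of the invariant double divergence that is added.\<close>
definition symbol_map :: "(bool \<Rightarrow> real) \<Rightarrow> real \<Rightarrow> ('n::finite) bi_operator \<Rightarrow> 'n bi_symbol" where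
  "symbol_map w e T = (THE P. \<exists>h U Q. smooth_quad h U Q \<and> symmetric Q \<and>
     T = quad_op h U Q \<and> P = corrected_symbol w e h U Q)"

lemma symbol_map_quad_op:
  assumes "smooth_quad h U Q" "symmetric Q"
  shows "symbol_map w e (quad_op h U Q) = corrected_symbol w e h U Q"
  unfolding symbol_map_def
proof (rule the_equality)
  show "\<exists>h' U' Q'. smooth_quad h' U' Q' \<and> symmetric Q' \<and>
      quad_op h U Q = quad_op h' U' Q' \<and> corrected_symbol w e h U Q = corrected_symbol w e h' U' Q'"
    using assms by blast
  fix P
  assume "\<exists>h' U' Q'. smooth_quad h' U' Q' \<and> symmetric Q' \<and>
      quad_op h U Q = quad_op h' U' Q' \<and> P = corrected_symbol w e h' U' Q'"
  then obtain h' U' Q' where *: "smooth_quad h' U' Q'" "symmetric Q'" "quad_op h U Q = quad_op h' U' Q'"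
    "P = corrected_symbol w e h' U' Q'"
    by blast
  then show "P = corrected_symbol w e h U Q"
    using quad_op_inj[OF assms *(1-3)] by simp
qed

text \<open>The correction is unipotent with respect to the degree: \<open>Q\<close>, \<open>U\<close> and \<open>h\<close> are recovered one after the other
from the corrected triple.\<close>
lemma symbol_map_bij:
  "bij_betw (symbol_map w e) second_order_ops (second_order_symbols :: ('n::finite) bi_symbol set)"
  unfolding bij_betw_def
proof
  show "inj_on (symbol_map w e) (second_order_ops :: 'n bi_operator set)"
  proof (rule inj_onI)
    fix S T :: "'n bi_operator"
    assume "S \<in> second_order_ops" "T \<in> second_order_ops" and eq: "symbol_map w e S = symbol_map w e T"
    then obtain h U Q h' U' Q' where q: "smooth_quad h U Q" "symmetric Q" "S = quad_op h U Q"
      and q': "smooth_quad h' U' Q'" "symmetric Q'" "T = quad_op h' U' Q'"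
      using second_order_op_cases by metis
    have "corrected_symbol w e h U Q = corrected_symbol w e h' U' Q'"
      using eq by (simp add: q(3) q'(3) symbol_map_quad_op[OF q(1,2)] symbol_map_quad_op[OF q'(1,2)])
    note * = quad_symbol_inj[OF smooth_quad_corrected[OF q(1)] q(2) smooth_quad_corrected[OF q'(1)] q'(2)
        this[unfolded corrected_symbol_def]]
    then have Q: "Q = Q'" by blast
    have U: "U = U'"
    proof (intro ext)
      fix p x
      have "U p x + correction2 w Q p x = U' p x + correction2 w Q' p x"
        using * by meson
      then show "U p x = U' p x" by (simp add: Q)
    qed
    have "h = h'"
    proof
      fix x
      have "h x + correction1 w U x + e * double_divergence Q x = h' x + correction1 w U' x + e * double_divergence Q' x"
        using * by meson
      then show "h x = h' x" by (simp add: Q U)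
    qed
    then show "S = T" by (simp add: q(3) q'(3) Q U)
  qed
  show "symbol_map w e ` second_order_ops = (second_order_symbols :: 'n bi_symbol set)"
  proof (intro equalityI subsetI)
    fix P assume "P \<in> symbol_map w e ` second_order_ops"
    then obtain T where T: "T \<in> second_order_ops" "P = symbol_map w e T" by blast
    obtain h U Q where q: "smooth_quad h U Q" "symmetric Q" "T = quad_op h U Q"
      using second_order_op_cases[OF T(1)] .
    show "P \<in> second_order_symbols"
      unfolding T(2) q(3) symbol_map_quad_op[OF q(1,2)] corrected_symbol_def
      by (rule quad_symbol_second_order[OF smooth_quad_corrected[OF q(1)]])
  next
    fix P :: "'n bi_symbol" assume "P \<in> second_order_symbols"
    then obtain h U Q where q: "smooth_quad h U Q" "symmetric Q" "P = quad_symbol h U Q"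
      using second_order_symbol_cases by blast
    define U' where "U' = (\<lambda>p x. U p x - correction2 w Q p x)"
    define h' where "h' = (\<lambda>x. h x - correction1 w U' x - e * double_divergence Q x)"
    note sm = smooth_quadD[OF q(1)]
    have U': "smooth (U' p)" for p
      unfolding U'_def by (intro smooth_diff smooth_correction2 sm)
    have q': "smooth_quad h' U' Q"
      unfolding smooth_quad_def h'_def
      by (intro conjI allI smooth_diff smooth_mult smooth_const smooth_correction1 smooth_double_divergence sm U')
    have "symbol_map w e (quad_op h' U' Q) = P"
      unfolding symbol_map_quad_op[OF q' q(2)] corrected_symbol_def q(3) by (simp add: h'_def U'_def)
    then show "P \<in> symbol_map w e ` second_order_ops"
      using quad_op_second_order[OF q'] by blast
  qed
qed

lemma symbol_map_combination:
  assumes q: "smooth_quad h U Q" "symmetric Q" and q': "smooth_quad h' U' Q'" "symmetric Q'"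
  shows "symbol_map w e (\<lambda>f g x. c * quad_op h U Q f g x + d * quad_op h' U' Q' f g x) =
    (\<lambda>x \<alpha> \<beta>. c * symbol_map w e (quad_op h U Q) x \<alpha> \<beta> + d * symbol_map w e (quad_op h' U' Q') x \<alpha> \<beta>)"
proof -
  note sm = smooth_quadD[OF q(1)] and sm' = smooth_quadD[OF q'(1)]
  have sym: "symmetric (\<lambda>p r x. c * Q p r x + d * Q' p r x)"
    unfolding symmetric_def
  proof (intro allI ext)
    fix p r x
    have "Q p r = Q r p" "Q' p r = Q' r p" using q(2) q'(2) unfolding symmetric_def by blast+
    then show "c * Q p r x + d * Q' p r x = c * Q r p x + d * Q' r p x" by simp
  qed
  show ?thesis
    unfolding quad_op_combination symbol_map_quad_op[OF smooth_quad_combination[OF q(1) q'(1)] sym]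
      symbol_map_quad_op[OF q] symbol_map_quad_op[OF q'] corrected_symbol_def
      correction1_combination[OF sm(2) sm'(2)] correction2_combination[OF sm(3) sm'(3)]
      double_divergence_combination[OF sm(3) sm'(3)]
    by (intro ext) (simp add: quad_symbol_def sum.distrib sum_distrib_left algebra_simps)
qed

lemma proj_equiv_symbol_map_symbol_map:
  assumes m: "m = d + w False + w True" and d: "d * succ_dim TYPE('n) = succ_dim TYPE('n) + 1"
    and w: "\<And>s t. w t * (of_bool (s = t) + succ_dim TYPE('n) * w s) = 0"
  shows "proj_equiv_symbol_map (w False) (w True) m (symbol_map w e :: ('n::finite) bi_operator \<Rightarrow> _)"
  unfolding proj_equiv_symbol_map_def
proof (intro conjI ballI allI)
  show "bij_betw (symbol_map w e) second_order_ops second_order_symbols"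
    by (rule symbol_map_bij)
next
  fix S T :: "'n bi_operator" and c a :: real
  assume "S \<in> second_order_ops" "T \<in> second_order_ops"
  then obtain h U Q h' U' Q' where "smooth_quad h U Q" "symmetric Q" "S = quad_op h U Q"
      and "smooth_quad h' U' Q'" "symmetric Q'" "T = quad_op h' U' Q'"
    using second_order_op_cases by metis
  then show "symbol_map w e (\<lambda>f g x. c * S f g x + a * T f g x) =
      (\<lambda>x \<alpha> \<beta>. c * symbol_map w e S x \<alpha> \<beta> + a * symbol_map w e T x \<alpha> \<beta>)"
    using symbol_map_combination by blast
next
  fix T :: "'n bi_operator" assume "T \<in> second_order_ops"
  then obtain h U Q where q: "smooth_quad h U Q" "symmetric Q" "T = quad_op h U Q"
    using second_order_op_cases by blast
  note A = quad_coeffs_smooth[OF q(1)] and B = quad_coeffs_smooth[OF smooth_quad_corrected[OF q(1)]]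
  note pr = corrected_principal_part[OF q(1,2), of w e]
  have T: "T = bidiff_op (quad_coeffs h U Q)" by (simp add: q(3) bidiff_op_quad_coeffs)
  have \<sigma>: "symbol_map w e T = bi_symbol_of (quad_coeffs (\<lambda>x. h x + correction1 w U x + e * double_divergence Q x)
      (\<lambda>p x. U p x + correction2 w Q p x) Q)"
    unfolding q(3) symbol_map_quad_op[OF q(1,2)] corrected_symbol_def bi_symbol_of_quad_coeffs ..
  show "symbol_degree (symbol_map w e T) = total_order T"
    unfolding \<sigma> unfolding T by (simp add: principal_symbol_bidiff_op[OF A] principal_symbol_bidiff_op[OF B] pr(1))
  show "hom_component (total_order T) (symbol_map w e T) = principal_symbol T"
    unfolding \<sigma> unfolding T by (simp add: principal_symbol_bidiff_op[OF A] principal_symbol_bidiff_op[OF B] pr(2))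
next
  fix X :: "real^'n \<Rightarrow> real^'n" and T :: "'n bi_operator"
  assume "X \<in> sl_fields" "T \<in> second_order_ops"
  then obtain c A b where X: "X = sl_field c A b" unfolding sl_fields_eq by blast
  have Xb: "projective_field X b" unfolding X by (rule projective_sl_field)
  obtain h U Q where q: "smooth_quad h U Q" "symmetric Q" "T = quad_op h U Q"
    using second_order_op_cases[OF \<open>T \<in> second_order_ops\<close>] .
  have "m - w False - w True = d" using m by simp
  then show "symbol_map w e (lie_op (w False) (w True) m X T) = lie_symbol (m - w False - w True) X (symbol_map w e T)"
    unfolding q(3) lie_op_quad_op[OF Xb q(1) m] symbol_map_quad_op[OF q(1,2)]
      symbol_map_quad_op[OF smooth_quad_lie[OF Xb q(1)] symmetric_lie2[OF q(2)]]
    using corrected_symbol_equivariant[OF Xb q(1,2) d w] by simp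
qed

text \<open>The operator with symbol \<open>(x\<^sup>i)\<^sup>2 \<alpha>\<^sub>i\<^sup>2\<close> has double divergence \<open>2\<close>.\<close>
lemma symbol_map_not_unique:
  "\<exists>T\<in>second_order_ops. symbol_map w 0 T \<noteq> (symbol_map w 1 T :: ('n::finite) bi_symbol)"
proof -
  fix i :: 'n
  define Q where "Q p q x = of_bool (p = (False, i)) * of_bool (q = (False, i)) * ((x $ i) * (x $ i))"
    for p q :: "'n slot" and x :: "real^'n"
  let ?o = "\<lambda>x :: real^'n. 0 :: real"
  have q: "smooth_quad ?o (\<lambda>p. ?o) Q"
    unfolding smooth_quad_def Q_def[abs_def] by (simp add: smooth_mult)
  have sym: "symmetric Q"
    by (simp add: symmetric_def Q_def[abs_def] mult_ac)
  have 1: "partial j (Q (False, j) q) x = of_bool (j = i) * (of_bool (q = (False, i)) * (2 * x $ i))" for j q x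
    unfolding Q_def[abs_def]
    by (simp add: partial_cmult partial_mult partial_coord partial_const smooth_differentiable smooth_mult algebra_simps)
  have inner: "slot_divergence (\<lambda>p. Q p q) False = (\<lambda>x. of_bool (q = (False, i)) * (2 * x $ i))" for q
    by (simp add: fun_eq_iff slot_divergence_def 1)
  have "double_divergence Q x = (\<Sum>k\<in>UNIV. partial k (\<lambda>x. of_bool (k = i) * (2 * x $ i)) x)" for x
    unfolding double_divergence_def inner unfolding slot_divergence_def by simp
  then have "double_divergence Q x = 2" for x
    by (simp add: partial_cmult partial_coord smooth_differentiable smooth_mult)
  then have "symbol_map w e (quad_op ?o (\<lambda>p. ?o) Q) 0 0 0 = e * 2" for e
    unfolding symbol_map_quad_op[OF q sym] corrected_symbol_def quad_symbol_0 by (simp add: corrections_zero)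
  then have "symbol_map w 0 (quad_op ?o (\<lambda>p. ?o) Q) 0 0 0 \<noteq> symbol_map w 1 (quad_op ?o (\<lambda>p. ?o) Q) 0 0 0"
    by simp
  then show ?thesis
    using quad_op_second_order[OF q] by metis
qed

theorem proposition13:
  fixes l1 l2 \<mu> \<delta> n :: real and \<Lambda> :: "(real \<times> real) set"
  assumes "CARD('n::finite) \<ge> 2" and "n = real CARD('n)"
    and "\<delta> = \<mu> - l1 - l2"
    and "\<Lambda> = {(0, -1 / (n + 1)), (-1 / (n + 1), 0), (0, 0)}"
    and "\<delta> = (n + 2) / (n + 1)"
  shows "((\<exists>\<sigma> :: 'n bi_operator \<Rightarrow> 'n bi_symbol. proj_equiv_symbol_map l1 l2 \<mu> \<sigma>)
            \<longleftrightarrow> (l1, l2) \<in> \<Lambda>)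
       \<and> ((l1, l2) \<in> \<Lambda> \<longrightarrow>
            (\<exists>(\<sigma> :: 'n bi_operator \<Rightarrow> 'n bi_symbol) \<tau>.
               proj_equiv_symbol_map l1 l2 \<mu> \<sigma> \<and> proj_equiv_symbol_map l1 l2 \<mu> \<tau> \<and>
               (\<exists>T\<in>second_order_ops. \<sigma> T \<noteq> \<tau> T)))"
proof -
  define w where "w s = (if s then l2 else l1)" for s
  have w: "w False = l1" "w True = l2" by (simp_all add: w_def)
  have n: "n > 0" using assms(2) by simp
  have m: "\<mu> = \<delta> + w False + w True" using assms(3) by (simp add: w)
  have d: "\<delta> * succ_dim TYPE('n) = succ_dim TYPE('n) + 1"
    using n by (simp add: assms(2,5) add_pos_nonneg)
  have factor: "l = 0 \<or> l = -1 / (n + 1)" if "l * (1 + (n + 1) * l) = 0" for l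
  proof -
    have "l = -1 / (n + 1)" if "1 + (n + 1) * l = 0"
    proof -
      have "n + 1 \<noteq> 0" using n by simp
      moreover have "l * (n + 1) = -1" using that by (simp add: algebra_simps)
      ultimately show ?thesis using nonzero_eq_divide_eq by blast
    qed
    then show ?thesis using that by auto
  qed
  have nec: "(l1, l2) \<in> \<Lambda>" if "proj_equiv_symbol_map l1 l2 \<mu> \<sigma>" for \<sigma> :: "'n bi_operator \<Rightarrow> 'n bi_symbol"
  proof -
    note ob = symbol_map_obstruction[OF that[folded w] m d, folded assms(2)]
    have same: "w s * (1 + (n + 1) * w s) = 0" for s
    proof -
      have "(n + 1) * (w s * (1 + (n + 1) * w s)) = 0"
        using ob[of s s] by (simp add: algebra_simps)
      then show ?thesis using n by simp
    qed
    have "(n + 1) * (n + 1) * (l1 * l2) = 0"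
      using ob[of False True] by (simp add: w algebra_simps)
    then have "l1 = 0 \<or> l2 = 0" using n by simp
    then show ?thesis
      using factor[OF same[of False, unfolded w]] factor[OF same[of True, unfolded w]] assms(4) by auto
  qed
  have suf: "proj_equiv_symbol_map l1 l2 \<mu> (symbol_map w e :: 'n bi_operator \<Rightarrow> _)" if "(l1, l2) \<in> \<Lambda>" for e
  proof -
    define r where "r = -1 / (n + 1)"
    have r: "(n + 1) * r = -1" using n by (simp add: r_def)
    have "w t * (of_bool (s = t) + succ_dim TYPE('n) * w s) = 0" for s t
      using that unfolding assms(4) assms(2)[symmetric] r_def[symmetric]
      by (cases s; cases t) (auto simp: w r)
    then show ?thesis using proj_equiv_symbol_map_symbol_map[OF m d, of e] by (simp add: w)
  qed
  show ?thesis
    using nec suf symbol_map_not_unique by blast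
qed

end
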